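(* Let $G$ be a non-discrete Polish Abelian group and let $\kappa$ be a cardinal such that (i) $1\le\kappa\le|G|$, (ii) $\kappa\ne 2$ if $G=[G]_3$, and (iii) $\kappa\ne 3$ if $\big|G/[G]_2\big|\le 2$. Then: (1) the group $G$ contains a nowhere dense Haar null subset $A$ such that $\mathrm{ind}_P(A)=\mathrm{Ind}_P(A)=\kappa$; (2) if $\mathrm{cov}(\mathbb{K})=\mathfrak{c}$, then $G$ contains a universally null subset $A$ with $\mathrm{ind}_P(A)=\mathrm{Ind}_P(A)=\kappa$.
   Context: $\mathfrak{c}$ is the cardinality of the continuum. For a non-empty subset $A$ of a group $G$, the packing index and the almost packing index of $A$ are the cardinals $$\mathrm{ind}_P(A)=\sup\{|S| : S\subset G \text{ and } \{xA\}_{x\in S}\text{ is disjoint}\},$$ $$\mathrm{Ind}_P(A)=\sup\{|S| : S\subset G \text{ and } \{xA\}_{x\in S}\text{ is almost disjoint}\},$$ where $\{xA\}_{x\in S}$ is called disjoint if $xA\cap yA=\emptyset$ for all distinct $x,y\in S$, and almost disjoint if $|xA\cap yA|<|A|$ for all distinct $x,y\in S$. For $p\in\{2,3\}$, $[G]_p=\{x\in G:x^p=e\}$, a subgroup of the Abelian group $G$ with neutral element $e$. Measures of sets that are not Borel are understood with respect to the completion of the measure. A subset $A$ of a topological group $G$ is Haar null if there is a Borel probability measure $\mu$ on $G$ such that $\mu(xAy)=0$ for all $x,y\in G$. A subset $A$ of a topological space $X$ is universally null if $\mu(A)=0$ for every continuous Borel probability measure $\mu$ on $X$, where $\mu$ is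 continuous if $\mu(\{x\})=0$ for all $x\in X$. $\mathrm{cov}(\mathbb{K})$ is the smallest cardinality of a cover of the real line by meager subsets. *)

theory Defs
  imports "HOL-Analysis.Analysis" "HOL-Probability.Probability_Measure"
begin

unbundle cardinal_syntax
no_notation elt_set_eq (infix "=o" 50)

text \<open>
  Cardinals are represented by relations satisfying \<^const>\<open>Card_order\<close>, and equality of cardinals
  is \<open>=o\<close>. The two operators below choose a representative, as \<^const>\<open>cardSuc\<close> does.
\<close>

definition card_min :: "'a rel set \<Rightarrow> 'a rel" where
  "card_min R = (SOME r. r \<in> R \<and> (\<forall>r'\<in>R. r \<le>o r'))"

definition card_sup :: "'a set set \<Rightarrow> 'a rel" where
  "card_sup F = card_min {r. Card_order r \<and> (\<forall>S\<in>F. |S| \<le>o r)}"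

lemma card_min:
  assumes "R \<noteq> {}" "\<And>r. r \<in> R \<Longrightarrow> Card_order r"
  shows card_min_in: "card_min R \<in> R"
    and card_min_le: "r \<in> R \<Longrightarrow> card_min R \<le>o r"
proof -
  have "\<exists>r. r \<in> R \<and> (\<forall>r'\<in>R. r \<le>o r')"
    using exists_minim_Card_order[of R] assms by blast
  then have *: "card_min R \<in> R \<and> (\<forall>r'\<in>R. card_min R \<le>o r')"
    unfolding card_min_def by (rule someI_ex)
  then show "card_min R \<in> R" and "r \<in> R \<Longrightarrow> card_min R \<le>o r" by auto
qed

lemma card_sup:
  fixes F :: "'a set set"
  shows Card_order_card_sup: "Card_order (card_sup F)"
    and card_sup_upper: "S \<in> F \<Longrightarrow> |S| \<le>o card_sup F"
    and card_sup_le_UNIV: "card_sup F \<le>o |UNIV :: 'a set|"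
proof -
  let ?R = "{r :: 'a rel. Card_order r \<and> (\<forall>S\<in>F. |S| \<le>o r)}"
  have U: "|UNIV :: 'a set| \<in> ?R"
    by (simp add: card_of_Card_order card_of_mono1)
  then have "card_sup F \<in> ?R"
    unfolding card_sup_def by (intro card_min_in) auto
  then show "Card_order (card_sup F)" and "S \<in> F \<Longrightarrow> |S| \<le>o card_sup F" by auto
  show "card_sup F \<le>o |UNIV :: 'a set|"
    unfolding card_sup_def using U by (intro card_min_le) auto
qed

lemma card_sup_least:
  fixes F :: "'a set set" and r :: "'b rel"
  assumes r: "Card_order r" and ub: "\<And>S. S \<in> F \<Longrightarrow> |S| \<le>o r"
  shows "card_sup F \<le>o r"
proof (cases "r \<le>o |UNIV :: 'a set|")
  case True
  then have "|Field r| \<le>o |UNIV :: 'a set|"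
    by (rule ordIso_ordLeq_trans[OF card_of_Field_ordIso[OF r]])
  then obtain f :: "'b \<Rightarrow> 'a" where "inj_on f (Field r)"
    unfolding card_of_ordLeq[symmetric] by auto
  then have "|Field r| =o |f ` Field r|"
    by (metis card_of_ordIsoI inj_on_imp_bij_betw)
  then have eq: "r =o |f ` Field r|"
    by (rule ordIso_transitive[OF ordIso_symmetric[OF card_of_Field_ordIso[OF r]]])
  let ?R = "{r :: 'a rel. Card_order r \<and> (\<forall>S\<in>F. |S| \<le>o r)}"
  have fr: "|f ` Field r| \<in> ?R"
    using ordLeq_ordIso_trans[OF ub eq] by (simp add: card_of_Card_order)
  then have ne: "?R \<noteq> {}" by blast
  have "card_sup F \<le>o |f ` Field r|"
    unfolding card_sup_def by (rule card_min_le[OF ne _ fr]) simp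
  then show ?thesis
    by (rule ordLeq_ordIso_trans[OF _ ordIso_symmetric[OF eq]])
next
  case False
  then have "|UNIV :: 'a set| \<le>o r"
    using ordLeq_total[of r "|UNIV :: 'a set|"] r card_of_Well_order
    unfolding card_order_on_def by auto
  then show ?thesis
    by (rule ordLeq_transitive[OF card_sup_le_UNIV])
qed

text \<open>Groups are written additively, so the translate \<open>xA\<close> is \<open>(+) x ` A\<close>.\<close>

definition packing_index :: "'a::group_add set \<Rightarrow> 'a rel" where
  "packing_index A = card_sup {S. \<forall>x\<in>S. \<forall>y\<in>S. x \<noteq> y \<longrightarrow> ((+) x ` A) \<inter> ((+) y ` A) = {}}"

definition almost_packing_index :: "'a::group_add set \<Rightarrow> 'a rel" where
  "almost_packing_index A =
     card_sup {S. \<forall>x\<in>S. \<forall>y\<in>S. x \<noteq> y \<longrightarrow> |((+) x ` A) \<inter> ((+) y ` A)| <o |A|}"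

text \<open>The multiplicative condition \<open>x\<^sup>p = e\<close> becomes \<open>x + \<dots> + x = 0\<close> with \<open>p\<close> summands.\<close>

definition torsion :: "nat \<Rightarrow> 'a::ab_group_add set" where
  "torsion p = {x. (\<Sum>i<p. x) = 0}"

definition cosets :: "'a::ab_group_add set \<Rightarrow> 'a set set" where
  "cosets H = range (\<lambda>x. (+) x ` H)"

definition nowhere_dense :: "'a::topological_space set \<Rightarrow> bool" where
  "nowhere_dense A \<longleftrightarrow> interior (closure A) = {}"

definition meager :: "'a::topological_space set \<Rightarrow> bool" where
  "meager A \<longleftrightarrow> (\<exists>N :: nat \<Rightarrow> 'a set. (\<forall>n. nowhere_dense (N n)) \<and> A = (\<Union>n. N n))"

definition cov_meager :: "real set rel" where
  "cov_meager = card_min {|C| | C. (\<forall>M\<in>C. meager M) \<and> \<Union>C = (UNIV :: real set)}"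

definition borel_prob :: "'a::topological_space measure \<Rightarrow> bool" where
  "borel_prob \<mu> \<longleftrightarrow> prob_space \<mu> \<and> sets \<mu> = sets borel"

text \<open>
  The sets below need not be Borel. Measures of such sets are taken in the completion; membership
  in \<^const>\<open>null_sets\<close> includes measurability with respect to the completion, which matters because
  \<^const>\<open>emeasure\<close> is \<open>0\<close> by convention on nonmeasurable sets.
\<close>

definition haar_null :: "'a::{topological_space, group_add} set \<Rightarrow> bool" where
  "haar_null A \<longleftrightarrow>
     (\<exists>\<mu>. borel_prob \<mu> \<and> (\<forall>x y. (\<lambda>a. x + a + y) ` A \<in> null_sets (completion \<mu>)))"

definition universally_null :: "'a::topological_space set \<Rightarrow> bool" where
  "universally_null A \<longleftrightarrow>
     (\<forall>\<mu>. borel_prob \<mu> \<and> (\<forall>x. emeasure \<mu> {x} = 0) \<longrightarrow> A \<in> null_sets (completion \<mu>))"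

lemma cov_meager:
  shows cov_meager_attained: "\<exists>C. cov_meager = |C| \<and> (\<forall>M\<in>C. meager M) \<and> \<Union>C = (UNIV :: real set)"
    and cov_meager_le: "(\<forall>M\<in>C. meager M) \<Longrightarrow> \<Union>C = (UNIV :: real set) \<Longrightarrow> cov_meager \<le>o |C|"
proof -
  let ?R = "{|C| | C. (\<forall>M\<in>C. meager M) \<and> \<Union>C = (UNIV :: real set)}"
  have "meager {x}" for x :: real
    unfolding meager_def nowhere_dense_def by (rule exI[of _ "\<lambda>_. {x}"]) simp
  then have "|range (\<lambda>x::real. {x})| \<in> ?R"
    by (intro CollectI exI[of _ "range (\<lambda>x::real. {x})"]) auto
  then have ne: "?R \<noteq> {}" by blast
  have co: "Card_order r" if "r \<in> ?R" for r using that card_of_Card_order by auto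
  show "\<exists>C. cov_meager = |C| \<and> (\<forall>M\<in>C. meager M) \<and> \<Union>C = (UNIV :: real set)"
    using card_min_in[OF ne co] unfolding cov_meager_def by blast
  show "(\<forall>M\<in>C. meager M) \<Longrightarrow> \<Union>C = (UNIV :: real set) \<Longrightarrow> cov_meager \<le>o |C|"
    unfolding cov_meager_def by (rule card_min_le[OF ne co]) auto
qed

end

theory Submission
  imports Defs
begin

text \<open>
  A set \<open>A\<close> has translates \<open>x + A\<close>, \<open>y + A\<close> that are disjoint exactly when \<open>y - x\<close> lies in the set \<open>T\<close> of
  all \<open>t\<close> with \<open>A \<inter> (t + A) = {}\<close>. So if \<open>A\<close> meets \<open>t + A\<close> either not at all (\<open>t \<in> T\<close>) or in \<open>|A|\<close>
  points (\<open>t \<notin> T\<close>), then both packing indices are the supremum of the sizes of the cliques of the Cayley graph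
  of \<open>T\<close>, that is of the sets whose nonzero differences all lie in \<open>T\<close> (\<open>packing_indices_eq\<close>). The proof
  finds a \<open>T\<close> with clique number \<open>\<kappa>\<close> and then realises \<open>T\<close> by a small set \<open>A\<close>. If \<open>\<kappa> = |G|\<close>,
  a one-point set will do. So let \<open>\<kappa> < |G|\<close>.

  The set \<open>T\<close> is taken to be the set of nonzero differences of a set \<open>S\<close> with \<open>|S| = \<kappa>\<close>
  (\<open>exists_clique_set\<close>). For infinite \<open>\<kappa>\<close> every \<open>S\<close> is good, because a clique embeds into \<open>T \<union> {0}\<close>.
  For finite \<open>\<kappa>\<close> the set \<open>S\<close> is built one element \<open>s\<close> at a time, each outside a countable subgroup \<open>H\<close>
  that contains the previous ones; a clique then splits along the cosets of \<open>H\<close>, and the Sidon property of \<open>S\<close> (a nonzero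
  difference determines its two elements, at least as a set) bounds the parts. If \<open>2G\<close> and \<open>3G\<close> are uncountable,
  \<open>s\<close> can be chosen so generic that the bound is \<open>|S|\<close>. Otherwise the elements of order dividing two, or those
  of order dividing three, form an uncountable subgroup, in which the bound is \<open>max |S| 4\<close>. This leaves \<open>\<kappa> \<le> 3\<close> to be done by hand; there, for \<open>\<kappa> = 2\<close> and \<open>\<kappa> = 3\<close>, the
  exceptional groups of the statement appear.

  The set \<open>A\<close> is a union of pairs \<open>{x, x + g}\<close>, picked by transfinite recursion so that every \<open>g \<notin> T\<close>
  is used \<open>|G|\<close> times and no difference in \<open>T\<close> appears (\<open>transfinite_construction\<close>). At each stage fewer than
  \<open>|G|\<close> points are forbidden, which leaves room for a further smallness requirement on \<open>x\<close>.

  For the Haar null set, the room comes from a perfect set with few coincidences among sums of its points, the limit of a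
  tree of balls (locale \<open>sidon_tree\<close>). Its left half \<open>P\<close> carries a continuous probability measure. Its right half
  \<open>Q\<close> is nowhere dense, and there is a closed set \<open>W\<close> with empty interior such that for every \<open>g\<close> continuum
  many \<open>x \<in> Q\<close> satisfy \<open>x + g \<in> W\<close>. Choosing \<open>x\<close> there makes \<open>A\<close> nowhere dense. Two distinct points lie
  in only finitely many translates of \<open>P\<close>, each of which meets \<open>Q\<close> in at most one point. So \<open>x\<close> and
  \<open>x + g\<close> can avoid every translate that already contains two points. Then every translate of \<open>P\<close> meets
  \<open>A\<close> in a finite set, and the measure on \<open>P\<close> shows that \<open>A\<close> is Haar null.

  For the universally null set, \<open>x\<close> and \<open>x + g\<close> avoid at each stage all meager sets listed before; this is possible
  if \<open>cov_meager\<close> is the continuum. A continuous measure is concentrated on a meager set \<open>M\<close>, and \<open>A \<inter> M\<close>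
  has fewer than \<open>cov_meager\<close> points, hence is null. Both uses of \<open>cov_meager\<close>, which speaks about the real line,
  go through \<open>generic_chain\<close>: Cohen genericity for fewer than \<open>cov_meager\<close> dense subsets of a countable set of
  conditions.
\<close>

section \<open>Sidon sets and the cliques of their difference sets\<close>

definition clique :: "'a::ab_group_add set \<Rightarrow> 'a set \<Rightarrow> bool" where
  "clique T K \<longleftrightarrow> (\<forall>x\<in>K. \<forall>y\<in>K. x \<noteq> y \<longrightarrow> y - x \<in> T)"

definition difference_set :: "'a::ab_group_add set \<Rightarrow> 'a set" where
  "difference_set S = {x - y |x y. x \<in> S \<and> y \<in> S \<and> x \<noteq> y}"

definition sidon :: "'a::ab_group_add set \<Rightarrow> bool" where
  "sidon S \<longleftrightarrow> (\<forall>a\<in>S. \<forall>b\<in>S. \<forall>c\<in>S. \<forall>d\<in>S. a - b = c - d \<longrightarrow>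
     a = b \<or> (a = c \<and> b = d) \<or> (a = d \<and> b = c))"

definition is_subgroup :: "'a::ab_group_add set \<Rightarrow> bool" where
  "is_subgroup H \<longleftrightarrow> 0 \<in> H \<and> (\<forall>x\<in>H. \<forall>y\<in>H. x - y \<in> H)"

lemma is_subgroupD:
  assumes "is_subgroup H"
  shows "0 \<in> H" "x \<in> H \<Longrightarrow> y \<in> H \<Longrightarrow> x - y \<in> H" "x \<in> H \<Longrightarrow> - x \<in> H"
    "x \<in> H \<Longrightarrow> y \<in> H \<Longrightarrow> x + y \<in> H"
proof -
  show 1: "0 \<in> H" and 2: "\<And>x y. x \<in> H \<Longrightarrow> y \<in> H \<Longrightarrow> x - y \<in> H"
    using assms unfolding is_subgroup_def by auto
  show 3: "- x \<in> H" if "x \<in> H" for x using 2[OF 1 that] by simp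
  show "x + y \<in> H" if "x \<in> H" "y \<in> H" for x y using 2[OF that(1) 3[OF that(2)]] by simp
qed

lemma countable_subgroup_extension:
  fixes F :: "'a::ab_group_add set"
  assumes "countable F"
  obtains H where "countable H" "F \<subseteq> H" "is_subgroup H"
proof -
  define X where "X = rec_nat (insert 0 F) (\<lambda>_ Y. Y \<union> (\<lambda>(x,y). x - y) ` (Y \<times> Y))"
  have X0: "X 0 = insert 0 F" and XS: "X (Suc n) = X n \<union> (\<lambda>(x,y). x - y) ` (X n \<times> X n)" for n
    by (simp_all add: X_def)
  have c: "countable (X n)" for n by (induction n) (auto simp: X0 XS assms)
  have "incseq X" by (rule incseq_SucI) (auto simp: XS)
  then have m: "X m \<subseteq> X (max m n)" "X n \<subseteq> X (max m n)" for m n by (auto simp: incseq_def)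
  show thesis
  proof
    show "countable (\<Union>n. X n)" using c by auto
    show "F \<subseteq> (\<Union>n. X n)" using X0 by blast
    have "x - y \<in> (\<Union>n. X n)" if xy: "x \<in> X i" "y \<in> X j" for x y i j
    proof -
      have "(x, y) \<in> X (max i j) \<times> X (max i j)" using xy m(1)[of i j] m(2)[of j i] by blast
      then have "x - y \<in> X (Suc (max i j))" unfolding XS by force
      then show ?thesis by blast
    qed
    then show "is_subgroup (\<Union>n. X n)" unfolding is_subgroup_def using X0 by auto
  qed
qed

lemma clique_translate: "clique T ((\<lambda>x. x - k) ` K) \<longleftrightarrow> clique T K"
  unfolding clique_def by auto

lemma clique_subset: "clique T K \<Longrightarrow> K' \<subseteq> K \<Longrightarrow> clique T K'"
  unfolding clique_def by blast

text \<open>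
  The set \<open>X - Y\<close> contains the rectangle \<open>x - y, x' - y, x - y', x' - y'\<close>, whose opposite sides give
  equal differences. In a Sidon set this leaves only the case that diagonally opposite corners coincide.
\<close>

lemma sidon_rectangle:
  assumes S: "sidon S" and sub: "\<forall>x\<in>X. \<forall>y\<in>Y. x - y \<in> S"
    and "x \<in> X" "x' \<in> X" "x \<noteq> x'" "y \<in> Y" "y' \<in> Y" "y \<noteq> y'"
  shows "x - x' = y - y'"
proof -
  have "(x - y) - (x' - y) = (x - y') - (x' - y')" by simp
  then have "x - y = x' - y \<or> (x - y = x - y' \<and> x' - y = x' - y') \<or> (x - y = x' - y' \<and> x' - y = x - y')"
    using S sub assms(3-) unfolding sidon_def by blast
  then have "x - y = x' - y'" using assms(5,8) by simp
  then show ?thesis by (simp add: algebra_simps)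
qed

lemma card_le_2_if_equal_differences:
  fixes d :: "'a::ab_group_add"
  assumes "\<And>x x'. x \<in> X \<Longrightarrow> x' \<in> X \<Longrightarrow> x \<noteq> x' \<Longrightarrow> x - x' = d"
  shows "finite X \<and> card X \<le> 2"
proof (cases "X = {}")
  case False
  then obtain x where x: "x \<in> X" by blast
  have "X \<subseteq> {x, x - d}" using assms[OF x] by force
  then show ?thesis using card_mono[of "{x, x - d}" X] card_insert_le_m1[of 2 "{x - d}" x]
    by (auto intro: finite_subset)
qed simp

lemma two_distinct_elements: "\<lbrakk>finite X; 2 \<le> card X\<rbrakk> \<Longrightarrow> \<exists>x\<in>X. \<exists>y\<in>X. x \<noteq> y"
  by (metis card_le_Suc0_iff_eq not_less_eq_eq numeral_2_eq_2)

text \<open>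
  If both sets have at least two elements, every pair in \<open>X\<close> has the same difference as every pair in \<open>Y\<close>, so both
  have exactly two elements and the common difference is an involution. This exceptional case is recorded in the second
  disjunct, so that it can be excluded when involutions are. If one set is a singleton, the other embeds into \<open>S\<close>.
\<close>

lemma card_add_le_of_differences_in_sidon:
  assumes S: "sidon S" "finite S" and sub: "\<forall>x\<in>X. \<forall>y\<in>Y. x - y \<in> S"
    and fin: "finite X" "finite Y" and ne: "X \<noteq> {}" "Y \<noteq> {}"
  shows "card X + card Y \<le> card S + 1 \<or>
    (card X + card Y \<le> 4 \<and> (\<exists>x\<in>X. \<exists>x'\<in>X. \<exists>y\<in>Y. \<exists>y'\<in>Y. x \<noteq> x' \<and> y \<noteq> y' \<and> x - x' = y - y' \<and> x - x' = y' - y))"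
proof -
  have X: "card X \<le> card S"
  proof -
    obtain y where "y \<in> Y" using ne by blast
    then have "(\<lambda>x. x - y) ` X \<subseteq> S" using sub by auto
    moreover have "inj_on (\<lambda>x. x - y) X" by (auto simp: inj_on_def)
    ultimately show ?thesis by (metis S(2) card_image card_mono)
  qed
  have Y: "card Y \<le> card S"
  proof -
    obtain x where "x \<in> X" using ne by blast
    then have "(\<lambda>y. x - y) ` Y \<subseteq> S" using sub by auto
    moreover have "inj_on (\<lambda>y. x - y) Y" by (auto simp: inj_on_def)
    ultimately show ?thesis by (metis S(2) card_image card_mono)
  qed
  consider "card X \<le> 1" | "card Y \<le> 1" | "2 \<le> card X" "2 \<le> card Y" by linarith
  then show ?thesis
  proof cases
    case 3
    obtain x x' where x: "x \<in> X" "x' \<in> X" "x \<noteq> x'" using two_distinct_elements[OF fin(1) 3(1)] by blast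
    obtain y y' where y: "y \<in> Y" "y' \<in> Y" "y \<noteq> y'" using two_distinct_elements[OF fin(2) 3(2)] by blast
    have "x1 - x2 = y - y'" if "x1 \<in> X" "x2 \<in> X" "x1 \<noteq> x2" for x1 x2
      by (rule sidon_rectangle[OF S(1) sub that y])
    then have "card X \<le> 2" using card_le_2_if_equal_differences[of X "y - y'"] by blast
    moreover have "y1 - y2 = x - x'" if "y1 \<in> Y" "y2 \<in> Y" "y1 \<noteq> y2" for y1 y2
      using sidon_rectangle[OF S(1) sub x that] by simp
    then have "card Y \<le> 2" using card_le_2_if_equal_differences[of Y "x - x'"] by blast
    moreover have "x - x' = y - y'" "x - x' = y' - y"
      using sidon_rectangle[OF S(1) sub x y] sidon_rectangle[OF S(1) sub x y(2,1)] y by auto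
    ultimately show ?thesis using x y by force
  qed (use X Y in auto)
qed

text \<open>
  This is what a clique meeting three cosets of a subgroup produces when the new element has order three. By the rectangle
  argument at most one of the three sets has two or more elements, and the other two determine for such a set \<open>X\<close>
  the sum of any two of its elements.
\<close>

lemma card_add_le_of_cyclic_differences_in_sidon:
  assumes S: "sidon S" and two: "\<And>a b. a \<in> S \<Longrightarrow> b \<in> S \<Longrightarrow> a - b = b - a \<Longrightarrow> a = b"
    and XY: "\<forall>x\<in>X. \<forall>y\<in>Y. x - y \<in> S"
    and YZ: "\<forall>x\<in>Y. \<forall>y\<in>Z. x - y \<in> S"
    and ZX: "\<forall>x\<in>Z. \<forall>y\<in>X. x - y \<in> S"
    and fin: "finite X" "finite Y" "finite Z" and ne: "X \<noteq> {}" "Y \<noteq> {}" "Z \<noteq> {}"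
  shows "card X + card Y + card Z \<le> 4"
proof -
  have rect: "card A \<le> 1 \<or> card B \<le> 1"
    if AB: "\<forall>x\<in>A. \<forall>y\<in>B. x - y \<in> S" and f: "finite A" "finite B" for A B
  proof (rule ccontr)
    assume "\<not> ?thesis"
    then have "2 \<le> card A" "2 \<le> card B" by auto
    then obtain x x' y y' where x: "x \<in> A" "x' \<in> A" "x \<noteq> x'" and y: "y \<in> B" "y' \<in> B" "y \<noteq> y'"
      using two_distinct_elements f by metis
    have 1: "x - x' = y - y'" by (rule sidon_rectangle[OF S AB x y])
    have 2: "x - x' = y' - y" by (rule sidon_rectangle[OF S AB x y(2,1)]) (use y in auto)
    have "x - x' = x' - x" using 1 2 by (metis minus_diff_eq)
    then have "(x - y) - (x' - y) = (x' - y) - (x - y)" by simp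
    then have "x - y = x' - y" using two AB x y by blast
    then show False using x by simp
  qed
  have third: "card A \<le> 2"
    if AB: "\<forall>x\<in>A. \<forall>y\<in>B. x - y \<in> S" and CA: "\<forall>x\<in>C. \<forall>y\<in>A. x - y \<in> S"
      and ne: "B \<noteq> {}" "C \<noteq> {}" for A B C
  proof (cases "A = {}")
    case False
    then obtain x where x: "x \<in> A" by blast
    obtain y z where y: "y \<in> B" and z: "z \<in> C" using ne by blast
    have "A \<subseteq> {x, y + z - x}"
    proof
      fix x' assume x': "x' \<in> A"
      have "(x - y) - (x' - y) = (z - x') - (z - x)" by simp
      then have "x - y = x' - y \<or> (x - y = z - x' \<and> x' - y = z - x) \<or> (x - y = z - x \<and> x' - y = z - x')"
        using S AB CA x x' y z unfolding sidon_def by blast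
      moreover have "x = x'" if "x - y = z - x" "x' - y = z - x'"
      proof -
        have "(x - y) - (x' - y) = (x' - y) - (x - y)" using that
          by (simp add: algebra_simps)
        then have "x - y = x' - y" using two AB x x' y by blast
        then show ?thesis by simp
      qed
      ultimately show "x' \<in> {x, y + z - x}" by (auto simp: algebra_simps)
    qed
    then show ?thesis using card_mono[of "{x, y + z - x}" A] card_insert_le_m1[of 2 "{y+z-x}" x] by auto
  qed simp
  show ?thesis
    using rect[OF XY fin(1,2)] rect[OF YZ fin(2,3)] rect[OF ZX fin(3,1)]
      third[OF XY ZX ne(2,3)] third[OF YZ XY ne(3,1)] third[OF ZX YZ ne(1,2)] by linarith
qed

text \<open>
  No nonzero difference of elements of \<open>S\<close> has order two. With this condition the third alternative in the definition
  of \<^const>\<open>sidon\<close> disappears.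
\<close>

definition involution_free :: "'a::ab_group_add set \<Rightarrow> bool" where
  "involution_free S \<longleftrightarrow> (\<forall>a\<in>S. \<forall>b\<in>S. a - b = b - a \<longrightarrow> a = b)"

lemma finite_difference_set: "finite S \<Longrightarrow> finite (difference_set S)"
proof -
  assume "finite S"
  then have "finite ((\<lambda>(x,y). x - y) ` (S \<times> S))" by simp
  moreover have "difference_set S \<subseteq> (\<lambda>(x,y). x - y) ` (S \<times> S)" unfolding difference_set_def by auto
  ultimately show ?thesis by (rule finite_subset[rotated])
qed

lemma clique_mono: "T \<subseteq> T' \<Longrightarrow> clique T K \<Longrightarrow> clique T' K"
  unfolding clique_def by blast

lemma clique_subset_translate:
  assumes "clique T K" "k \<in> K"
  shows "K \<subseteq> insert k ((+) k ` T)"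
proof
  fix x assume x: "x \<in> K"
  have "x = k \<or> x - k \<in> T" using assms x unfolding clique_def by auto
  moreover have "x = k + (x - k)" by simp
  ultimately show "x \<in> insert k ((+) k ` T)" by blast
qed

lemma finite_clique: "finite T \<Longrightarrow> clique T K \<Longrightarrow> finite K"
proof (cases "K = {}")
  case False
  assume "finite T" "clique T K"
  then show "finite K"
    using False clique_subset_translate[of T K] by (meson all_not_in_conv finite_imageI finite_insert finite_subset)
qed simp

lemma difference_set_insertE:
  assumes "t \<in> difference_set (insert s S)"
  obtains "t \<in> difference_set S" | \<sigma> where "\<sigma> \<in> S" "t = s - \<sigma>" | \<sigma> where "\<sigma> \<in> S" "t = \<sigma> - s"
  using assms unfolding difference_set_def by blast

lemma difference_set_subset_subgroup: "is_subgroup H \<Longrightarrow> S \<subseteq> H \<Longrightarrow> difference_set S \<subseteq> H"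
  unfolding difference_set_def using is_subgroupD(2) by blast

lemma clique_difference_set_restrict:
  assumes H: "is_subgroup H" "S \<subseteq> H" "s \<notin> H" and K: "clique (difference_set (insert s S)) K"
    and sub: "\<And>x. x \<in> K \<Longrightarrow> x - c \<in> H"
  shows "clique (difference_set S) K"
  unfolding clique_def
proof (intro ballI impI)
  fix x y assume xy: "x \<in> K" "y \<in> K" "x \<noteq> y"
  then have t: "y - x \<in> difference_set (insert s S)" using K unfolding clique_def by auto
  have h: "y - x \<in> H" using is_subgroupD(2)[OF H(1) sub[OF xy(2)] sub[OF xy(1)]] by simp
  have "s \<in> H" if "\<sigma> \<in> S" "y - x = s - \<sigma>" for \<sigma>
    using is_subgroupD(4)[OF H(1) h, of \<sigma>] H(2) that by auto
  moreover have "s \<in> H" if "\<sigma> \<in> S" "y - x = \<sigma> - s" for \<sigma>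
    using is_subgroupD(2)[OF H(1) _ h, of \<sigma>] H(2) that by auto
  ultimately show "y - x \<in> difference_set S" using t H(3) by (elim difference_set_insertE) auto
qed

lemma sidon_insert:
  assumes H: "is_subgroup H" "S \<subseteq> H" "s \<notin> H" and S: "sidon S"
    and s: "s + s \<notin> H \<or> (\<forall>x\<in>insert s H. x + x = 0)"
  shows "sidon (insert s S)"
proof -
  have *: "a - b = c - d \<longrightarrow> a = b \<or> (a = c \<and> b = d) \<or> (a = d \<and> b = c)"
    if abcd: "a \<in> insert s S" "b \<in> insert s S" "c \<in> insert s S" "d \<in> insert s S" for a b c d
  proof
    assume eq: "a - b = c - d"
    have n1: "s \<noteq> x + y - z" if "x \<in> S" "y \<in> S" "z \<in> S" for x y z
      using is_subgroupD(2,4)[OF H(1)] H(2,3) that by (metis subsetD)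
    have n2: "s + s = x + y \<Longrightarrow> x = y" if xy: "x \<in> S" "y \<in> S" for x y
    proof -
      assume e: "s + s = x + y"
      then have "s + s \<in> H" using is_subgroupD(4)[OF H(1)] H(2) xy by (metis subsetD)
      then have h: "\<forall>x\<in>insert s H. x + x = 0" using s by auto
      then have "x + y = y + y" using e H(2) xy by auto
      then show ?thesis by simp
    qed
    consider "a \<in> S" "b \<in> S" "c \<in> S" "d \<in> S" | "a = s \<or> b = s \<or> c = s \<or> d = s" using abcd by auto
    then show "a = b \<or> (a = c \<and> b = d) \<or> (a = d \<and> b = c)"
    proof cases
      case 1
      then show ?thesis using S eq unfolding sidon_def by blast
    next
      case 2
      have e1: "a + d = c + b" using eq by (simp add: algebra_simps)
      have "a = s \<Longrightarrow> b \<in> S \<Longrightarrow> c \<in> S \<Longrightarrow> d \<in> S \<Longrightarrow> False" using n1[of c b d] e1 by (simp add: algebra_simps)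
      moreover have "b = s \<Longrightarrow> a \<in> S \<Longrightarrow> c \<in> S \<Longrightarrow> d \<in> S \<Longrightarrow> False" using n1[of a d c] e1 by (simp add: algebra_simps)
      moreover have "c = s \<Longrightarrow> b \<in> S \<Longrightarrow> a \<in> S \<Longrightarrow> d \<in> S \<Longrightarrow> False" using n1[of a d b] e1 by (simp add: algebra_simps)
      moreover have "d = s \<Longrightarrow> b \<in> S \<Longrightarrow> c \<in> S \<Longrightarrow> a \<in> S \<Longrightarrow> False" using n1[of c b a] e1 by (simp add: algebra_simps)
      moreover have "a = s \<Longrightarrow> d = s \<Longrightarrow> c \<in> S \<Longrightarrow> b \<in> S \<Longrightarrow> c = b" using n2[of c b] e1 by simp
      moreover have "c = s \<Longrightarrow> b = s \<Longrightarrow> a \<in> S \<Longrightarrow> d \<in> S \<Longrightarrow> a = d" using n2[of a d] e1 by simp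
      ultimately show ?thesis using 2 abcd e1 by (auto simp: algebra_simps)
    qed
  qed
  then show ?thesis unfolding sidon_def by blast
qed

lemma involution_free_insert:
  assumes H: "is_subgroup H" "S \<subseteq> H" and S: "involution_free S" and s: "s + s \<notin> H"
  shows "involution_free (insert s S)"
proof -
  have "s - b \<noteq> b - s" if "b \<in> S" for b
  proof
    assume "s - b = b - s"
    then have "s + s = b + b" by (simp add: algebra_simps)
    then show False using s is_subgroupD(4)[OF H(1), of b b] H(2) that by auto
  qed
  then show ?thesis using S unfolding involution_free_def by (metis insert_iff)
qed

text \<open>
  After a translation, a clique lies in \<open>H \<union> (s + H)\<close>: to meet \<open>H\<close>, \<open>s + H\<close> and \<open>- s + H\<close> it
  would need \<open>2s\<close> or \<open>3s\<close> in \<open>H\<close>, and if all orders divide two, the last two cosets coincide. All differences between the two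
  parts are of the form \<open>s - \<sigma>\<close> with \<open>\<sigma> \<in> S\<close>, so after shifting the second part back by \<open>s\<close> the
  differences lie in \<open>S\<close> itself.
\<close>

lemma two_coset_clique_bound:
  assumes H: "is_subgroup H" "S \<subseteq> H" "s \<notin> H" and S: "sidon S" "finite S"
    and s: "(s + s \<notin> H \<and> s + s + s \<notin> H) \<or> (\<forall>x\<in>insert s H. x + x = 0)"
    and N: "\<And>K. clique (difference_set S) K \<Longrightarrow> card K \<le> N"
    and K: "clique (difference_set (insert s S)) K"
  shows "card K \<le> N \<or> card K \<le> card S + 1 \<or> (card K \<le> 4 \<and> \<not> involution_free S)"
proof (cases "K = {}")
  case False
  note D = is_subgroupD[OF H(1)]
  have finK: "finite K" using finite_clique[OF finite_difference_set K] S by simp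
  have step: "t \<in> difference_set S \<or> (\<exists>\<sigma>\<in>S. t = s - \<sigma>) \<or> (\<exists>\<sigma>\<in>S. t = \<sigma> - s)" if "t \<in> difference_set (insert s S)" for t
    using that by (elim difference_set_insertE) auto
  have dH: "difference_set S \<subseteq> H" using difference_set_subset_subgroup[OF H(1,2)] .
  have near: "y - x \<in> H \<or> y - x - s \<in> H \<or> y - x + s \<in> H" if "x \<in> K" "y \<in> K" for x y
  proof (cases "x = y")
    case False
    then have "y - x \<in> difference_set (insert s S)" using K that unfolding clique_def by auto
    then show ?thesis using step[of "y - x"] dH H(2) D(3) by fastforce
  qed (use D(1) in auto)
  have "\<exists>k\<in>K. \<forall>x\<in>K. x - k \<in> H \<or> x - k - s \<in> H"
  proof (cases "\<forall>x\<in>insert s H. x + x = 0")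
    case True
    obtain k where k: "k \<in> K" using False by blast
    have "s + s = 0" using True by auto
    then have "x + s = x - s" for x by (metis add_diff_cancel_right' diff_add_eq_diff_diff_swap diff_zero)
    then show ?thesis using near[OF k] k by metis
  next
    case F: False
    then have s2: "s + s \<notin> H" "s + s + s \<notin> H" using s by auto
    obtain k where k: "k \<in> K" using False by blast
    show ?thesis
    proof (cases "\<exists>l\<in>K. l - k + s \<in> H")
      case False
      then show ?thesis using near[OF k] k by blast
    next
      case True
      then obtain l where l: "l \<in> K" "l - k + s \<in> H" by blast
      have "x - l \<in> H \<or> x - l - s \<in> H" if x: "x \<in> K" for x
      proof (rule ccontr)
        assume "\<not> ?thesis"
        then have a: "x - l \<notin> H" "x - l - s \<notin> H" by auto
        then have b: "x - l + s \<in> H" using near[OF l(1) x] by blast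
        have c: "x - k + s + s \<in> H" using D(4)[OF b l(2)] by (simp add: algebra_simps)
        from near[OF k x] show False
        proof (elim disjE)
          assume "x - k \<in> H"
          from D(2)[OF c this] show False using s2(1) by (simp add: algebra_simps)
        next
          assume "x - k - s \<in> H"
          from D(2)[OF c this] show False using s2(2) by (simp add: algebra_simps)
        next
          assume "x - k + s \<in> H"
          from D(2)[OF c this] show False using H(3) by (simp add: algebra_simps)
        qed
      qed
      then show ?thesis using l by blast
    qed
  qed
  then obtain k where k: "k \<in> K" "\<And>x. x \<in> K \<Longrightarrow> x - k \<in> H \<or> x - k - s \<in> H" by blast
  define X where "X = {x \<in> K. x - k \<in> H}"
  define Y where "Y = {x \<in> K. x - k - s \<in> H}"
  have KXY: "K = X \<union> Y" using k(2) unfolding X_def Y_def by auto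
  have disj: "X \<inter> Y = {}"
  proof (rule ccontr)
    assume "X \<inter> Y \<noteq> {}"
    then obtain x where "x - k \<in> H" "x - k - s \<in> H" unfolding X_def Y_def by blast
    from D(2)[OF this] show False using H(3) by simp
  qed
  have cardK: "card K = card X + card Y" using KXY disj finK by (simp add: card_Un_disjoint)
  have cX: "clique (difference_set S) X"
    by (rule clique_difference_set_restrict[OF H clique_subset[OF K], where c = k]) (auto simp: X_def)
  show ?thesis
  proof (cases "Y = {}")
    case True
    then show ?thesis using N[OF cX] cardK by simp
  next
    case Y: False
    define Y' where "Y' = (\<lambda>y. y - s) ` Y"
    have XY: "\<forall>x\<in>X. \<forall>y\<in>Y'. x - y \<in> S"
    proof (intro ballI)
      fix x y' assume x: "x \<in> X" and "y' \<in> Y'"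
      then obtain y where y: "y \<in> Y" "y' = y - s" unfolding Y'_def by blast
      have "x \<noteq> y" using disj x y by auto
      then have d: "y - x \<in> difference_set (insert s S)" using K x y KXY unfolding clique_def by auto
      have h: "y - x - s \<in> H" using D(2)[of "y - k - s" "x - k"] x y unfolding X_def Y_def by (simp add: algebra_simps)
      from step[OF d] show "x - y' \<in> S"
      proof (elim disjE bexE)
        assume "y - x \<in> difference_set S"
        then have "s \<in> H" using D(2)[OF _ h, of "y - x"] dH by (auto simp: algebra_simps)
        then show ?thesis using H(3) by simp
      next
        fix \<sigma> assume a: "\<sigma> \<in> S" "y - x = s - \<sigma>"
        have "x - y' = s - (y - x)" using y(2) by simp
        then show ?thesis using a by simp
      next
        fix \<sigma> assume a: "\<sigma> \<in> S" "y - x = \<sigma> - s"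
        then have sH: "\<sigma> \<in> H" using H(2) by blast
        have "s + s \<in> H" using D(2)[OF sH h] a(2) by (simp add: algebra_simps)
        then have e: "\<forall>x\<in>insert s H. x + x = 0" using s by auto
        have "x - y' = s + s - \<sigma>" using a(2) y(2) by (simp add: algebra_simps)
        also have "\<dots> = \<sigma>" using e sH by (metis add.inverse_unique diff_0 insert_iff)
        finally show ?thesis using a(1) by simp
      qed
    qed
    have cY: "card Y' = card Y" unfolding Y'_def by (rule card_image) (auto simp: inj_on_def)
    have "k \<in> X" using k(1) D(1) unfolding X_def by auto
    then have "X \<noteq> {}" "Y' \<noteq> {}" "finite X" "finite Y'" using Y finK KXY unfolding Y'_def by auto
    then consider "card K \<le> card S + 1" | x x' y y' where "card K \<le> 4" "x \<in> X" "x' \<in> X" "y \<in> Y'" "y' \<in> Y'"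
       "x \<noteq> x'" "x - x' = y - y'" "x - x' = y' - y"
      using card_add_le_of_differences_in_sidon[OF S XY] cardK cY by auto
    then show ?thesis
    proof cases
      case 2
      have "x - y \<in> S" "x' - y \<in> S" using XY 2 by auto
      moreover have "(x - y) - (x' - y) = (x' - y) - (x - y)" using 2(7,8) by (metis diff_diff_eq2 diff_add_cancel minus_diff_eq)
      ultimately have "\<not> involution_free S" unfolding involution_free_def using 2(6) by (metis diff_left_imp_eq diff_add_cancel)
      then show ?thesis using 2(1) by simp
    qed simp
  qed
qed simp

text \<open>
  If \<open>s\<close> has order three, a clique can meet all of \<open>H\<close>, \<open>s + H\<close> and \<open>2s + H\<close>. Shifted back into one coset,
  the three parts have cyclically all their differences in \<open>S\<close>.
\<close>

lemma three_coset_clique_bound: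
  assumes H: "is_subgroup H" "S \<subseteq> H" "s \<notin> H" and S: "sidon S" "finite S" "involution_free S"
    and s: "s + s + s = 0"
    and N: "\<And>K. clique (difference_set S) K \<Longrightarrow> card K \<le> N"
    and K: "clique (difference_set (insert s S)) K"
  shows "card K \<le> N \<or> card K \<le> card S + 1 \<or> card K \<le> 4"
proof (cases "K = {}")
  case False
  note D = is_subgroupD[OF H(1)]
  have finK: "finite K" using finite_clique[OF finite_difference_set K] S by simp
  have step: "t \<in> difference_set S \<or> (\<exists>\<sigma>\<in>S. t = s - \<sigma>) \<or> (\<exists>\<sigma>\<in>S. t = \<sigma> - s)" if "t \<in> difference_set (insert s S)" for t
    using that by (elim difference_set_insertE) auto
  have dH: "difference_set S \<subseteq> H" using difference_set_subset_subgroup[OF H(1,2)] .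
  have near: "y - x \<in> H \<or> y - x - s \<in> H \<or> y - x + s \<in> H" if "x \<in> K" "y \<in> K" for x y
  proof (cases "x = y")
    case False
    then have "y - x \<in> difference_set (insert s S)" using K that unfolding clique_def by auto
    then show ?thesis using step[of "y - x"] dH H(2) D(3) by fastforce
  qed (use D(1) in auto)
  have ss: "s + s \<notin> H"
  proof
    assume "s + s \<in> H"
    from D(3)[OF this] have "s \<in> H" using s by (metis add.inverse_unique add.commute)
    then show False using H(3) by simp
  qed
  obtain k where k: "k \<in> K" using False by blast
  \<comment> \<open>the part of \<open>K\<close> in the coset \<open>k + c + H\<close>, and its copy \<open>Z c\<close> in \<open>k + H\<close>\<close>
  define X where "X c = {x \<in> K. x - k - c \<in> H}" for c
  define Z where "Z c = (\<lambda>x. x - c) ` X c" for c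
  have cross: "\<forall>x\<in>Z c. \<forall>y\<in>Z (c + s). x - y \<in> S" for c
  proof (intro ballI)
    fix x' y' assume "x' \<in> Z c" "y' \<in> Z (c + s)"
    then obtain x y where x: "x \<in> X c" "x' = x - c" and y: "y \<in> X (c + s)" "y' = y - (c + s)"
      unfolding Z_def by blast
    have h: "y - x - s \<in> H" using D(2)[of "y - k - (c + s)" "x - k - c"] x y unfolding X_def
      by (simp add: algebra_simps)
    have "x \<noteq> y" using h D(3) H(3) by fastforce
    then have d: "y - x \<in> difference_set (insert s S)" using K x y unfolding clique_def X_def by auto
    from step[OF d] show "x' - y' \<in> S"
    proof (elim disjE bexE)
      assume "y - x \<in> difference_set S"
      then have "s \<in> H" using D(2)[OF _ h, of "y - x"] dH by (auto simp: algebra_simps)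
      then show ?thesis using H(3) by simp
    next
      fix \<sigma> assume a: "\<sigma> \<in> S" "y - x = s - \<sigma>"
      have "x' - y' = s - (y - x)" unfolding x(2) y(2) by (simp add: algebra_simps)
      then show ?thesis using a by simp
    next
      fix \<sigma> assume a: "\<sigma> \<in> S" "y - x = \<sigma> - s"
      then have sH: "\<sigma> \<in> H" using H(2) by blast
      have "s + s \<in> H" using D(2)[OF sH h] a(2) by (simp add: algebra_simps)
      then show ?thesis using ss by simp
    qed
  qed
  have Zs: "Z (s + s + s) = Z 0" using s by simp
  have m: "x - (s + s) = x + s" for x using s by (simp add: algebra_simps eq_neg_iff_add_eq_0 diff_eq_eq)
  have KX: "K = X 0 \<union> X s \<union> X (s + s)"
    using near[OF k] unfolding X_def by (auto simp: m)
  have cZ: "card (Z c) = card (X c)" "finite (Z c)" for c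
    using finK unfolding Z_def X_def by (auto simp: card_image inj_on_def)
  have cK: "card K \<le> card (Z 0) + card (Z s) + card (Z (s + s))"
    unfolding cZ KX using card_Un_le[of "X 0 \<union> X s" "X (s+s)"] card_Un_le[of "X 0" "X s"] by linarith
  have k0: "Z 0 \<noteq> {}" using k D(1) unfolding Z_def X_def by auto
  have involution_free: "a = b" if "a \<in> S" "b \<in> S" "a - b = b - a" for a b using S(3) that unfolding involution_free_def by blast
  have two: "card (Z c) + card (Z (c + s)) \<le> card S + 1" if ne: "Z c \<noteq> {}" "Z (c + s) \<noteq> {}" for c
  proof -
    consider "card (Z c) + card (Z (c + s)) \<le> card S + 1" | x x' y y' where "x \<in> Z c" "x' \<in> Z c" "y \<in> Z (c + s)" "y' \<in> Z (c + s)"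
       "x \<noteq> x'" "x - x' = y - y'" "x - x' = y' - y"
      using card_add_le_of_differences_in_sidon[OF S(1,2) cross cZ(2) cZ(2) ne] by auto
    then show ?thesis
    proof cases
      case 2
      have "x - y \<in> S" "x' - y \<in> S" using cross 2 by auto
      moreover have "x - x' = x' - x" using 2(6,7) by (metis minus_diff_eq)
      then have "(x - y) - (x' - y) = (x' - y) - (x - y)" by simp
      ultimately show ?thesis using involution_free[of "x - y" "x' - y"] 2(5) by auto
    qed
  qed
  consider "Z s = {}" "Z (s + s) = {}" | "Z s = {}" "Z (s + s) \<noteq> {}" | "Z s \<noteq> {}" "Z (s + s) = {}"
    | "Z s \<noteq> {}" "Z (s + s) \<noteq> {}" by blast
  then show ?thesis
  proof cases
    case 1
    then have "K = X 0" using KX unfolding Z_def by auto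
    moreover have "clique (difference_set S) (X 0)"
      by (rule clique_difference_set_restrict[OF H clique_subset[OF K], where c = k]) (auto simp: X_def)
    ultimately show ?thesis using N by simp
  next
    case 2
    then show ?thesis using two[of "s + s"] k0 cK by (simp add: Zs)
  next
    case 3
    then show ?thesis using two[of 0] k0 cK by simp
  next
    case 4
    have "card (Z 0) + card (Z s) + card (Z (s + s)) \<le> 4"
    proof (rule card_add_le_of_cyclic_differences_in_sidon[OF S(1) involution_free])
      show "\<forall>x\<in>Z 0. \<forall>y\<in>Z s. x - y \<in> S" using cross[of 0] by simp
      show "\<forall>x\<in>Z s. \<forall>y\<in>Z (s + s). x - y \<in> S" by (rule cross)
      show "\<forall>x\<in>Z (s + s). \<forall>y\<in>Z 0. x - y \<in> S" using cross[of "s + s"] unfolding Zs .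
    qed (use cZ(2) k0 4 in auto)
    then show ?thesis using cK by simp
  qed
qed simp

section \<open>Finite sets whose difference sets have no larger cliques\<close>

lemma is_subgroup_torsion2: "is_subgroup {x::'a::ab_group_add. x + x = 0}"
  unfolding is_subgroup_def
proof (intro conjI ballI)
  fix x y :: 'a assume "x \<in> {x. x + x = 0}" "y \<in> {x. x + x = 0}"
  moreover have "(x - y) + (x - y) = (x + x) - (y + y)" by (simp add: algebra_simps)
  ultimately show "x - y \<in> {x. x + x = 0}" by auto
qed simp

lemma clique_empty: "clique {} K \<Longrightarrow> card K \<le> 1"
  by (cases "finite K") (auto simp: card_le_Suc0_iff_eq clique_def)

lemma difference_set_singleton: "difference_set {x} = {}"
  by (auto simp: difference_set_def)

lemma is_subgroup_Int: "is_subgroup H \<Longrightarrow> is_subgroup K \<Longrightarrow> is_subgroup (H \<inter> K)"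
  unfolding is_subgroup_def by auto

text \<open>
  The group is covered by the fibres of \<open>f\<close>, which are translates of the kernel.
\<close>

lemma uncountable_kernel:
  fixes f :: "'a::ab_group_add \<Rightarrow> 'a"
  assumes unc: "uncountable (UNIV :: 'a set)" and add: "\<And>x y. f (x - y) = f x - f y"
    and c: "countable (range f)"
  shows "uncountable {x. f x = 0}"
proof
  assume k: "countable {x. f x = 0}"
  have "countable {x. f x = y}" for y
  proof (cases "\<exists>z. f z = y")
    case True
    then obtain z where z: "f z = y" by blast
    have "x \<in> (+) z ` {x. f x = 0}" if "f x = y" for x
    proof -
      have "f (x - z) = 0" using add z that by simp
      moreover have "x = z + (x - z)" by simp
      ultimately show ?thesis by blast
    qed
    then have "{x. f x = y} \<subseteq> (+) z ` {x. f x = 0}" by blast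
    then show ?thesis using k countable_subset by blast
  qed simp
  then have "countable (\<Union>y\<in>range f. {x. f x = y})" using c by blast
  moreover have "(\<Union>y\<in>range f. {x. f x = y}) = UNIV" by auto
  ultimately show False using unc by simp
qed

text \<open>
  The three cases of the construction: either a new element can be chosen with \<open>2s\<close> and \<open>3s\<close> outside any given
  countable subgroup, or one can work inside a group of exponent two, or inside one of exponent three.
\<close>

lemma uncountable_multiples_or_torsion:
  assumes unc: "uncountable (UNIV :: 'a::ab_group_add set)"
  obtains "uncountable (range (\<lambda>x::'a. x + x))" "uncountable (range (\<lambda>x::'a. x + x + x))"
    | "uncountable {x::'a. x + x = 0}" | "uncountable {x::'a. x + x + x = 0}"
proof -
  have "uncountable {x::'a. x + x = 0}" if "countable (range (\<lambda>x::'a. x + x))"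
    by (rule uncountable_kernel[OF unc _ that]) (simp add: algebra_simps)
  moreover have "uncountable {x::'a. x + x + x = 0}" if "countable (range (\<lambda>x::'a. x + x + x))"
    by (rule uncountable_kernel[OF unc _ that]) (simp add: algebra_simps)
  ultimately show thesis using that by blast
qed

lemma exists_clique_bound_generic:
  assumes unc2: "uncountable (range (\<lambda>x::'a::ab_group_add. x + x))"
    and unc3: "uncountable (range (\<lambda>x::'a. x + x + x))"
  shows "\<exists>S::'a set. finite S \<and> card S = Suc n \<and> sidon S \<and> involution_free S \<and> (\<forall>K. clique (difference_set S) K \<longrightarrow> card K \<le> Suc n)"
proof (induction n)
  case 0
  have 0: "\<forall>K. clique (difference_set {0::'a}) K \<longrightarrow> card K \<le> 1"
    using clique_empty unfolding difference_set_singleton by blast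
  then show ?case by (intro exI[of _ "{0}"]) (simp add: sidon_def involution_free_def)
next
  case (Suc n)
  then obtain S :: "'a set" where S: "finite S" "card S = Suc n" "sidon S" "involution_free S" "\<And>K. clique (difference_set S) K \<Longrightarrow> card K \<le> Suc n"
    by blast
  obtain H where H: "countable H" "S \<subseteq> H" "is_subgroup H"
    by (rule countable_subgroup_extension[OF countable_finite[OF S(1)]])
  note D = is_subgroupD[OF H(3)]
  obtain u where u: "u + u \<notin> H" using unc2 H(1) countable_subset[of "range (\<lambda>x::'a. x + x)" H] by blast
  obtain v where v: "v + v + v \<notin> H" using unc3 H(1) countable_subset[of "range (\<lambda>x::'a. x + x + x)" H] by blast
  \<comment> \<open>\<open>{s. 2s \<in> H}\<close> and \<open>{s. 3s \<in> H}\<close> are proper subgroups, and a group is not the union of two of these\<close>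
  have "\<exists>s. s + s \<notin> H \<and> s + s + s \<notin> H"
  proof (cases "u + u + u \<in> H \<and> v + v \<in> H")
    case True
    have "(u + v) + (u + v) \<notin> H" using D(2)[of "(u + v) + (u + v)" "v + v"] u True by (auto simp: algebra_simps)
    moreover have "(u + v) + (u + v) + (u + v) \<notin> H"
      using D(2)[of "(u + v) + (u + v) + (u + v)" "u + u + u"] v True by (auto simp: algebra_simps)
    ultimately show ?thesis by blast
  qed (use u v in blast)
  then obtain s where s: "s + s \<notin> H" "s + s + s \<notin> H" by blast
  then have sH: "s \<notin> H" using D(4) by blast
  have "card K \<le> Suc (Suc n)" if "clique (difference_set (insert s S)) K" for K
    using two_coset_clique_bound[OF H(3,2) sH S(3,1) _ S(5) that] s S(2,4) by auto
  moreover have "card (insert s S) = Suc (Suc n)" using S(1,2) H(2) sH by (subst card_insert_disjoint) auto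
  moreover have "sidon (insert s S)" using sidon_insert[OF H(3,2) sH S(3)] s by blast
  moreover have "involution_free (insert s S)" using involution_free_insert[OF H(3,2) S(4)] s by blast
  ultimately show ?case using S(1) by (intro exI[of _ "insert s S"]) auto
qed

lemma exists_clique_bound_exponent2:
  assumes unc: "uncountable {x::'a::ab_group_add. x + x = 0}"
  shows "\<exists>S::'a set. finite S \<and> card S = Suc n \<and> sidon S \<and> (\<forall>x\<in>S. x + x = 0) \<and> (\<forall>K. clique (difference_set S) K \<longrightarrow> card K \<le> max (Suc n) 4)"
proof (induction n)
  case 0
  have 0: "\<forall>K. clique (difference_set {0::'a}) K \<longrightarrow> card K \<le> 1"
    using clique_empty unfolding difference_set_singleton by blast
  have "\<forall>K. clique (difference_set {0::'a}) K \<longrightarrow> card K \<le> max (Suc 0) 4"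
    using 0 by (metis le_max_iff_disj One_nat_def)
  then show ?case by (intro exI[of _ "{0}"]) (simp add: sidon_def)
next
  case (Suc n)
  then obtain S :: "'a set" where S: "finite S" "card S = Suc n" "sidon S" "\<forall>x\<in>S. x + x = 0"
    "\<And>K. clique (difference_set S) K \<Longrightarrow> card K \<le> max (Suc n) 4" by blast
  obtain H0 where H0: "countable H0" "S \<subseteq> H0" "is_subgroup H0"
    by (rule countable_subgroup_extension[OF countable_finite[OF S(1)]])
  define H where "H = H0 \<inter> {x. x + x = 0}"
  have H: "is_subgroup H" "S \<subseteq> H" using is_subgroup_Int[OF H0(3) is_subgroup_torsion2] H0(2) S(4) unfolding H_def by auto
  obtain s where s: "s + s = 0" "s \<notin> H0" using unc H0(1) countable_subset[of "{x::'a. x + x = 0}" H0] by blast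
  then have sH: "s \<notin> H" unfolding H_def by simp
  have e: "\<forall>x\<in>insert s H. x + x = 0" using s unfolding H_def by auto
  have "card K \<le> max (Suc (Suc n)) 4" if "clique (difference_set (insert s S)) K" for K
    using two_coset_clique_bound[OF H sH S(3,1) _ S(5) that] e S(2) by auto
  moreover have "card (insert s S) = Suc (Suc n)" using S(1,2) H(2) sH by (subst card_insert_disjoint) auto
  moreover have "sidon (insert s S)" using sidon_insert[OF H sH S(3)] e by blast
  ultimately show ?case using S(1,4) s(1) by (intro exI[of _ "insert s S"]) auto
qed

lemma exists_clique_bound_exponent3:
  assumes unc: "uncountable {x::'a::ab_group_add. x + x + x = 0}"
  shows "\<exists>S::'a set. finite S \<and> card S = Suc n \<and> sidon S \<and> involution_free S \<and>
    (\<forall>K. clique (difference_set S) K \<longrightarrow> card K \<le> max (Suc n) 4)"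
proof (induction n)
  case 0
  have 0: "\<forall>K. clique (difference_set {0::'a}) K \<longrightarrow> card K \<le> 1"
    using clique_empty unfolding difference_set_singleton by blast
  have "\<forall>K. clique (difference_set {0::'a}) K \<longrightarrow> card K \<le> max (Suc 0) 4"
    using 0 by (metis le_max_iff_disj One_nat_def)
  then show ?case by (intro exI[of _ "{0}"]) (simp add: sidon_def involution_free_def)
next
  case (Suc n)
  then obtain S :: "'a set" where S: "finite S" "card S = Suc n" "sidon S" "involution_free S"
    "\<And>K. clique (difference_set S) K \<Longrightarrow> card K \<le> max (Suc n) 4" by blast
  obtain H0 where H0: "countable H0" "S \<subseteq> H0" "is_subgroup H0"
    by (rule countable_subgroup_extension[OF countable_finite[OF S(1)]])
  obtain s where s: "s + s + s = 0" "s \<notin> H0" using unc H0(1) countable_subset[of "{x::'a. x + x + x = 0}" H0] by blast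
  have ss: "s + s \<notin> H0"
  proof
    assume "s + s \<in> H0"
    then have "- (s + s) \<in> H0" using is_subgroupD(3)[OF H0(3)] by blast
    moreover have "- (s + s) = s" using s(1) by (metis add.inverse_unique)
    ultimately show False using s(2) by simp
  qed
  have "card K \<le> max (Suc (Suc n)) 4" if "clique (difference_set (insert s S)) K" for K
    using three_coset_clique_bound[OF H0(3,2) s(2) S(3,1,4) s(1) S(5) that] S(2) by auto
  moreover have "card (insert s S) = Suc (Suc n)" using S(1,2) H0(2) s by (subst card_insert_disjoint) auto
  moreover have "sidon (insert s S)" using sidon_insert[OF H0(3,2) s(2) S(3)] ss by blast
  moreover have "involution_free (insert s S)" using involution_free_insert[OF H0(3,2) S(4) ss] .
  ultimately show ?case using S(1) by (intro exI[of _ "insert s S"]) auto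
qed

lemma clique_difference_set_self: "clique (difference_set S) S"
  unfolding clique_def difference_set_def by auto

lemma exists_clique_bound_ge4:
  assumes unc: "uncountable (UNIV :: 'a::ab_group_add set)" and n: "4 \<le> n"
  shows "\<exists>S::'a set. finite S \<and> card S = n \<and> (\<forall>K. clique (difference_set S) K \<longrightarrow> card K \<le> n)"
proof -
  obtain m where m: "n = Suc m" using n by (cases n) auto
  have mx: "max n 4 = n" using n by simp
  from unc consider "uncountable (range (\<lambda>x::'a. x + x))" "uncountable (range (\<lambda>x::'a. x + x + x))"
    | "uncountable {x::'a. x + x = 0}" | "uncountable {x::'a. x + x + x = 0}"
    by (rule uncountable_multiples_or_torsion)
  then show ?thesis
  proof cases
    case 1
    then show ?thesis using exists_clique_bound_generic[OF 1, of m] m by auto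
  next
    case 2
    then show ?thesis using exists_clique_bound_exponent2[OF 2, of m] mx unfolding m by auto
  next
    case 3
    then show ?thesis using exists_clique_bound_exponent3[OF 3, of m] mx unfolding m by auto
  qed
qed

lemma difference_set_pair: "difference_set {0, t::'a::ab_group_add} = (if t = 0 then {} else {t, - t})"
proof (cases "t = 0")
  case False
  then have "t - 0 \<in> difference_set {0, t}" "0 - t \<in> difference_set {0, t}" unfolding difference_set_def by blast+
  moreover have "difference_set {0, t} \<subseteq> {t, - t}" unfolding difference_set_def by auto
  ultimately show ?thesis using False by auto
qed (simp add: difference_set_singleton)

lemma clique_pair_bound:
  fixes t :: "'a::ab_group_add"
  assumes "t + t + t \<noteq> 0" "clique (difference_set {0, t}) K"
  shows "card K \<le> 2"
proof (rule ccontr)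
  assume "\<not> ?thesis"
  then have "3 \<le> card K" by simp
  then obtain K' where "K' \<subseteq> K" "card K' = 3" by (meson obtain_subset_with_card_n)
  then obtain x y z where xyz: "x \<in> K" "y \<in> K" "z \<in> K" "x \<noteq> y" "y \<noteq> z" "x \<noteq> z"
    by (auto simp: card_3_iff)
  have t0: "t \<noteq> 0" using assms by auto
  have *: "b - a = t \<or> b - a = - t" if "a \<in> K" "b \<in> K" "a \<noteq> b" for a b
    using assms(2) that t0 unfolding clique_def difference_set_pair by auto
  have sum: "(y - x) + (z - y) + (x - z) = 0" by simp
  have "d1 + d2 + d3 \<in> {t, - t, t + t + t, - (t + t + t)}" if "d1 \<in> {t, - t}" "d2 \<in> {t, - t}" "d3 \<in> {t, - t}" for d1 d2 d3
    using that by (auto simp: algebra_simps)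
  from this[of "y - x" "z - y" "x - z"] * xyz have "0 \<in> {t, - t, t + t + t, - (t + t + t)}"
    unfolding sum by blast
  then have "t = 0 \<or> t + t + t = 0" by (metis insertE singletonD neg_equal_0_iff_equal)
  then show False using assms(1) t0 by blast
qed

lemma clique_order3_bound:
  fixes t :: "'a::ab_group_add"
  assumes "clique {t, - t} K"
  shows "card K \<le> 3"
proof (cases "K = {}")
  case False
  then obtain k where "k \<in> K" by blast
  then have "K \<subseteq> {k, k + t, k - t}" using clique_subset_translate[OF assms] by auto
  then have "card K \<le> card {k, k + t, k - t}" by (intro card_mono) auto
  also have "\<dots> \<le> 3" by (simp add: card_insert_if)
  finally show ?thesis .
qed simp

text \<open>
  The nonzero differences of \<open>{0, p, q}\<close> form a hexagon \<open>p, q, q - p, - p, - q, p - q\<close> around \<open>0\<close>. The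
  hypotheses imply that no two of its vertices differ by another vertex, except for neighbours; as a hexagon has no triangle,
  cliques have at most three elements. The vertices fall into three opposite pairs \<open>P\<close>, \<open>Q\<close>, \<open>R\<close>
  with different classes modulo \<open>H\<close>, and a clique has at most one vertex in each.
\<close>

lemma hexagon_clique_bound:
  fixes p q :: "'a::ab_group_add"
  assumes H: "is_subgroup H" and pq: "p \<notin> H" "q \<notin> H" "p + q \<notin> H" and pq2: "p + p \<in> H" "q + q \<in> H"
    and ne: "p + p \<noteq> 0" "q + q \<noteq> 0" "p + p \<noteq> q + q"
    and K: "clique (difference_set {0, p, q}) K"
  shows "card K \<le> 3"
proof (cases "K = {}")
  case False
  note D = is_subgroupD[OF H]
  have r: "p - q \<notin> H"
  proof
    assume "p - q \<in> H"
    from D(4)[OF this pq2(2)] show False using pq(3) by (simp add: algebra_simps)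
  qed
  define P where "P = {p, - p}"
  define Q where "Q = {q, - q}"
  define R where "R = {p - q, q - p}"
  have T: "difference_set {0, p, q} \<subseteq> P \<union> Q \<union> R" unfolding P_def Q_def R_def difference_set_def by auto
  have n: "- x \<in> H \<longleftrightarrow> x \<in> H" for x using D(3)[of x] D(3)[of "- x"] by auto
  have TH: "x \<notin> H" if "x \<in> P \<union> Q \<union> R" for x
    using that pq r n[of p] n[of q] n[of "p - q"] unfolding P_def Q_def R_def by auto
  have r2: "(p - q) + (p - q) \<in> H" using D(2)[OF pq2] by (simp add: algebra_simps)
  have e0: "y - x = 0 \<or> y - x = c + c \<or> y - x = - (c + c)" if "x \<in> {c, - c}" "y \<in> {c, - c}" for x y c :: 'a
    using that by auto
  have R': "R = {p - q, - (p - q)}" unfolding R_def by simp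
  have same: "y - x \<in> H" if "x \<in> P \<and> y \<in> P \<or> x \<in> Q \<and> y \<in> Q \<or> x \<in> R \<and> y \<in> R" for x y
  proof -
    have "y - x \<in> H" if "x \<in> {c, - c}" "y \<in> {c, - c}" "c + c \<in> H" for c :: 'a
      using e0[OF that(1,2)] D(1) D(3)[OF that(3)] that(3) by auto
    then show ?thesis using that pq2 r2 unfolding P_def Q_def R' by blast
  qed
  obtain k where k: "k \<in> K" using False by blast
  define L where "L = (\<lambda>x. x - k) ` K - {0}"
  have cK: "clique (difference_set {0, p, q}) ((\<lambda>x. x - k) ` K)" using K unfolding clique_translate .
  have k0: "0 \<in> (\<lambda>x. x - k) ` K" by (rule image_eqI[of _ _ k]) (simp_all add: k)
  have adj0: "y - x \<in> P \<union> Q \<union> R" if "x \<in> insert 0 L" "y \<in> insert 0 L" "x \<noteq> y" for x y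
  proof -
    have "x \<in> (\<lambda>x. x - k) ` K" "y \<in> (\<lambda>x. x - k) ` K" using that(1,2) k0 unfolding L_def by auto
    then have "y - x \<in> difference_set {0, p, q}" using cK that(3) unfolding clique_def by (metis (no_types, lifting))
    then show ?thesis using T by (rule subsetD[rotated])
  qed
  have LT: "x \<in> P \<union> Q \<union> R" if "x \<in> L" for x
    using adj0[of 0 x] that unfolding L_def by simp
  have adj: "y - x \<in> P \<union> Q \<union> R" if "x \<in> L" "y \<in> L" "x \<noteq> y" for x y
    using adj0[of x y] that by simp
  have one: "card (L \<inter> P) \<le> 1" "card (L \<inter> Q) \<le> 1" "card (L \<inter> R) \<le> 1"
  proof -
    have "finite (L \<inter> P)" "finite (L \<inter> Q)" "finite (L \<inter> R)" unfolding P_def Q_def R_def by auto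
    moreover have "x = y" if "x \<in> L" "y \<in> L" "x \<in> P \<and> y \<in> P \<or> x \<in> Q \<and> y \<in> Q \<or> x \<in> R \<and> y \<in> R" for x y
      using adj[OF that(1,2)] TH same[OF that(3)] by blast
    ultimately show "card (L \<inter> P) \<le> 1" "card (L \<inter> Q) \<le> 1" "card (L \<inter> R) \<le> 1"
      by (simp_all add: card_le_Suc0_iff_eq)
  qed
  have "L \<inter> P = {} \<or> L \<inter> Q = {} \<or> L \<inter> R = {}"
  proof (rule ccontr)
    assume "\<not> ?thesis"
    then obtain x y z where xyz: "x \<in> L" "x \<in> P" "y \<in> L" "y \<in> Q" "z \<in> L" "z \<in> R" by blast
    have disj: "x \<noteq> y" "x \<noteq> z" "y \<noteq> z"
    proof -
      show "x \<noteq> y"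
      proof
        assume "x = y"
        then have "p - x \<in> H" "q - x \<in> H" using same[of x p] same[of x q] xyz unfolding P_def Q_def by auto
        from D(2)[OF this] show False using r by simp
      qed
      show "x \<noteq> z"
      proof
        assume "x = z"
        then have "p - x \<in> H" "p - q - x \<in> H" using same[of x p] same[of x "p - q"] xyz unfolding P_def R_def by auto
        from D(2)[OF this] show False using pq by simp
      qed
      show "y \<noteq> z"
      proof
        assume "y = z"
        then have "q - y \<in> H" "p - q - y \<in> H" using same[of y q] same[of y "p - q"] xyz unfolding Q_def R_def by auto
        from D(2)[OF this(2,1)] have "p - (q + q) \<in> H" by (simp add: algebra_simps)
        from D(4)[OF this pq2(2)] show False using pq by simp
      qed
    qed
    have step: "w - v \<notin> C \<and> w - v \<notin> C'" if C: "C \<in> {P, Q, R}" "C' \<in> {P, Q, R}" and vw: "v \<in> C" "w \<in> C'" for v w C C'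
    proof
      have neg: "- v \<in> C" using C(1) vw(1) unfolding P_def Q_def R_def by auto
      have h: "v \<notin> H" "w \<notin> H" using TH C vw by auto
      show "w - v \<notin> C" using same[of "- v" "w - v"] neg C(1) h(2) by auto
      show "w - v \<notin> C'"
      proof
        assume "w - v \<in> C'"
        then have "w - v - w \<in> H" using same[of w "w - v"] vw C(2) by blast
        then show False using h(1) n by simp
      qed
    qed
    have "y - x \<in> R" using step[of P Q x y] adj[of x y] disj xyz by auto
    moreover have "z - x \<in> Q" using step[of P R x z] adj[of x z] disj xyz by auto
    moreover have "z - y \<in> P" using step[of Q R y z] adj[of y z] disj xyz by auto
    ultimately have d: "y - x = p - q \<or> y - x = q - p" "z - x = q \<or> z - x = - q" "z - y = p \<or> z - y = - p"
      and e: "x = p \<or> x = - p" "y = q \<or> y = - q" "z = p - q \<or> z = q - p"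
      using xyz unfolding P_def Q_def R_def by auto
    have "(x = p \<and> y = q) \<or> (x = - p \<and> y = - q)"
      using e(1,2) d(1) ne by (auto simp: algebra_simps eq_neg_iff_add_eq_0)
    then show False using e(3) d(2,3) ne by (auto simp: algebra_simps eq_neg_iff_add_eq_0 neg_eq_iff_add_eq_0)
  qed
  then have "card L \<le> 2"
  proof -
    have "L = (L \<inter> P) \<union> (L \<inter> Q) \<union> (L \<inter> R)" using LT by auto
    then have "card L \<le> card (L \<inter> P) + card (L \<inter> Q) + card (L \<inter> R)"
      by (metis card_Un_le add_le_mono1 order_trans)
    moreover assume "L \<inter> P = {} \<or> L \<inter> Q = {} \<or> L \<inter> R = {}"
    ultimately show ?thesis using one by (auto simp del: One_nat_def)
  qed
  moreover have "card ((\<lambda>x. x - k) ` K) = card L + 1"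
  proof -
    have "finite K" using finite_clique[OF finite_difference_set K] by simp
    then show ?thesis using card.remove[OF finite_imageI k0] unfolding L_def by simp
  qed
  moreover have "card ((\<lambda>x. x - k) ` K) = card K" by (rule card_image) (auto simp: inj_on_def)
  ultimately show ?thesis by simp
qed simp

text \<open>
  Adding generic elements \<open>u\<close>, \<open>v\<close> of order two to \<open>a\<close>, \<open>b\<close> changes neither \<open>2a\<close> nor \<open>2b\<close>
  but separates the classes modulo a countable subgroup.
\<close>

lemma exists_hexagon:
  fixes a b :: "'a::ab_group_add"
  assumes unc: "uncountable {x::'a. x + x = 0}"
    and ab: "a + a \<noteq> 0" "b + b \<noteq> 0" "a + a \<noteq> b + b"
  shows "\<exists>S::'a set. finite S \<and> card S = 3 \<and> (\<forall>K. clique (difference_set S) K \<longrightarrow> card K \<le> 3)"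
proof -
  obtain H where H: "countable H" "{a,b} \<subseteq> H" "is_subgroup H"
    using countable_subgroup_extension[of "{a,b}"] by auto
  note D = is_subgroupD[OF H(3)]
  obtain u where u: "u + u = 0" "u \<notin> H" using unc H(1) countable_subset[of "{x::'a. x + x = 0}" H] by blast
  have "countable (H \<union> (\<lambda>x. x - u) ` H)" using H(1) by auto
  then obtain v where v: "v + v = 0" "v \<notin> H \<union> (\<lambda>x. x - u) ` H"
    using unc countable_subset[of "{x::'a. x + x = 0}" "H \<union> (\<lambda>x. x - u) ` H"] by blast
  have vH: "v \<notin> H" and uvH: "u + v \<notin> H"
  proof -
    show "v \<notin> H" using v by blast
    show "u + v \<notin> H"
    proof
      assume "u + v \<in> H"
      then have "v \<in> (\<lambda>x. x - u) ` H" by (intro image_eqI[of _ _ "u + v"]) auto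
      then show False using v by blast
    qed
  qed
  define p where "p = a + u"
  define q where "q = b + v"
  have aH: "a \<in> H" "b \<in> H" using H by auto
  have 2: "p + p = a + a" "q + q = b + b"
    unfolding p_def q_def using u(1) v(1) by (metis add.assoc add.commute add.right_neutral)+
  have "u = p - a" "v = q - b" unfolding p_def q_def by simp_all
  then have "p \<notin> H" "q \<notin> H" using u(2) vH D(2) aH by metis+
  moreover have "p + q \<notin> H"
  proof
    assume h: "p + q \<in> H"
    have "u + v = (p + q) - (a + b)" unfolding p_def q_def by simp
    then show False using D(2)[OF h D(4)[OF aH]] uvH by simp
  qed
  ultimately have "card K \<le> 3" if "clique (difference_set {0, p, q}) K" for K
    using hexagon_clique_bound[OF H(3) _ _ _ _ _ _ _ _ that] 2 D(4) aH ab by metis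
  moreover have "card {0, p, q} = 3"
  proof -
    have "p \<noteq> 0" "q \<noteq> 0" "p \<noteq> q" using ab 2 by auto
    then show ?thesis by auto
  qed
  ultimately show ?thesis by (intro exI[of _ "{0, p, q}"]) auto
qed

text \<open>
  For \<open>n = 2\<close> the set \<open>{0, t}\<close> works unless \<open>{0, t, - t}\<close> is a clique, that is unless \<open>t\<close> has order
  three. For \<open>n = 3\<close> the exponent two construction would give four-element cliques, so that case uses the hexagon; if
  the elements of order three are uncountably many, a subgroup \<open>{0, t, - t}\<close> of order three works as well.
\<close>

lemma exists_finite_clique_set:
  assumes unc: "uncountable (UNIV :: 'a::ab_group_add set)" and n: "1 \<le> n"
    and two: "n = 2 \<Longrightarrow> \<exists>t::'a. t + t + t \<noteq> 0"
    and three: "n = 3 \<Longrightarrow> \<exists>a b::'a. a + a \<noteq> 0 \<and> b + b \<noteq> 0 \<and> a + a \<noteq> b + b"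
  shows "\<exists>S::'a set. finite S \<and> card S = n \<and> (\<forall>K. clique (difference_set S) K \<longrightarrow> card K \<le> n)"
proof -
  consider "n = 1" | "n = 2" | "n = 3" | "4 \<le> n" using n by linarith
  then show ?thesis
  proof cases
    case 1
    then show ?thesis using clique_empty unfolding 1 by (intro exI[of _ "{0}"]) (auto simp: difference_set_singleton simp del: One_nat_def)
  next
    case 2
    then obtain t :: 'a where t: "t + t + t \<noteq> 0" using two by blast
    then have "t \<noteq> 0" by auto
    then show ?thesis using clique_pair_bound[OF t] 2 by (intro exI[of _ "{0, t}"]) auto
  next
    case 3
    from unc consider "uncountable (range (\<lambda>x::'a. x + x))" "uncountable (range (\<lambda>x::'a. x + x + x))"
      | "uncountable {x::'a. x + x = 0}" | "uncountable {x::'a. x + x + x = 0}"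
      by (rule uncountable_multiples_or_torsion)
    then show ?thesis
    proof cases
      case 1
      have e: "n = Suc 2" using 3 by simp
      show ?thesis using exists_clique_bound_generic[OF 1, of 2] unfolding e by blast
    next
      case 2
      obtain a b :: 'a where ab: "a + a \<noteq> 0" "b + b \<noteq> 0" "a + a \<noteq> b + b" using three 3 by blast
      show ?thesis using exists_hexagon[OF 2 ab] unfolding 3 .
    next
      case c: 3
      have "\<exists>t::'a. t + t + t = 0 \<and> t \<noteq> 0"
      proof (rule ccontr)
        assume "\<not> ?thesis"
        then have "{x::'a. x + x + x = 0} \<subseteq> {0}" by blast
        then have "countable {x::'a. x + x + x = 0}" by (rule countable_subset) simp
        then show False using c by simp
      qed
      then obtain t :: 'a where t: "t + t + t = 0" "t \<noteq> 0" by blast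
      have mt: "- t = t + t" by (rule minus_unique) (use t(1) in \<open>simp add: add.assoc\<close>)
      have tt: "t + t \<noteq> 0" unfolding mt[symmetric] using t(2) by simp
      have tt': "t - - t = - t" "- t - t = t" by (simp_all add: mt)
      have "x - y = 0 \<or> x - y = t \<or> x - y = - t" if "x \<in> {0, t, - t}" "y \<in> {0, t, - t}" for x y
        using that tt' by auto
      then have "difference_set {0, t, - t} \<subseteq> {t, - t}" unfolding difference_set_def by fastforce
      then have "card K \<le> 3" if "clique (difference_set {0, t, - t}) K" for K
        using clique_order3_bound[of t K] clique_mono that by blast
      moreover have "card {0, t, - t} = 3" using t tt unfolding mt by auto
      ultimately show ?thesis using 3 by (intro exI[of _ "{0, t, - t}"]) auto
    qed
  next
    case 4
    then show ?thesis by (rule exists_clique_bound_ge4[OF unc])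
  qed
qed

lemma finite_card_ordLeq_iff:
  assumes "finite A" "finite B"
  shows "|A| \<le>o |B| \<longleftrightarrow> card A \<le> card B"
proof
  assume "|A| \<le>o |B|"
  then obtain f where "inj_on f A" "f ` A \<subseteq> B" using card_of_ordLeq[of A B] by blast
  then show "card A \<le> card B" using assms(2) card_inj_on_le by blast
next
  assume "card A \<le> card B"
  then obtain f where "inj_on f A" "f ` A \<subseteq> B" using card_le_inj[OF assms] by blast
  then show "|A| \<le>o |B|" using card_of_ordLeq[of A B] by blast
qed

lemma finite_ordLess_infinite_set:
  assumes "finite A" "infinite B"
  shows "|A| <o |B|"
  using assms by (intro finite_ordLess_infinite) (auto simp: card_of_well_order_on Field_card_of)

lemma difference_set_symmetric: "t \<in> difference_set S \<Longrightarrow> - t \<in> difference_set S"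
proof -
  assume "t \<in> difference_set S"
  then obtain x y where "t = x - y" "x \<in> S" "y \<in> S" "x \<noteq> y" unfolding difference_set_def by blast
  then have "- t = y - x" "y \<in> S" "x \<in> S" "y \<noteq> x" by auto
  then show ?thesis unfolding difference_set_def by blast
qed

lemma zero_notin_difference_set: "0 \<notin> difference_set S"
  unfolding difference_set_def by auto

theorem exists_clique_set:
  fixes \<kappa> :: "'k rel"
  assumes unc: "uncountable (UNIV :: 'a::ab_group_add set)"
    and \<kappa>: "Card_order \<kappa>" "|{..<1::nat}| \<le>o \<kappa>" "\<kappa> <o |UNIV :: 'a set|"
    and two: "\<kappa> =o |{..<2::nat}| \<Longrightarrow> \<exists>t::'a. t + t + t \<noteq> 0"
    and three: "\<kappa> =o |{..<3::nat}| \<Longrightarrow> \<exists>a b::'a. a + a \<noteq> 0 \<and> b + b \<noteq> 0 \<and> a + a \<noteq> b + b"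
  shows "\<exists>S::'a set. |S| =o \<kappa> \<and> |difference_set S| <o |UNIV :: 'a set| \<and>
    (\<forall>K. clique (difference_set S) K \<longrightarrow> |K| \<le>o \<kappa>)"
proof (cases "finite (Field \<kappa>)")
  case True
  have infU: "infinite (UNIV :: 'a set)" using unc countable_finite by blast
  define n where "n = card (Field \<kappa>)"
  have fn: "|Field \<kappa>| =o |{..<n}|" using True unfolding n_def by (metis card_of_ordIso finite_lessThan card_lessThan finite_same_card_bij)
  have n\<kappa>: "\<kappa> =o |{..<n}|" using ordIso_transitive[OF ordIso_symmetric[OF card_of_Field_ordIso[OF \<kappa>(1)]] fn] .
  have "|{..<1::nat}| \<le>o |{..<n}|" using \<kappa>(2) n\<kappa> ordLeq_ordIso_trans by blast
  then have n1: "1 \<le> n" by (subst (asm) finite_card_ordLeq_iff) auto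
  obtain S :: "'a set" where S: "finite S" "card S = n" "\<And>K. clique (difference_set S) K \<Longrightarrow> card K \<le> n"
    using exists_finite_clique_set[OF unc n1] two three n\<kappa> by metis
  have "|S| =o |{..<n}|" using S(1,2) by (metis card_of_ordIso finite_lessThan card_lessThan finite_same_card_bij)
  then have "|S| =o \<kappa>" using n\<kappa> ordIso_transitive ordIso_symmetric by blast
  moreover have "|difference_set S| <o |UNIV :: 'a set|"
    using finite_difference_set[OF S(1)] infU by (rule finite_ordLess_infinite_set)
  moreover have "|K| \<le>o \<kappa>" if K: "clique (difference_set S) K" for K
  proof -
    have "finite K" using finite_clique[OF finite_difference_set[OF S(1)] K] .
    then have "|K| \<le>o |{..<n}|" using S(3)[OF K] by (subst finite_card_ordLeq_iff) auto
    then show ?thesis using n\<kappa> ordLeq_ordIso_trans ordIso_symmetric by blast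
  qed
  ultimately show ?thesis by blast
next
  case False
  have F\<kappa>: "|Field \<kappa>| =o \<kappa>" using card_of_Field_ordIso[OF \<kappa>(1)] .
  then have "|Field \<kappa>| \<le>o |UNIV :: 'a set|" using \<kappa>(3) ordIso_ordLess_trans ordLess_imp_ordLeq by blast
  then obtain f :: "'k \<Rightarrow> 'a" where f: "inj_on f (Field \<kappa>)" using card_of_ordLeq[of "Field \<kappa>" "UNIV :: 'a set"] by blast
  define S where "S = f ` Field \<kappa>"
  have "|Field \<kappa>| =o |S|" using f unfolding S_def by (metis card_of_ordIsoI inj_on_imp_bij_betw)
  then have S\<kappa>: "|S| =o \<kappa>" using F\<kappa> ordIso_transitive ordIso_symmetric by blast
  have infS: "infinite S" using False f unfolding S_def by (simp add: finite_image_iff)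
  have SS: "|S \<times> S| =o \<kappa>" using card_of_Times_same_infinite[OF infS] S\<kappa> ordIso_transitive by blast
  have "difference_set S \<subseteq> (\<lambda>(x, y). x - y) ` (S \<times> S)" unfolding difference_set_def by force
  then have "|difference_set S| \<le>o \<kappa>"
    using card_of_mono1 card_of_image SS ordLeq_transitive ordLeq_ordIso_trans by metis
  then have "|difference_set S| <o |UNIV :: 'a set|" using \<kappa>(3) ordLeq_ordLess_trans by blast
  moreover have "|K| \<le>o \<kappa>" if K: "clique (difference_set S) K" for K
  proof (cases "K = {}")
    case True
    then show ?thesis by (simp add: \<kappa>(1) card_of_empty1 card_order_on_well_order_on)
  next
    case False
    then obtain k where k: "k \<in> K" by blast
    obtain z where z: "z \<in> S" using infS by (metis finite.emptyI ex_in_conv)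
    have "K \<subseteq> (\<lambda>(x, y). k + (x - y)) ` (S \<times> S)"
    proof
      fix x assume "x \<in> K"
      then have "x = k + (z - z) \<or> (\<exists>a\<in>S. \<exists>b\<in>S. x = k + (a - b))"
        using clique_subset_translate[OF K k] unfolding difference_set_def by auto
      then show "x \<in> (\<lambda>(x, y). k + (x - y)) ` (S \<times> S)" using z by force
    qed
    then show ?thesis
      using card_of_mono1 card_of_image SS ordLeq_transitive ordLeq_ordIso_trans by metis
  qed
  ultimately show ?thesis using S\<kappa> by blast
qed

section \<open>A perfect set with few coincidences of sums\<close>

lemma continuous_translate:
  "continuous_on UNIV (\<lambda>x::'a::topological_ab_group_add. x - a)"
  by (intro continuous_intros)

lemma open_translate: "open U \<Longrightarrow> open {x::'a::topological_ab_group_add. x - a \<in> U}"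
  using continuous_on_open_vimage[of UNIV "\<lambda>x. x - a"] continuous_translate[of a] by (simp add: vimage_def)

lemma not_open_singleton:
  assumes "(euclidean :: 'a::{topological_ab_group_add} topology) \<noteq> discrete_topology UNIV"
  shows "\<not> open {x::'a}"
proof
  assume o: "open {x}"
  have "open {y}" for y :: 'a
  proof -
    have "{z. z - (y - x) \<in> {x}} = {y}" by (auto simp: algebra_simps)
    then show ?thesis using open_translate[OF o, of "y - x"] by simp
  qed
  then have "open (\<Union>y\<in>S. {y})" for S :: "'a set" by (intro open_UN) auto
  then have "open S" for S :: "'a set" by simp
  then have "(euclidean :: 'a topology) = discrete_topology UNIV" by (simp add: topology_eq)
  then show False using assms by simp
qed

lemma infinite_open:
  fixes U :: "'a::t1_space set"
  assumes iso: "\<And>x::'a. \<not> open {x}" and U: "open U" "U \<noteq> {}"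
  shows "infinite U"
proof
  assume f: "finite U"
  obtain x where x: "x \<in> U" using U by blast
  have "open (U - (U - {x}))" using U(1) f by (intro open_Diff finite_imp_closed) auto
  moreover have "U - (U - {x}) = {x}" using x by auto
  ultimately show False using iso by simp
qed

text \<open>
  Every new point has to avoid finitely many values \<open>c k + c l - c j\<close>. Only four distinct indices are considered:
  a relation \<open>2 x = c k + c l\<close> may hold for all \<open>x\<close> in an open set.
\<close>

lemma generic_points:
  fixes U :: "'i \<Rightarrow> 'a::{t1_space, ab_group_add} set"
  assumes iso: "\<And>x::'a. \<not> open {x}" and fin: "finite I"
    and U: "\<And>i. i \<in> I \<Longrightarrow> open (U i) \<and> U i \<noteq> {}"
  shows "\<exists>c. (\<forall>i\<in>I. c i \<in> U i) \<and> inj_on c I \<and>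
    (\<forall>i\<in>I. \<forall>j\<in>I. \<forall>k\<in>I. \<forall>l\<in>I. distinct [i, j, k, l] \<longrightarrow> c i + c j \<noteq> c k + c l)"
  using fin U
proof (induction I rule: finite_induct)
  case empty
  then show ?case by simp
next
  case (insert m I)
  then obtain c where c: "\<And>i. i \<in> I \<Longrightarrow> c i \<in> U i" "inj_on c I"
    "\<And>i j k l. \<lbrakk>i \<in> I; j \<in> I; k \<in> I; l \<in> I; distinct [i, j, k, l]\<rbrakk> \<Longrightarrow> c i + c j \<noteq> c k + c l"
    by (metis (no_types, lifting) insertI2)
  define F where "F = c ` I \<union> (\<lambda>(j, k, l). c k + c l - c j) ` (I \<times> I \<times> I)"
  have "finite F" unfolding F_def using insert.hyps by auto
  moreover have "infinite (U m)" using infinite_open[OF iso] insert.prems by auto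
  ultimately obtain x where x: "x \<in> U m" "x \<notin> F" by (meson finite_subset subsetI)
  have xF: "x \<noteq> c i" "x \<noteq> c k + c l - c j" if "i \<in> I" "j \<in> I" "k \<in> I" "l \<in> I" for i j k l
    using x(2) that unfolding F_def by force+
  define c' where "c' = c(m := x)"
  have c'm: "c' m = x" and c'I: "\<And>i. i \<in> I \<Longrightarrow> c' i = c i" using insert.hyps unfolding c'_def by auto
  show ?case
  proof (intro exI[of _ c'] conjI ballI impI)
    show "c' i \<in> U i" if "i \<in> insert m I" for i using that c(1) x(1) c'm c'I by auto
    show "inj_on c' (insert m I)"
      using c(2) xF(1) c'm c'I insert.hyps unfolding inj_on_def by (metis insert_iff)
  next
    fix i j k l assume ijkl: "i \<in> insert m I" "j \<in> insert m I" "k \<in> insert m I" "l \<in> insert m I" and d: "distinct [i, j, k, l]"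
    consider "i \<in> I" "j \<in> I" "k \<in> I" "l \<in> I" | "i = m" "j \<in> I" "k \<in> I" "l \<in> I" | "i \<in> I" "j = m" "k \<in> I" "l \<in> I"
      | "i \<in> I" "j \<in> I" "k = m" "l \<in> I" | "i \<in> I" "j \<in> I" "k \<in> I" "l = m" using ijkl d by auto
    then show "c' i + c' j \<noteq> c' k + c' l"
    proof cases
      case 1 then show ?thesis using c(3)[OF 1 d] c'I by simp
    next
      case 2 then show ?thesis using xF(2)[of j j k l] c'I c'm by (auto simp: algebra_simps)
    next
      case 3 then show ?thesis using xF(2)[of i i k l] c'I c'm by (auto simp: algebra_simps)
    next
      case 4 then show ?thesis using xF(2)[of i l i j] c'I c'm by (auto simp: algebra_simps)
    next
      case 5 then show ?thesis using xF(2)[of i k i j] c'I c'm by (auto simp: algebra_simps)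
    qed
  qed
qed

lemma add_near:
  fixes a b :: "'a::{metric_space, topological_ab_group_add}"
  assumes W: "open W" "a + b \<in> W"
  shows "\<exists>r>0. \<forall>u\<in>cball a r. \<forall>v\<in>cball b r. u + v \<in> W"
proof -
  have "open ((\<lambda>p::'a \<times> 'a. fst p + snd p) -` W)"
    using W(1) by (intro continuous_open_vimage) (auto intro!: continuous_intros simp: continuous_on_eq_continuous_at)
  then obtain A B where AB: "open A" "open B" "a \<in> A" "b \<in> B" "A \<times> B \<subseteq> (\<lambda>p. fst p + snd p) -` W"
    by (rule open_prod_elim[of _ "(a, b)"]) (use W(2) in auto)
  obtain r s where "r > 0" "cball a r \<subseteq> A" "s > 0" "cball b s \<subseteq> B"
    using AB by (metis open_contains_cball)
  then have "\<forall>u\<in>cball a (min r s). \<forall>v\<in>cball b (min r s). u + v \<in> W" using AB(5) by fastforce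
  then show ?thesis using \<open>r > 0\<close> \<open>s > 0\<close> by (intro exI[of _ "min r s"]) auto
qed

lemma finite_common_radius:
  fixes P :: "'b \<Rightarrow> real \<Rightarrow> bool"
  assumes "finite A" "\<And>a. a \<in> A \<Longrightarrow> \<exists>r>0. P a r" "\<And>a r s. P a r \<Longrightarrow> 0 < s \<Longrightarrow> s \<le> r \<Longrightarrow> P a s"
  shows "\<exists>r>0. \<forall>a\<in>A. P a r"
  using assms(1,2)
proof (induction A rule: finite_induct)
  case empty
  then show ?case by (auto intro: exI[of _ 1])
next
  case (insert x A)
  then obtain r s where "r > 0" "\<forall>a\<in>A. P a r" "s > 0" "P x s" by (metis insert_iff)
  moreover from this have "P a (min r s)" if "a \<in> A" for a using assms(3)[of a r "min r s"] that by simp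
  moreover from calculation have "P x (min r s)" using assms(3)[of x s "min r s"] by simp
  ultimately show ?case by (intro exI[of _ "min r s"]) auto
qed

text \<open>
  The inequalities that hold at finitely many generic points persist on small closed balls around them. The same radius
  serves for a ball around \<open>0\<close> that the differences of points in distinct balls avoid; this uniform separation is
  translation invariant, whereas the metric need not be.
\<close>

lemma exists_next_level:
  fixes U :: "nat \<Rightarrow> 'a::{metric_space, topological_ab_group_add} set"
  assumes iso: "\<And>x::'a. \<not> open {x}" and U: "\<And>k. k < N \<Longrightarrow> open (U k) \<and> U k \<noteq> {}" and e: "\<epsilon> > 0"
  shows "\<exists>c r. 0 < r \<and> r \<le> \<epsilon> \<and> (\<forall>k<N. cball (c k) r \<subseteq> U k) \<and>
    (\<forall>k<N. \<forall>l<N. k \<noteq> l \<longrightarrow> (\<forall>u\<in>cball (c k) r. \<forall>v\<in>cball (c l) r. u - v \<notin> cball 0 r)) \<and>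
    (\<forall>i<N. \<forall>j<N. \<forall>k<N. \<forall>l<N. distinct [i, j, k, l] \<longrightarrow>
      (\<forall>a\<in>cball (c i) r. \<forall>b\<in>cball (c j) r. \<forall>u\<in>cball (c k) r. \<forall>v\<in>cball (c l) r. a + b \<noteq> u + v))"
proof -
  obtain c where c: "\<forall>i\<in>{..<N}. c i \<in> U i" "inj_on c {..<N}"
    "\<forall>i\<in>{..<N}. \<forall>j\<in>{..<N}. \<forall>k\<in>{..<N}. \<forall>l\<in>{..<N}. distinct [i, j, k, l] \<longrightarrow> c i + c j \<noteq> c k + c l"
    using generic_points[OF iso, of "{..<N}" U] U by auto
  have "\<exists>r>0. \<forall>k\<in>{..<N}. cball (c k) r \<subseteq> U k"
  proof (rule finite_common_radius)
    fix k assume "k \<in> {..<N}"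
    then show "\<exists>r>0. cball (c k) r \<subseteq> U k" using U[of k] c(1) open_contains_cball[of "U k"] by auto
  qed auto
  then obtain r1 where r1: "r1 > 0" "\<forall>k\<in>{..<N}. cball (c k) r1 \<subseteq> U k" by blast
  let ?S = "\<lambda>(k, l) r. \<forall>u\<in>cball (c k) r. \<forall>v\<in>cball (c l) r. u - v \<notin> cball 0 r"
  have "\<exists>r>0. \<forall>p\<in>{(k, l). k < N \<and> l < N \<and> k \<noteq> l}. ?S p r"
  proof (rule finite_common_radius)
    show "finite {(k, l). k < N \<and> l < N \<and> k \<noteq> l}" by (rule finite_subset[of _ "{..<N} \<times> {..<N}"]) auto
    fix p assume "p \<in> {(k, l). k < N \<and> l < N \<and> k \<noteq> l}"
    then obtain k l where p: "p = (k, l)" "k < N" "l < N" "k \<noteq> l" by auto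
    have "c k \<noteq> 0 + c l" using p c(2) by (auto simp: inj_on_def)
    then obtain A B where AB: "open A" "open B" "c k \<in> A" "0 + c l \<in> B" "A \<inter> B = {}"
      using hausdorff[of "c k" "0 + c l"] by blast
    obtain s where s: "s > 0" "cball (c k) s \<subseteq> A" using AB open_contains_cball by blast
    obtain t where t: "t > 0" "\<forall>u\<in>cball 0 t. \<forall>v\<in>cball (c l) t. u + v \<in> B" using add_near[OF AB(2,4)] by blast
    have "u - v \<notin> cball 0 (min s t)" if uv: "u \<in> cball (c k) (min s t)" "v \<in> cball (c l) (min s t)" for u v
    proof
      assume "u - v \<in> cball 0 (min s t)"
      then have "u - v \<in> cball 0 t" "v \<in> cball (c l) t" using uv by auto
      then have "(u - v) + v \<in> B" using t(2) by blast
      moreover have "u \<in> A" using s uv by auto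
      ultimately show False using AB(5) by auto
    qed
    then show "\<exists>r>0. ?S p r" using s t p by (intro exI[of _ "min s t"]) auto
  next
    fix p :: "nat \<times> nat" and r s :: real
    assume a: "?S p r" "0 < s" "s \<le> r"
    obtain k l where p: "p = (k, l)" by (cases p) auto
    have "cball x s \<subseteq> cball x r" for x :: 'a using a by auto
    then show "?S p s" using a(1) unfolding p prod.case by blast
  qed
  then obtain r2 where r2: "r2 > 0" "\<forall>p\<in>{(k, l). k < N \<and> l < N \<and> k \<noteq> l}. ?S p r2" by blast
  let ?T = "\<lambda>(i, j, k, l) r. \<forall>a\<in>cball (c i) r. \<forall>b\<in>cball (c j) r. \<forall>u\<in>cball (c k) r. \<forall>v\<in>cball (c l) r. a + b \<noteq> u + v"
  let ?D = "{(i, j, k, l). i < N \<and> j < N \<and> k < N \<and> l < N \<and> distinct [i, j, k, l]}"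
  have "\<exists>r>0. \<forall>p\<in>?D. ?T p r"
  proof (rule finite_common_radius)
    show "finite ?D" by (rule finite_subset[of _ "{..<N} \<times> {..<N} \<times> {..<N} \<times> {..<N}"]) auto
    fix p assume "p \<in> ?D"
    then obtain i j k l where p: "p = (i, j, k, l)" "i < N" "j < N" "k < N" "l < N" "distinct [i, j, k, l]" by auto
    have "c i + c j \<noteq> c k + c l" using p c(3) by auto
    then obtain A B where AB: "open A" "open B" "c i + c j \<in> A" "c k + c l \<in> B" "A \<inter> B = {}"
      using hausdorff[of "c i + c j" "c k + c l"] by blast
    obtain s where s: "s > 0" "\<forall>u\<in>cball (c i) s. \<forall>v\<in>cball (c j) s. u + v \<in> A" using add_near[OF AB(1,3)] by blast
    obtain t where t: "t > 0" "\<forall>u\<in>cball (c k) t. \<forall>v\<in>cball (c l) t. u + v \<in> B" using add_near[OF AB(2,4)] by blast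
    have "a + b \<noteq> u + v" if "a \<in> cball (c i) (min s t)" "b \<in> cball (c j) (min s t)" "u \<in> cball (c k) (min s t)" "v \<in> cball (c l) (min s t)" for a b u v
    proof -
      have "a + b \<in> A" "u + v \<in> B" using that s(2) t(2) by auto
      then show ?thesis using AB(5) by auto
    qed
    then show "\<exists>r>0. ?T p r" using s t p by (intro exI[of _ "min s t"]) auto
  next
    fix p :: "nat \<times> nat \<times> nat \<times> nat" and r s :: real
    assume a: "?T p r" "0 < s" "s \<le> r"
    obtain i j k l where p: "p = (i, j, k, l)" by (cases p) auto
    have "cball x s \<subseteq> cball x r" for x :: 'a using a by auto
    then show "?T p s" using a(1) unfolding p prod.case by blast
  qed
  then obtain r3 where r3: "r3 > 0" "\<forall>p\<in>?D. ?T p r3" by blast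
  define r where "r = min \<epsilon> (min r1 (min r2 r3))"
  have r: "r > 0" "r \<le> \<epsilon>" "r \<le> r1" "r \<le> r2" "r \<le> r3" using e r1 r2 r3 unfolding r_def by auto
  have sub: "cball x r \<subseteq> cball x r1" "cball x r \<subseteq> cball x r2" "cball x r \<subseteq> cball x r3" for x :: 'a using r by auto
  show ?thesis
  proof (intro exI[of _ c] exI[of _ r] conjI allI impI ballI)
    show "0 < r" "r \<le> \<epsilon>" using r by auto
    show "cball (c k) r \<subseteq> U k" if "k < N" for k using r1(2) sub(1)[of "c k"] that by blast
    show "u - v \<notin> cball 0 r" if "k < N" "l < N" "k \<noteq> l" "u \<in> cball (c k) r" "v \<in> cball (c l) r" for k l u v
    proof -
      have "u \<in> cball (c k) r2" "v \<in> cball (c l) r2" using sub(2) that by blast+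
      moreover have "?S (k, l) r2" using r2(2) that by blast
      ultimately have "u - v \<notin> cball 0 r2" by blast
      then show ?thesis using sub(2) by blast
    qed
    show "a + b \<noteq> u + v" if "i < N" "j < N" "k < N" "l < N" "distinct [i, j, k, l]"
      "a \<in> cball (c i) r" "b \<in> cball (c j) r" "u \<in> cball (c k) r" "v \<in> cball (c l) r" for i j k l a b u v
    proof -
      have "a \<in> cball (c i) r3" "b \<in> cball (c j) r3" "u \<in> cball (c k) r3" "v \<in> cball (c l) r3" using sub(3) that by blast+
      moreover have "?T (i, j, k, l) r3" using r3(2) that by blast
      ultimately show ?thesis by blast
    qed
  qed
qed

text \<open>
  A tree of balls in which the ball \<open>k\<close> of level \<open>Suc n\<close> lies in the ball \<open>k div 4\<close> of level \<open>n\<close>.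
  There are two roots, \<open>0\<close> and \<open>1\<close>, so that the indices of level \<open>n\<close> are those below \<open>2 * 4 ^ n\<close>.
  Even if one child of a node is forbidden, at least two of the four remain.
\<close>

locale sidon_tree =
  fixes c :: "nat \<Rightarrow> nat \<Rightarrow> 'a::{polish_space, topological_ab_group_add}" and r :: "nat \<Rightarrow> real"
  assumes r_pos: "0 < r n" and r_le: "r n \<le> 1 / real (Suc n)"
    and nested: "k < 2 * 4 ^ Suc n \<Longrightarrow> cball (c (Suc n) k) (r (Suc n)) \<subseteq> cball (c n (k div 4)) (r n)"
    and separated: "\<lbrakk>k < 2 * 4 ^ n; l < 2 * 4 ^ n; k \<noteq> l; u \<in> cball (c n k) (r n); v \<in> cball (c n l) (r n)\<rbrakk>
      \<Longrightarrow> u - v \<notin> cball 0 (r n)"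
    and sums: "\<lbrakk>i < 2 * 4 ^ n; j < 2 * 4 ^ n; k < 2 * 4 ^ n; l < 2 * 4 ^ n; distinct [i, j, k, l];
      a \<in> cball (c n i) (r n); b \<in> cball (c n j) (r n); u \<in> cball (c n k) (r n); v \<in> cball (c n l) (r n)\<rbrakk>
      \<Longrightarrow> a + b \<noteq> u + v"

lemma exists_sidon_tree:
  assumes iso: "\<And>x::'a::{polish_space, topological_ab_group_add}. \<not> open {x}"
  shows "\<exists>(c :: nat \<Rightarrow> nat \<Rightarrow> 'a) r. sidon_tree c r"
proof -
  define P where "P n p \<longleftrightarrow> (case p of (c :: nat \<Rightarrow> 'a, r) \<Rightarrow> 0 < r \<and> r \<le> 1 / real (Suc n) \<and>
    (\<forall>k<2 * 4 ^ n. \<forall>l<2 * 4 ^ n. k \<noteq> l \<longrightarrow> (\<forall>u\<in>cball (c k) r. \<forall>v\<in>cball (c l) r. u - v \<notin> cball 0 r)) \<and>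
    (\<forall>i<2 * 4 ^ n. \<forall>j<2 * 4 ^ n. \<forall>k<2 * 4 ^ n. \<forall>l<2 * 4 ^ n. distinct [i, j, k, l] \<longrightarrow>
      (\<forall>a\<in>cball (c i) r. \<forall>b\<in>cball (c j) r. \<forall>u\<in>cball (c k) r. \<forall>v\<in>cball (c l) r. a + b \<noteq> u + v)))" for n p
  define Q where "Q n p q \<longleftrightarrow> (\<forall>k<2 * 4 ^ Suc n. cball (fst q k) (snd q) \<subseteq> cball (fst p (k div 4)) (snd p))"
    for n :: nat and p q :: "(nat \<Rightarrow> 'a) \<times> real"
  have "\<exists>p. P 0 p"
  proof -
    obtain c :: "nat \<Rightarrow> 'a" and r where cr: "0 < r" "r \<le> 1 / real (Suc 0)"
      "\<forall>k<2 * 4 ^ 0. \<forall>l<2 * 4 ^ 0. k \<noteq> l \<longrightarrow> (\<forall>u\<in>cball (c k) r. \<forall>v\<in>cball (c l) r. u - v \<notin> cball 0 r)"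
      "\<forall>i<2 * 4 ^ 0. \<forall>j<2 * 4 ^ 0. \<forall>k<2 * 4 ^ 0. \<forall>l<2 * 4 ^ 0. distinct [i, j, k, l] \<longrightarrow>
      (\<forall>a\<in>cball (c i) r. \<forall>b\<in>cball (c j) r. \<forall>u\<in>cball (c k) r. \<forall>v\<in>cball (c l) r. a + b \<noteq> u + v)"
      using exists_next_level[where N = "2 * 4 ^ 0" and U = "\<lambda>_. UNIV" and \<epsilon> = "1 / real (Suc 0)", OF iso] by auto
    have "P 0 (c, r)" unfolding P_def prod.case using cr by blast
    then show ?thesis by blast
  qed
  moreover have "\<exists>q. P (Suc n) q \<and> Q n p q" if p: "P n p" for p n
  proof -
    obtain c r where cr: "p = (c, r)" by (cases p)
    have r: "r > 0" using p unfolding P_def cr by simp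
    have U: "open (ball (c (k div 4)) r) \<and> ball (c (k div 4)) r \<noteq> {}" for k :: nat using r by simp
    obtain c' r' where c': "0 < r'" "r' \<le> 1 / real (Suc (Suc n))" "\<forall>k<2 * 4 ^ Suc n. cball (c' k) r' \<subseteq> ball (c (k div 4)) r"
      "\<forall>k<2 * 4 ^ Suc n. \<forall>l<2 * 4 ^ Suc n. k \<noteq> l \<longrightarrow> (\<forall>u\<in>cball (c' k) r'. \<forall>v\<in>cball (c' l) r'. u - v \<notin> cball 0 r')"
      "\<forall>i<2 * 4 ^ Suc n. \<forall>j<2 * 4 ^ Suc n. \<forall>k<2 * 4 ^ Suc n. \<forall>l<2 * 4 ^ Suc n. distinct [i, j, k, l] \<longrightarrow>
      (\<forall>a\<in>cball (c' i) r'. \<forall>b\<in>cball (c' j) r'. \<forall>u\<in>cball (c' k) r'. \<forall>v\<in>cball (c' l) r'. a + b \<noteq> u + v)"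
      using exists_next_level[where N = "2 * 4 ^ Suc n" and U = "\<lambda>k. ball (c (k div 4)) r" and \<epsilon> = "1 / real (Suc (Suc n))", OF iso U]
      by auto
    have "P (Suc n) (c', r')" unfolding P_def prod.case using c' by blast
    moreover have "Q n p (c', r')" unfolding Q_def cr using c'(3) ball_subset_cball by fastforce
    ultimately show ?thesis by blast
  qed
  ultimately obtain f where f: "\<And>n. P n (f n)" "\<And>n. Q n (f n) (f (Suc n))"
    using dependent_nat_choice[of P Q] by blast
  have "sidon_tree (\<lambda>n. fst (f n)) (\<lambda>n. snd (f n))"
  proof
    fix n
    note F = f(1)[of n, unfolded P_def case_prod_beta]
    show "0 < snd (f n)" "snd (f n) \<le> 1 / real (Suc n)" using F by blast+
    show "cball (fst (f (Suc n)) k) (snd (f (Suc n))) \<subseteq> cball (fst (f n) (k div 4)) (snd (f n))" if "k < 2 * 4 ^ Suc n" for k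
      using f(2)[of n] that unfolding Q_def by blast
    show "u - v \<notin> cball 0 (snd (f n))" if "k < 2 * 4 ^ n" "l < 2 * 4 ^ n" "k \<noteq> l"
      "u \<in> cball (fst (f n) k) (snd (f n))" "v \<in> cball (fst (f n) l) (snd (f n))" for k l u v
      using F[THEN conjunct2, THEN conjunct2, THEN conjunct1, rule_format, OF that] .
    show "a + b \<noteq> u + v" if "i < 2 * 4 ^ n" "j < 2 * 4 ^ n" "k < 2 * 4 ^ n" "l < 2 * 4 ^ n" "distinct [i, j, k, l]"
      "a \<in> cball (fst (f n) i) (snd (f n))" "b \<in> cball (fst (f n) j) (snd (f n))"
      "u \<in> cball (fst (f n) k) (snd (f n))" "v \<in> cball (fst (f n) l) (snd (f n))" for i j k l a b u v
      using F[THEN conjunct2, THEN conjunct2, THEN conjunct2, rule_format, OF that] .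
  qed
  then show ?thesis by blast
qed

context sidon_tree
begin

abbreviation piece :: "nat \<Rightarrow> nat \<Rightarrow> 'a set" where
  "piece n k \<equiv> cball (c n k) (r n)"

text \<open>
  The limit points above the roots \<open>0\<close> and \<open>1\<close>, respectively.
\<close>

definition left_half :: "'a set" where
  "left_half = (\<Inter>n. \<Union>k<4 ^ n. piece n k)"

definition right_half :: "'a set" where
  "right_half = (\<Inter>n. \<Union>k\<in>{4 ^ n..<2 * 4 ^ n}. piece n k)"

lemma piece_unique:
  assumes "x \<in> piece n k" "x \<in> piece n l" "k < 2 * 4 ^ n" "l < 2 * 4 ^ n"
  shows "k = l"
proof (rule ccontr)
  assume "k \<noteq> l"
  then have "x - x \<notin> cball 0 (r n)" using separated assms by blast
  then show False using r_pos[of n] by simp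
qed

lemma mem_piece:
  assumes "x \<in> left_half \<union> right_half"
  shows "\<exists>k<2 * 4 ^ n. x \<in> piece n k"
proof -
  from assms consider "x \<in> (\<Union>k<4 ^ n. piece n k)" | "x \<in> (\<Union>k\<in>{4 ^ n..<2 * 4 ^ n}. piece n k)"
    unfolding left_half_def right_half_def by blast
  then show ?thesis
  proof cases
    case 1
    then obtain k where "k < 4 ^ n" "x \<in> piece n k" by blast
    then show ?thesis by (intro exI[of _ k]) auto
  next
    case 2
    then obtain k where "k \<in> {4 ^ n..<2 * 4 ^ n}" "x \<in> piece n k" by blast
    then show ?thesis by (intro exI[of _ k]) auto
  qed
qed

lemma left_right_disjoint: "left_half \<inter> right_half = {}"
proof (rule ccontr)
  assume "left_half \<inter> right_half \<noteq> {}"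
  then obtain x where x: "x \<in> left_half" "x \<in> right_half" by blast
  have "x \<in> (\<Union>k<4 ^ 0. piece 0 k)" using x(1) unfolding left_half_def by blast
  moreover have "x \<in> (\<Union>k\<in>{4 ^ 0..<2 * 4 ^ 0}. piece 0 k)" using x(2) unfolding right_half_def by blast
  ultimately obtain k l where kl: "k < 4 ^ 0" "x \<in> piece 0 k" "l \<in> {4 ^ 0..<2 * 4 ^ 0}" "x \<in> piece 0 l" by blast
  then have "k = l" using piece_unique[OF kl(2,4)] by auto
  then show False using kl by auto
qed

lemma closed_left_half: "closed left_half" and closed_right_half: "closed right_half"
  unfolding left_half_def right_half_def by (intro closed_INT closed_UN ballI; simp)+

lemma small_radius:
  assumes "\<epsilon> > 0"
  shows "\<exists>n. 2 * r n < \<epsilon>"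
proof -
  obtain n where n: "inverse (real (Suc n)) < \<epsilon> / 2" using reals_Archimedean[of "\<epsilon> / 2"] assms by auto
  have "r n \<le> inverse (real (Suc n))" using r_le[of n] by (simp add: divide_inverse)
  then have "2 * r n < \<epsilon>" using n by linarith
  then show ?thesis by blast
qed

lemma dist_le_in_piece: "x \<in> piece n k \<Longrightarrow> y \<in> piece n k \<Longrightarrow> dist x y \<le> 2 * r n"
  using dist_triangle3[of x y "c n k"] by simp

text \<open>
  On a level whose balls are smaller than the distances between four distinct points, these lie in four distinct balls.
\<close>

lemma sums_distinct:
  assumes x: "{a, b, u, v} \<subseteq> left_half \<union> right_half" and d: "distinct [a, b, u, v]"
  shows "a + b \<noteq> u + v"
proof -
  define \<delta> where "\<delta> = Min {dist a b, dist a u, dist a v, dist b u, dist b v, dist u v}"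
  have "\<delta> > 0" unfolding \<delta>_def using d by (subst Min_gr_iff) auto
  then obtain n where n: "2 * r n < \<delta>" using small_radius by blast
  have \<delta>: "\<delta> \<le> dist a b" "\<delta> \<le> dist a u" "\<delta> \<le> dist a v" "\<delta> \<le> dist b u" "\<delta> \<le> dist b v" "\<delta> \<le> dist u v"
    unfolding \<delta>_def by (auto intro!: Min_le)
  obtain i j k l where k: "i < 2 * 4 ^ n" "j < 2 * 4 ^ n" "k < 2 * 4 ^ n" "l < 2 * 4 ^ n"
    and p: "a \<in> piece n i" "b \<in> piece n j" "u \<in> piece n k" "v \<in> piece n l"
    using x mem_piece[of a n] mem_piece[of b n] mem_piece[of u n] mem_piece[of v n] by blast
  have far: "m \<noteq> m'" if "y \<in> piece n m" "z \<in> piece n m'" "\<delta> \<le> dist y z" for y z m m'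
    using dist_le_in_piece[of y n m z] that n by auto
  have "distinct [i, j, k, l]" using far[OF p(1,2)] far[OF p(1,3)] far[OF p(1,4)] far[OF p(2,3)] far[OF p(2,4)] far[OF p(3,4)] \<delta> by auto
  then show ?thesis using sums k p by blast
qed

text \<open>
  Such a \<open>z\<close> corresponds to \<open>p = a - z\<close> with \<open>p\<close> and \<open>p + d\<close> in the left half, where \<open>d = b - a\<close>.
  Two solutions \<open>p\<close>, \<open>q\<close> give \<open>p + (q + d) = q + (p + d)\<close>, which is excluded if the four points are distinct;
  so \<open>q\<close> is \<open>p\<close>, \<open>p + d\<close> or \<open>p - d\<close>.
\<close>

lemma finite_translates_through_two_points:
  assumes "a \<noteq> b"
  shows "finite {z. a \<in> (+) z ` left_half \<and> b \<in> (+) z ` left_half}"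
proof -
  define d where "d = b - a"
  have d: "d \<noteq> 0" using assms unfolding d_def by simp
  define D where "D = {p \<in> left_half. p + d \<in> left_half}"
  have "finite D"
  proof (cases "D = {}")
    case False
    then obtain p where p: "p \<in> D" by blast
    have "D \<subseteq> {p, p + d, p - d}"
    proof
      fix q assume q: "q \<in> D"
      show "q \<in> {p, p + d, p - d}"
      proof (rule ccontr)
        assume "q \<notin> {p, p + d, p - d}"
        then have "distinct [p, q + d, q, p + d]" using d by (auto simp: algebra_simps)
        moreover have "{p, q + d, q, p + d} \<subseteq> left_half \<union> right_half" using p q unfolding D_def by auto
        ultimately have "p + (q + d) \<noteq> q + (p + d)" by (intro sums_distinct) auto
        then show False by (simp add: algebra_simps)
      qed
    qed
    then show ?thesis by (rule finite_subset) simp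
  qed simp
  moreover have "{z. a \<in> (+) z ` left_half \<and> b \<in> (+) z ` left_half} \<subseteq> (\<lambda>p. a - p) ` D"
  proof
    fix z assume "z \<in> {z. a \<in> (+) z ` left_half \<and> b \<in> (+) z ` left_half}"
    then obtain p q where "a = z + p" "p \<in> left_half" "b = z + q" "q \<in> left_half" by blast
    then have "z = a - p" "p \<in> D" unfolding D_def d_def by (auto simp: algebra_simps)
    then show "z \<in> (\<lambda>p. a - p) ` D" by blast
  qed
  ultimately show ?thesis by (meson finite_imageI finite_subset)
qed

lemma right_meets_translate_once:
  assumes "p \<in> right_half" "q \<in> right_half" "p \<in> (+) z ` left_half" "q \<in> (+) z ` left_half"
  shows "p = q"
proof (rule ccontr)
  assume "p \<noteq> q"
  obtain u v where u: "p = z + u" "u \<in> left_half" and v: "q = z + v" "v \<in> left_half" using assms by blast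
  have "u \<noteq> v" using \<open>p \<noteq> q\<close> u v by auto
  then have "distinct [p, v, q, u]" using assms u(2) v(2) \<open>p \<noteq> q\<close> left_right_disjoint by auto
  then have "p + v \<noteq> q + u" using assms u(2) v(2) by (intro sums_distinct) auto
  then show False unfolding u(1) v(1) by (simp add: algebra_simps)
qed

text \<open>
  An open set contains a parallelogram \<open>a, a + e, a + f, a + e + f\<close>, whose diagonals have equal sums.
\<close>

lemma interior_right_half_empty:
  assumes iso: "\<And>x::'a. \<not> open {x}"
  shows "interior right_half = {}"
proof (rule ccontr)
  assume "interior right_half \<noteq> {}"
  then obtain a where a: "a \<in> interior right_half" by blast
  have "a + 0 \<in> interior right_half" using a by simp
  obtain s where s: "s > 0" "\<forall>u\<in>cball a s. \<forall>v\<in>cball 0 s. u + v \<in> interior right_half"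
    using add_near[OF open_interior \<open>a + 0 \<in> interior right_half\<close>] by blast
  have "\<exists>t>0. \<forall>u\<in>cball 0 t. \<forall>v\<in>cball 0 t. u + v \<in> ball (0::'a) s"
    by (rule add_near) (use s in auto)
  then obtain t where t: "t > 0" "\<forall>u\<in>cball 0 t. \<forall>v\<in>cball 0 t. u + v \<in> ball (0::'a) s" by blast
  have inf: "infinite (ball (0::'a) t)" using infinite_open[OF iso, of "ball 0 t"] t(1) by auto
  then obtain e where e: "e \<in> ball 0 t" "e \<noteq> (0::'a)" by (metis finite.emptyI finite_insert finite_subset insertI1 singletonI subsetI)
  obtain f where f: "f \<in> ball 0 t" "f \<notin> {0, e, - e}"
    using inf by (meson finite.emptyI finite_insert finite_subset subsetI)
  have "e + 0 \<in> ball 0 s" "f + 0 \<in> ball 0 s" "e + f \<in> ball 0 s" using t e f by fastforce+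
  then have "a + 0 \<in> right_half" "a + e \<in> right_half" "a + f \<in> right_half" "a + (e + f) \<in> right_half"
    using s interior_subset[of right_half] by fastforce+
  moreover have "e + f \<noteq> 0" using minus_unique[of e f] f(2) by auto
  then have "distinct [a + 0, a + (e + f), a + e, a + f]"
    using e(2) f(2) by auto
  ultimately have "(a + 0) + (a + (e + f)) \<noteq> (a + e) + (a + f)" by (intro sums_distinct) auto
  then show False by (simp add: algebra_simps)
qed

lemma branch_limit:
  assumes k: "\<And>n. k n < 2 * 4 ^ n" "\<And>n. k (Suc n) div 4 = k n"
  shows "\<exists>a. (\<forall>n. a \<in> piece n (k n)) \<and> (\<lambda>n. c n (k n)) \<longlonglongrightarrow> a"
proof -
  have "decseq (\<lambda>n. piece n (k n))" by (rule decseq_SucI) (use nested k in metis)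
  then obtain a where a: "\<And>n. a \<in> piece n (k n)"
  proof (rule_tac decreasing_closed_nest[of "\<lambda>n. piece n (k n)"])
    show "piece n (k n) \<noteq> {}" for n using r_pos[of n] by (metis centre_in_cball empty_iff less_imp_le)
    show "\<exists>n. \<forall>x\<in>piece n (k n). \<forall>y\<in>piece n (k n). dist x y < \<epsilon>" if "\<epsilon> > 0" for \<epsilon>
      using small_radius[OF that] dist_le_in_piece by (meson le_less_trans)
  qed (auto simp: decseq_def)
  have "(\<lambda>n. dist (c n (k n)) a) \<longlonglongrightarrow> 0"
  proof (rule tendsto_sandwich)
    show "\<forall>\<^sub>F n in sequentially. 0 \<le> dist (c n (k n)) a" by simp
    show "\<forall>\<^sub>F n in sequentially. dist (c n (k n)) a \<le> inverse (real (Suc n))"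
      using a r_le by (intro always_eventually allI) (metis divide_inverse mem_cball mult_1 order_trans)
  qed (use LIMSEQ_inverse_real_of_nat in auto)
  then have "(\<lambda>n. c n (k n)) \<longlonglongrightarrow> a" by (rule tendsto_dist_iff[THEN iffD2])
  then show ?thesis using a by blast
qed

text \<open>
  Numbering the balls by integers makes the first digits of a real number to base four an index into the tree. So every real
  number has a branch above the root \<open>0\<close>, and Lebesgue measure on the unit interval is carried over to the limit points.
\<close>

definition base4_prefix :: "real \<Rightarrow> nat \<Rightarrow> nat" where
  "base4_prefix x n = nat \<lfloor>4 ^ n * frac x\<rfloor>"

definition branch_point :: "real \<Rightarrow> 'a" where
  "branch_point x = lim (\<lambda>n. c n (base4_prefix x n))"

lemma base4_prefix_less: "base4_prefix x n < 4 ^ n"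
proof -
  have "4 ^ n * frac x < 4 ^ n * 1" using frac_lt_1[of x] by (intro mult_strict_left_mono) auto
  then have "\<lfloor>4 ^ n * frac x\<rfloor> < 4 ^ n" by (simp add: floor_less_iff)
  then show ?thesis unfolding base4_prefix_def by (simp add: nat_less_iff)
qed

lemma base4_prefix_Suc: "base4_prefix x (Suc n) div 4 = base4_prefix x n"
proof -
  have "\<lfloor>4 ^ Suc n * frac x\<rfloor> div 4 = \<lfloor>4 ^ n * frac x\<rfloor>"
    using floor_divide_real_eq_div[of 4 "4 ^ Suc n * frac x"] by simp
  then show ?thesis unfolding base4_prefix_def by (metis nat_div_distrib' nat_numeral zero_le_numeral nat_div_distrib frac_ge_0 mult_nonneg_nonneg zero_le_floor zero_le_power)
qed

lemma branch_point_properties: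
  shows branch_point_in_piece: "branch_point x \<in> piece n (base4_prefix x n)" and branch_point_limit: "(\<lambda>n. c n (base4_prefix x n)) \<longlonglongrightarrow> branch_point x"
proof -
  have "base4_prefix x m < 2 * 4 ^ m" for m using base4_prefix_less[of x m] by linarith
  then obtain a where a: "\<forall>n. a \<in> piece n (base4_prefix x n)" "(\<lambda>n. c n (base4_prefix x n)) \<longlonglongrightarrow> a"
    using branch_limit[of "base4_prefix x"] base4_prefix_Suc by blast
  then have "branch_point x = a" unfolding branch_point_def by (rule_tac limI)
  then show "branch_point x \<in> piece n (base4_prefix x n)" "(\<lambda>n. c n (base4_prefix x n)) \<longlonglongrightarrow> branch_point x" using a by auto
qed

lemma branch_point_in_left_half: "branch_point x \<in> left_half"
  unfolding left_half_def using branch_point_in_piece base4_prefix_less by blast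

lemma branch_point_measurable: "branch_point \<in> borel_measurable borel"
proof (rule borel_measurable_LIMSEQ_metric)
  show "(\<lambda>x. c n (base4_prefix x n)) \<in> borel_measurable borel" for n
  proof -
    have "(\<lambda>x. base4_prefix x n) \<in> measurable borel (count_space UNIV)" unfolding base4_prefix_def frac_def by measurable
    then show ?thesis by (rule measurable_compose) simp
  qed
qed (rule branch_point_limit)

lemma branch_point_inj: "inj_on branch_point {0..<1}"
proof (rule inj_onI)
  fix x y :: real assume x: "x \<in> {0..<1}" and y: "y \<in> {0..<1}" and eq: "branch_point x = branch_point y"
  have fr: "frac x = x" "frac y = y" using x y by (auto simp: frac_eq)
  have bound: "\<bar>x - y\<bar> < inverse (4 ^ n)" for n
  proof -
    have "base4_prefix x n = base4_prefix y n"
    proof (rule piece_unique)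
      show "branch_point x \<in> piece n (base4_prefix x n)" by (rule branch_point_in_piece)
      show "branch_point x \<in> piece n (base4_prefix y n)" unfolding eq by (rule branch_point_in_piece)
    qed (use base4_prefix_less[of x n] base4_prefix_less[of y n] in auto)
    then have "\<lfloor>4 ^ n * x\<rfloor> = \<lfloor>4 ^ n * y\<rfloor>" unfolding base4_prefix_def fr using x y by (auto simp: eq_nat_nat_iff)
    then have "\<bar>4 ^ n * x - 4 ^ n * y\<bar> < 1" by linarith
    then have "4 ^ n * \<bar>x - y\<bar> < 1" by (simp add: abs_mult right_diff_distrib[symmetric])
    then show ?thesis by (simp add: field_simps)
  qed
  show "x = y"
  proof (rule ccontr)
    assume "x \<noteq> y"
    then obtain n where "inverse \<bar>x - y\<bar> < 4 ^ n" using real_arch_pow[of 4 "inverse \<bar>x - y\<bar>"] by auto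
    moreover have "0 < \<bar>x - y\<bar>" using \<open>x \<noteq> y\<close> by simp
    ultimately have "inverse (4 ^ n) < \<bar>x - y\<bar>" by (simp add: field_simps)
    then show False using bound[of n] by linarith
  qed
qed

definition left_measure :: "'a measure" where
  "left_measure = distr (uniform_measure lborel {0..<1::real}) borel branch_point"

lemma borel_prob_left_measure: "borel_prob left_measure"
  unfolding borel_prob_def
proof
  interpret prob_space "uniform_measure lborel {0..<1::real}" by (rule prob_space_uniform_measure) auto
  show "prob_space left_measure" unfolding left_measure_def
    by (rule prob_space_distr) (simp add: branch_point_measurable measurable_cong_sets[OF sets_uniform_measure refl])
qed (simp add: left_measure_def)

lemma emeasure_left_measure:
  assumes "A \<in> sets borel"
  shows "emeasure left_measure A = emeasure lborel ({0..<1} \<inter> branch_point -` A)"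
proof -
  have m: "branch_point -` A \<in> sets borel" using measurable_sets[OF branch_point_measurable assms] by simp
  have "emeasure left_measure A = emeasure (uniform_measure lborel {0..<1::real}) (branch_point -` A)"
    unfolding left_measure_def using assms branch_point_measurable
    by (subst emeasure_distr) (simp_all add: measurable_cong_sets[OF sets_uniform_measure refl])
  also have "\<dots> = emeasure lborel ({0..<1} \<inter> branch_point -` A)"
    using m by (simp add: divide_ennreal_def)
  finally show ?thesis .
qed

lemma left_measure_singleton: "emeasure left_measure {y} = 0"
proof -
  have "countable ({0..<1} \<inter> branch_point -` {y})"
  proof (cases "{0..<1} \<inter> branch_point -` {y} = {}")
    case False
    then obtain x where "x \<in> {0..<1}" "branch_point x = y" by blast
    then have "{0..<1} \<inter> branch_point -` {y} \<subseteq> {x}" using branch_point_inj unfolding inj_on_def by auto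
    then show ?thesis by (rule countable_subset) simp
  qed simp
  then show ?thesis by (simp add: emeasure_left_measure emeasure_lborel_countable)
qed

lemma left_measure_outside: "emeasure left_measure (- left_half) = 0"
proof -
  have "{0..<1} \<inter> branch_point -` (- left_half) = {}" using branch_point_in_left_half by auto
  then show ?thesis using closed_left_half by (simp add: emeasure_left_measure)
qed

end

lemma diff_near_zero:
  fixes W :: "'a::{metric_space, topological_ab_group_add} set"
  assumes "open W" "0 \<in> W"
  shows "\<exists>s>0. \<forall>u\<in>ball 0 s. \<forall>v\<in>ball 0 s. u - v \<in> W"
proof -
  have "open ((\<lambda>p::'a \<times> 'a. fst p - snd p) -` W)"
    using assms(1) by (intro continuous_open_vimage) (auto intro!: continuous_intros simp: continuous_on_eq_continuous_at)
  then obtain A B where AB: "open A" "open B" "0 \<in> A" "0 \<in> B" "A \<times> B \<subseteq> (\<lambda>p. fst p - snd p) -` W"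
    by (rule open_prod_elim[of _ "(0, 0)"]) (use assms(2) in auto)
  obtain r s where "r > 0" "ball 0 r \<subseteq> A" "s > 0" "ball 0 s \<subseteq> B"
    using AB by (metis open_contains_ball)
  then have "\<forall>u\<in>ball 0 (min r s). \<forall>v\<in>ball 0 (min r s). u - v \<in> W" using AB(5) by fastforce
  then show ?thesis using \<open>r > 0\<close> \<open>s > 0\<close> by (intro exI[of _ "min r s"]) auto
qed

context sidon_tree
begin

text \<open>
  The complement of \<open>W\<close> is a union of neighbourhoods \<open>U n\<close> of the points of a countable dense set, with \<open>U n\<close>
  so small that each of its translates meets at most one ball of level \<open>Suc n\<close>. For given \<open>g\<close>, this rules out one
  ball on each level, and a branch with two free choices at every node avoids all of them.
\<close>

lemma exists_nowhere_dense_meeting_translates: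
  "\<exists>W. closed W \<and> interior W = {} \<and> (\<forall>g. \<exists>x :: nat set \<Rightarrow> 'a. inj x \<and> (\<forall>\<tau>. x \<tau> \<in> right_half \<and> x \<tau> + g \<in> W))"
proof -
  have "\<exists>s>0. \<forall>u\<in>ball 0 s. \<forall>v\<in>ball 0 s. u - v \<in> ball (0::'a) (r (Suc n))" for n
    by (rule diff_near_zero) (auto simp: r_pos)
  then obtain s where s: "\<And>n. s n > 0"
    "\<And>n u v. u \<in> ball 0 (s n) \<Longrightarrow> v \<in> ball 0 (s n) \<Longrightarrow> u - v \<in> ball (0::'a) (r (Suc n))" by metis
  obtain D :: "'a set" where D: "countable D" "\<And>X. open X \<Longrightarrow> X \<noteq> {} \<Longrightarrow> \<exists>d\<in>D. d \<in> X"
    using countable_dense_setE by blast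
  have Dne: "D \<noteq> {}" using D(2)[of UNIV] by auto
  define d where "d = from_nat_into D"
  have d: "range d = D" unfolding d_def using range_from_nat_into[OF Dne D(1)] .
  define U where "U n = {x. x - d n \<in> ball 0 (s n)}" for n
  have oU: "open (U n)" for n unfolding U_def by (rule open_translate) simp
  have dU: "d n \<in> U n" for n unfolding U_def using s(1)[of n] by simp
  define W where "W = - (\<Union>n. U n)"
  have "closed W" unfolding W_def using oU by auto
  moreover have "interior W = {}"
  proof (rule ccontr)
    assume "interior W \<noteq> {}"
    then obtain n where "d n \<in> interior W" using D(2)[of "interior W"] d by auto
    then show False using dU[of n] interior_subset[of W] unfolding W_def by auto
  qed
  moreover have "\<exists>x :: nat set \<Rightarrow> 'a. inj x \<and> (\<forall>\<tau>. x \<tau> \<in> right_half \<and> x \<tau> + g \<in> W)" for g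
  proof -
    \<comment> \<open>the ball of level \<open>Suc n\<close> to be avoided, if there is one\<close>
    have "\<exists>b. \<forall>x\<in>right_half. x + g \<in> U n \<longrightarrow> (\<forall>k<2 * 4 ^ Suc n. x \<in> piece (Suc n) k \<longrightarrow> k = b)" for n
    proof (cases "\<exists>x\<in>right_half. x + g \<in> U n")
      case True
      then obtain x where x: "x \<in> right_half" "x + g \<in> U n" by blast
      obtain b where b: "b < 2 * 4 ^ Suc n" "x \<in> piece (Suc n) b" using mem_piece[of x "Suc n"] x(1) by blast
      have "k = b" if y: "y + g \<in> U n" "k < 2 * 4 ^ Suc n" "y \<in> piece (Suc n) k" for y k
      proof (rule ccontr)
        assume "k \<noteq> b"
        then have "y - x \<notin> cball 0 (r (Suc n))" using separated[OF y(2) b(1) _ y(3) b(2)] by blast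
        moreover have "(y + g - d n) - (x + g - d n) \<in> ball 0 (r (Suc n))"
          by (rule s(2)) (use x(2) y(1) in \<open>auto simp: U_def\<close>)
        ultimately show False using ball_subset_cball by auto
      qed
      then show ?thesis by blast
    qed blast
    then obtain b where b: "\<And>n x k. \<lbrakk>x \<in> right_half; x + g \<in> U n; k < 2 * 4 ^ Suc n; x \<in> piece (Suc n) k\<rbrakk> \<Longrightarrow> k = b n"
      by metis
    \<comment> \<open>the last digit is 2 or 3 if that of \<open>b n\<close> is 0 or 1, and 0 or 1 otherwise; the set \<open>\<tau>\<close> decides which\<close>
    define k where "k \<tau> = rec_nat (1::nat) (\<lambda>n m. 4 * m + ((if b n mod 4 < 2 then 2 else 0) + of_bool (n \<in> \<tau>)))" for \<tau> :: "nat set"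
    have k0: "k \<tau> 0 = 1" and kS: "k \<tau> (Suc n) = 4 * k \<tau> n + ((if b n mod 4 < 2 then 2 else 0) + of_bool (n \<in> \<tau>))" for \<tau> n
      by (simp_all add: k_def)
    have kb: "4 ^ n \<le> k \<tau> n \<and> k \<tau> n < 2 * 4 ^ n" for \<tau> n
    proof (induction n)
      case (Suc n)
      have "(if b n mod 4 < 2 then 2 else 0) + of_bool (n \<in> \<tau>) < (4::nat)" by simp
      then show ?case using Suc unfolding kS power_Suc by linarith
    qed (simp add: k0)
    have kd: "k \<tau> (Suc n) div 4 = k \<tau> n" for \<tau> n unfolding kS by simp
    have kne: "k \<tau> (Suc n) \<noteq> b n" for \<tau> n
    proof
      assume "k \<tau> (Suc n) = b n"
      moreover have "k \<tau> (Suc n) mod 4 = (if b n mod 4 < 2 then 2 else 0) + of_bool (n \<in> \<tau>)"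
        unfolding kS by simp
      ultimately show False by (cases "n \<in> \<tau>") (simp_all split: if_splits)
    qed
    have "\<exists>a. \<forall>n. a \<in> piece n (k \<tau> n)" for \<tau> using branch_limit[of "k \<tau>"] kb kd by blast
    then obtain x where x: "\<And>\<tau> n. x \<tau> \<in> piece n (k \<tau> n)" by metis
    have xr: "x \<tau> \<in> right_half" for \<tau> unfolding right_half_def using x kb by fastforce
    have "x \<tau> + g \<in> W" for \<tau>
    proof (rule ccontr)
      assume "x \<tau> + g \<notin> W"
      then obtain n where "x \<tau> + g \<in> U n" unfolding W_def by blast
      then have "k \<tau> (Suc n) = b n" using b[OF xr _ _ x] kb by blast
      then show False using kne by blast
    qed
    moreover have "inj x"
    proof (rule injI)
      fix \<tau> \<sigma> assume eq: "x \<tau> = x \<sigma>"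
      have keq: "k \<tau> n = k \<sigma> n" for n
        using piece_unique[of "x \<tau>" n "k \<tau> n" "k \<sigma> n"] x[of \<tau> n] x[of \<sigma> n] kb[of n \<tau>] kb[of n \<sigma>] eq by simp
      have "n \<in> \<tau> \<longleftrightarrow> n \<in> \<sigma>" for n
      proof -
        have "of_bool (n \<in> \<tau>) = (of_bool (n \<in> \<sigma>) :: nat)"
          using kS[of \<tau> n] kS[of \<sigma> n] keq[of n] keq[of "Suc n"] by simp
        then show ?thesis by (simp add: of_bool_eq_iff)
      qed
      then show "\<tau> = \<sigma>" by blast
    qed
    ultimately show ?thesis using xr by blast
  qed
  ultimately show ?thesis by blast
qed

end

text \<open>
  The properties of the tree that the construction of a Haar null set uses: \<open>P\<close> and \<open>Q\<close> are the two halves, and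
  \<open>\<mu>\<close> is the measure on \<open>P\<close>.
\<close>

theorem exists_nowhere_dense_with_small_test_set:
  assumes iso: "\<And>x::'a::{polish_space, topological_ab_group_add}. \<not> open {x}"
  obtains P Q W :: "'a::{polish_space, topological_ab_group_add} set" and \<mu> :: "'a::{polish_space, topological_ab_group_add} measure"
  where "nowhere_dense (Q \<union> W)"
    and "\<And>g. \<exists>x :: nat set \<Rightarrow> 'a. inj x \<and> (\<forall>\<tau>. x \<tau> \<in> Q \<and> x \<tau> + g \<in> W)"
    and "\<And>a b. a \<noteq> b \<Longrightarrow> finite {z. a \<in> (+) z ` P \<and> b \<in> (+) z ` P}"
    and "\<And>p q z. \<lbrakk>p \<in> Q; q \<in> Q; p \<in> (+) z ` P; q \<in> (+) z ` P\<rbrakk> \<Longrightarrow> p = q"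
    and "borel_prob \<mu>" "\<And>x. emeasure \<mu> {x} = 0" "closed P" "emeasure \<mu> (- P) = 0"
proof -
  obtain c :: "nat \<Rightarrow> nat \<Rightarrow> 'a" and r where "sidon_tree c r" using exists_sidon_tree[OF iso] by blast
  then interpret sidon_tree c r .
  obtain W where W: "closed W" "interior W = {}"
    "\<And>g. \<exists>x :: nat set \<Rightarrow> 'a. inj x \<and> (\<forall>\<tau>. x \<tau> \<in> right_half \<and> x \<tau> + g \<in> W)"
    using exists_nowhere_dense_meeting_translates by blast
  have "interior (right_half \<union> W) = {}"
    using interior_right_half_empty[OF iso] interior_closed_Un_empty_interior[OF closed_right_half W(2)] by simp
  then have "nowhere_dense (right_half \<union> W)"
    unfolding nowhere_dense_def using closed_right_half W(1) by (simp add: closed_Un)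
  then show thesis
    using that[of right_half W left_half left_measure] W(3) finite_translates_through_two_points right_meets_translate_once
      borel_prob_left_measure left_measure_singleton closed_left_half left_measure_outside by blast
qed

section \<open>Genericity below the covering number of the meager ideal\<close>

text \<open>
  A walk through conditions coded as natural numbers: at time \<open>n\<close> a condition is offered, and the walk moves to it if
  this is an extension of the present one and the bit \<open>\<sigma> n\<close> says so. By the pairing function each condition is
  offered infinitely often.
\<close>

definition cohen_walk :: "(nat \<Rightarrow> nat \<Rightarrow> bool) \<Rightarrow> nat \<Rightarrow> (nat \<Rightarrow> bool) \<Rightarrow> nat \<Rightarrow> nat" where
  "cohen_walk le p \<sigma> = rec_nat p (\<lambda>n q. let e = fst (prod_decode n) in if \<sigma> n \<and> le e q then e else q)"

lemma cohen_walk_simps: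
  "cohen_walk le p \<sigma> 0 = p"
  "cohen_walk le p \<sigma> (Suc n) =
    (if \<sigma> n \<and> le (fst (prod_decode n)) (cohen_walk le p \<sigma> n) then fst (prod_decode n) else cohen_walk le p \<sigma> n)"
  by (simp_all add: cohen_walk_def Let_def)

lemma cohen_walk_cong: "(\<And>i. i < n \<Longrightarrow> \<sigma> i = \<tau> i) \<Longrightarrow> cohen_walk le p \<sigma> n = cohen_walk le p \<tau> n"
  by (induction n) (auto simp: cohen_walk_simps)

lemma cohen_walk_wait:
  "n \<le> m \<Longrightarrow> (\<And>i. n \<le> i \<Longrightarrow> i < m \<Longrightarrow> \<not> \<sigma> i) \<Longrightarrow> cohen_walk le p \<sigma> m = cohen_walk le p \<sigma> n"
proof (induction m rule: dec_induct)
  case (step m)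
  then show ?case by (simp add: cohen_walk_simps)
qed simp

definition binary_digit :: "real \<Rightarrow> nat \<Rightarrow> bool" where
  "binary_digit x n = odd \<lfloor>2 ^ n * x\<rfloor>"

lemma floor_in_dyadic:
  fixes x :: real
  assumes x: "of_int k \<le> 2 ^ m * x" "2 ^ m * x < of_int k + 1" and i: "i \<le> m"
  shows "\<lfloor>2 ^ i * x\<rfloor> = k div 2 ^ (m - i)"
proof -
  have "\<lfloor>2 ^ m * x\<rfloor> = k" using x by (simp add: floor_unique)
  moreover have "2 ^ m * x = 2 ^ (m - i) * (2 ^ i * x)" using i by (simp add: power_add[symmetric])
  ultimately have "\<lfloor>2 ^ (m - i) * (2 ^ i * x)\<rfloor> = k" by simp
  moreover have "\<lfloor>2 ^ i * x\<rfloor> = \<lfloor>2 ^ (m - i) * (2 ^ i * x)\<rfloor> div 2 ^ (m - i)"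
    using floor_divide_real_eq_div[of "2 ^ (m - i)" "2 ^ (m - i) * (2 ^ i * x)"] by simp
  ultimately show ?thesis by simp
qed

lemma int_div_times_plus_1: "1 < D \<Longrightarrow> (D * k + 1) div D = k" for D k :: int
  by simp

text \<open>
  Given an interval, fix finitely many binary digits so that all points with these digits lie in it. The walk then stands at
  some \<open>q0\<close>. Waiting with digits \<open>0\<close> until an extension of \<open>q0\<close> in \<open>E\<close> is offered, and accepting it with a
  digit \<open>1\<close>, describes a smaller interval on which all walks reach \<open>E\<close>.
\<close>

lemma nowhere_dense_walks_missing_dense_set:
  assumes dense: "\<And>p. \<exists>q\<in>E. le q p"
  shows "nowhere_dense {x::real. \<forall>n. cohen_walk le p (binary_digit x) n \<notin> E}" (is "nowhere_dense ?M")
  unfolding nowhere_dense_def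
proof (rule ccontr)
  assume "interior (closure ?M) \<noteq> {}"
  then obtain z where z: "z \<in> interior (closure ?M)" by blast
  obtain \<epsilon> where \<epsilon>: "\<epsilon> > 0" "ball z \<epsilon> \<subseteq> closure ?M"
    using z by (meson interior_subset open_contains_ball open_interior order_trans)
  obtain N where N: "inverse (2 ^ N) < \<epsilon> / 2"
    using \<epsilon>(1) real_arch_pow_inv[of "\<epsilon> / 2" "1/2"] by (auto simp: power_one_over inverse_eq_divide)
  define k where "k = \<lfloor>2 ^ N * z\<rfloor>"
  define \<sigma> where "\<sigma> i = odd (k div 2 ^ (N - i))" for i
  define q0 where "q0 = cohen_walk le p \<sigma> (Suc N)"
  obtain q where q: "q \<in> E" "le q q0" using dense by blast
  define m where "m = prod_encode (q, Suc N)"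
  have m: "Suc N \<le> m" "fst (prod_decode m) = q" unfolding m_def using le_prod_encode_2[of "Suc N" q] by auto
  \<comment> \<open>the digits of \<open>k\<close> up to \<open>N\<close>, then zeros, then a one at position \<open>m\<close>\<close>
  define k' where "k' = 2 ^ (m - N) * k + 1"
  define J where "J = {x. of_int k' < 2 ^ m * x \<and> 2 ^ m * x < of_int k' + (1::real)}"
  have oJ: "open J" unfolding J_def by (intro open_Collect_conj open_Collect_less continuous_intros)
  have "(of_int k' + 1/2) / 2 ^ m \<in> J" unfolding J_def by simp
  then have Jne: "J \<noteq> {}" by blast
  have JM: "x \<notin> ?M" if x: "x \<in> J" for x
  proof -
    have fl: "\<lfloor>2 ^ i * x\<rfloor> = k' div 2 ^ (m - i)" if "i \<le> m" for i
      using x that unfolding J_def by (intro floor_in_dyadic) auto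
    have low: "binary_digit x i = \<sigma> i" if "i < Suc N" for i
    proof -
      have "m - i = (m - N) + (N - i)" using m(1) that by simp
      then have "k' div 2 ^ (m - i) = (k' div 2 ^ (m - N)) div 2 ^ (N - i)"
        by (simp add: power_add div_mult2_eq zdiv_zmult2_eq)
      also have "k' div 2 ^ (m - N) = k"
      proof -
        have "1 < (2::int) ^ (m - N)" using m(1) by (simp add: one_less_power)
        then show ?thesis unfolding k'_def by (rule int_div_times_plus_1)
      qed
      finally show ?thesis using fl[of i] that m(1) unfolding binary_digit_def \<sigma>_def by simp
    qed
    have mid: "\<not> binary_digit x i" if "Suc N \<le> i" "i < m" for i
    proof -
      have e: "m - N = (m - i) + (i - N)" using that by simp
      have "1 < (2::int) ^ (m - i)" using that by (simp add: one_less_power)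
      then have "k' div 2 ^ (m - i) = 2 ^ (i - N) * k"
        unfolding k'_def e power_add mult.assoc by (rule int_div_times_plus_1)
      moreover have "even (2 ^ (i - N) * k)" using that by simp
      ultimately show ?thesis using fl[of i] that unfolding binary_digit_def by simp
    qed
    have top: "binary_digit x m" using fl[of m] m(1) unfolding binary_digit_def k'_def by simp
    have "cohen_walk le p (binary_digit x) (Suc N) = q0" unfolding q0_def by (rule cohen_walk_cong) (use low in auto)
    then have "cohen_walk le p (binary_digit x) m = q0" using cohen_walk_wait[OF m(1), of "binary_digit x"] mid by simp
    then have "cohen_walk le p (binary_digit x) (Suc m) = q" using top m(2) q(2) by (simp add: cohen_walk_simps)
    then have "cohen_walk le p (binary_digit x) (Suc m) \<in> E" using q(1) by simp
    then show ?thesis by blast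
  qed
  have Jball: "J \<subseteq> ball z \<epsilon>"
  proof
    fix x assume x: "x \<in> J"
    have "\<lfloor>2 ^ N * x\<rfloor> = k' div 2 ^ (m - N)" using x m(1) unfolding J_def by (intro floor_in_dyadic) auto
    also have "\<dots> = k"
    proof -
      have "1 < (2::int) ^ (m - N)" using m(1) by (simp add: one_less_power)
      then show ?thesis unfolding k'_def by (rule int_div_times_plus_1)
    qed
    finally have "\<bar>2 ^ N * x - 2 ^ N * z\<bar> < 1" unfolding k_def by linarith
    moreover have "2 ^ N * x - 2 ^ N * z = 2 ^ N * (x - z)" by (simp only: right_diff_distrib)
    ultimately have "2 ^ N * \<bar>x - z\<bar> < 1" by (simp only: abs_mult) simp
    then have "\<bar>x - z\<bar> < inverse (2 ^ N)" by (simp add: field_simps)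
    then show "x \<in> ball z \<epsilon>" using N \<epsilon>(1) by (simp add: dist_real_def abs_minus_commute)
  qed
  have "J \<inter> closure ?M = {}" using JM open_Int_closure_eq_empty[OF oJ, of ?M] by blast
  moreover have "J \<subseteq> closure ?M" using Jball \<epsilon>(2) by blast
  ultimately show False using Jne by blast
qed

lemma nowhere_dense_imp_meager: "nowhere_dense M \<Longrightarrow> meager M"
  unfolding meager_def by (rule exI[of _ "\<lambda>_. M"]) simp

text \<open>
  Fewer than \<open>cov_meager\<close> sets that are dense for the extension relation \<open>le\<close> are all met by one walk, because
  the real numbers whose walk misses one of them do not cover the line.
\<close>

theorem generic_chain:
  fixes le :: "nat \<Rightarrow> nat \<Rightarrow> bool" and E :: "'i \<Rightarrow> nat set"
  assumes I: "|I| <o cov_meager"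
    and dense: "\<And>i p. i \<in> I \<Longrightarrow> \<exists>q\<in>E i. le q p"
  shows "\<exists>q. q 0 = p \<and> (\<forall>n. q (Suc n) = q n \<or> le (q (Suc n)) (q n)) \<and> (\<forall>i\<in>I. \<exists>n. q n \<in> E i)"
proof -
  define M where "M i = {x::real. \<forall>n. cohen_walk le p (binary_digit x) n \<notin> E i}" for i
  have "meager (M i)" if "i \<in> I" for i
    unfolding M_def by (rule nowhere_dense_imp_meager[OF nowhere_dense_walks_missing_dense_set[OF dense[OF that]]])
  then have mgr: "\<forall>A\<in>M ` I. meager A" by blast
  have "|M ` I| <o cov_meager" by (rule ordLeq_ordLess_trans[OF card_of_image I])
  then have "\<not> cov_meager \<le>o |M ` I|" by (rule not_ordLess_ordLeq)
  then have "\<Union>(M ` I) \<noteq> UNIV" using cov_meager_le[OF mgr] by blast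
  then obtain x where x: "\<And>i. i \<in> I \<Longrightarrow> x \<notin> M i" by blast
  show ?thesis
  proof (intro exI[of _ "cohen_walk le p (binary_digit x)"] conjI allI ballI)
    show "\<exists>n. cohen_walk le p (binary_digit x) n \<in> E i" if "i \<in> I" for i using x[OF that] unfolding M_def by blast
  qed (auto simp: cohen_walk_simps)
qed

lemma nat_ordLess_uncountable:
  assumes "uncountable A"
  shows "|UNIV :: nat set| <o |A|"
proof -
  have "\<not> |A| \<le>o |UNIV :: nat set|"
  proof
    assume "|A| \<le>o |UNIV :: nat set|"
    then obtain f :: "'a \<Rightarrow> nat" where "inj_on f A" using card_of_ordLeq[of A "UNIV :: nat set"] by blast
    then show False using assms countableI by blast
  qed
  then show ?thesis by (simp add: not_ordLeq_iff_ordLess card_of_Well_order)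
qed

lemma exists_basis_enumeration:
  "\<exists>U :: nat \<Rightarrow> 'a::second_countable_topology set. topological_basis (range U)"
proof -
  obtain B :: "'a set set" where B: "countable B" "topological_basis B" using ex_countable_basis by blast
  have "B \<noteq> {}"
  proof
    assume "B = {}"
    then have "\<exists>B'\<subseteq>{}. \<Union>B' = (UNIV :: 'a set)" using B(2) unfolding topological_basis_def by (metis open_UNIV)
    then show False by auto
  qed
  then have "range (from_nat_into B) = B" using B(1) by (rule range_from_nat_into)
  then show ?thesis using B(2) by metis
qed

lemma basis_element:
  assumes U: "topological_basis (range U)" and V: "open V" "x \<in> V"
  shows "\<exists>j. x \<in> U j \<and> U j \<subseteq> V"
proof -
  obtain B where "B \<in> range U" "x \<in> B" "B \<subseteq> V" by (rule topological_basisE[OF U V])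
  then show ?thesis by blast
qed

lemma basis_closure:
  fixes U :: "nat \<Rightarrow> 'a::metric_space set"
  assumes U: "topological_basis (range U)" and O: "open V" "x \<in> V"
  shows "\<exists>j. x \<in> U j \<and> closure (U j) \<subseteq> V"
proof -
  obtain e where e: "e > 0" "cball x e \<subseteq> V" using O open_contains_cball by blast
  obtain j where j: "x \<in> U j" "U j \<subseteq> ball x e"
    using basis_element[OF U open_ball, of x x e] e(1) by auto
  have "closure (U j) \<subseteq> cball x e" using j(2) by (intro closure_minimal) auto
  then show ?thesis using j(1) e(2) by blast
qed

text \<open>
  This transfers the covering number from the real line to an arbitrary Polish space. Conditions are basic open sets, extended
  by basic sets with closure inside; a generic chain has vanishing diameters, and its limit avoids every \<open>M i\<close>.
  Every code counts as an extension of a code of the empty set, so that density holds at all codes.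
\<close>

theorem exists_point_avoiding_nowhere_dense:
  fixes M :: "'i \<Rightarrow> 'a::polish_space set"
  assumes cov: "cov_meager =o |UNIV :: real set|" and I: "|I| <o |UNIV :: real set|"
    and nd: "\<And>i. i \<in> I \<Longrightarrow> nowhere_dense (M i)"
  shows "\<exists>x. \<forall>i\<in>I. x \<notin> M i"
proof -
  obtain U :: "nat \<Rightarrow> 'a set" where U: "topological_basis (range U)" using exists_basis_enumeration by blast
  have oU: "open (U j)" for j using topological_basis_open[OF U] by blast
  define le where "le q p \<longleftrightarrow> (U p \<noteq> {} \<longrightarrow> U q \<noteq> {} \<and> closure (U q) \<subseteq> U p)" for q p
  define E where "E = case_sum (\<lambda>i. {q. closure (U q) \<inter> M i = {}})
    (\<lambda>n. {q. \<forall>x\<in>closure (U q). \<forall>y\<in>closure (U q). dist x y < 1 / real (Suc n)})"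
  have "|UNIV :: nat set| <o |UNIV :: real set|"
    by (rule nat_ordLess_uncountable[OF uncountable_UNIV_real])
  then have "|I <+> (UNIV :: nat set)| <o |UNIV :: real set|"
    using I by (intro card_of_Plus_ordLess_infinite infinite_UNIV_char_0)
  then have J: "|I <+> (UNIV :: nat set)| <o cov_meager" using cov ordLess_ordIso_trans ordIso_symmetric by blast
  have dense: "\<exists>q\<in>E i. le q p" if i: "i \<in> I <+> (UNIV :: nat set)" for i p
  proof (cases "U p = {}")
    case True
    then have "p \<in> E i" unfolding E_def by (cases i) auto
    then show ?thesis using True unfolding le_def by blast
  next
    case False
    from i show ?thesis
    proof (elim PlusE)
      fix j assume j: "j \<in> I" "i = Inl j"
      have "\<not> U p \<subseteq> closure (M j)"
      proof
        assume "U p \<subseteq> closure (M j)"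
        then have "U p \<subseteq> interior (closure (M j))" using oU by (simp add: interior_maximal)
        then show False using nd[OF j(1)] False unfolding nowhere_dense_def by simp
      qed
      then obtain x where "x \<in> U p - closure (M j)" by blast
      then obtain q where q: "x \<in> U q" "closure (U q) \<subseteq> U p - closure (M j)"
        using basis_closure[OF U, of "U p - closure (M j)" x] oU by blast
      then have "q \<in> E i" unfolding E_def j(2) using closure_subset[of "M j"] by auto
      then show ?thesis using q unfolding le_def by blast
    next
      fix n assume n: "i = Inr n"
      define \<delta> where "\<delta> = 1 / (2 * real (Suc n))"
      have \<delta>: "\<delta> > 0" unfolding \<delta>_def by simp
      obtain x where x: "x \<in> U p" using False by blast
      then obtain q where q: "x \<in> U q" "closure (U q) \<subseteq> U p \<inter> ball x \<delta>"
        using basis_closure[OF U, of "U p \<inter> ball x \<delta>" x] oU \<delta> by auto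
      have "dist y z < 1 / real (Suc n)" if "y \<in> closure (U q)" "z \<in> closure (U q)" for y z
      proof -
        have "dist x y < \<delta>" "dist x z < \<delta>" using q(2) that by auto
        then have "dist y z < \<delta> + \<delta>" using dist_triangle3[of y z x] by linarith
        then show ?thesis unfolding \<delta>_def by (simp add: field_simps)
      qed
      then have "q \<in> E i" unfolding E_def n by auto
      then show ?thesis using q unfolding le_def by blast
    qed
  qed
  obtain p where p: "U p \<noteq> {}" using basis_closure[OF U open_UNIV, of undefined] by blast
  obtain q where q: "q 0 = p" "\<And>n. q (Suc n) = q n \<or> le (q (Suc n)) (q n)" "\<And>i. i \<in> I <+> UNIV \<Longrightarrow> \<exists>n. q n \<in> E i"
    using generic_chain[where p = p and E = E and le = le, OF J dense] by blast
  have ne: "U (q n) \<noteq> {}" for n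
  proof (induction n)
    case (Suc n)
    then show ?case using q(2)[of n] unfolding le_def by metis
  qed (use p q(1) in simp)
  have "closure (U (q (Suc n))) \<subseteq> closure (U (q n))" for n
    using q(2)[of n] ne[of n] closure_subset[of "U (q n)"] unfolding le_def by fastforce
  then have dec: "decseq (\<lambda>n. closure (U (q n)))" by (rule decseq_SucI)
  obtain a where a: "\<And>n. a \<in> closure (U (q n))"
  proof (rule decreasing_closed_nest[of "\<lambda>n. closure (U (q n))"])
    fix \<epsilon> :: real assume "\<epsilon> > 0"
    then obtain m where m: "1 / real (Suc m) < \<epsilon>" using reals_Archimedean[of \<epsilon>] by (auto simp: inverse_eq_divide)
    obtain n where "q n \<in> E (Inr m)" using q(3)[of "Inr m"] by blast
    then show "\<exists>n. \<forall>x\<in>closure (U (q n)). \<forall>y\<in>closure (U (q n)). dist x y < \<epsilon>"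
      unfolding E_def using m by (intro exI[of _ n]) fastforce
  qed (use dec ne in \<open>auto simp: decseq_def\<close>)
  have "a \<notin> M i" if i: "i \<in> I" for i
  proof -
    obtain n where "q n \<in> E (Inl i)" using q(3)[OF InlI[OF i]] by blast
    then show ?thesis using a[of n] unfolding E_def by auto
  qed
  then show ?thesis by blast
qed

lemma small_ball:
  fixes \<mu> :: "'a::metric_space measure"
  assumes \<mu>: "borel_prob \<mu>" "emeasure \<mu> {b} = 0" and \<delta>: "\<delta> > 0"
  shows "\<exists>e>0. measure \<mu> (ball b e) < \<delta>"
proof -
  interpret prob_space \<mu> using \<mu>(1) unfolding borel_prob_def by blast
  have sets: "sets \<mu> = sets borel" using \<mu>(1) unfolding borel_prob_def by blast
  define A where "A n = ball b (1 / real (Suc n))" for n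
  have "(\<lambda>n. measure \<mu> (A n)) \<longlonglongrightarrow> measure \<mu> (\<Inter>n. A n)"
  proof (rule finite_Lim_measure_decseq)
    show "range A \<subseteq> sets \<mu>" unfolding A_def sets by auto
    show "decseq A" unfolding A_def by (rule decseq_SucI) (auto intro!: subset_ball simp: field_simps)
  qed
  moreover have "(\<Inter>n. A n) = {b}"
  proof -
    have "x = b" if "\<forall>n. x \<in> A n" for x
    proof (rule ccontr)
      assume "x \<noteq> b"
      then obtain n where "1 / real (Suc n) < dist b x" using reals_Archimedean[of "dist b x"] by (auto simp: inverse_eq_divide)
      moreover have "dist b x < 1 / real (Suc n)" using that unfolding A_def by auto
      ultimately show False by simp
    qed
    then show ?thesis unfolding A_def by auto
  qed
  ultimately have "(\<lambda>n. measure \<mu> (A n)) \<longlonglongrightarrow> 0" using \<mu>(2) by (simp add: measure_def)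
  then obtain n where "measure \<mu> (A n) < \<delta>"
    using order_tendstoD(2)[OF _ \<delta>] by (metis (no_types, lifting) eventually_sequentially le_refl)
  then show ?thesis unfolding A_def by (intro exI[of _ "1 / real (Suc n)"]) auto
qed

lemma null_if_outer_small:
  fixes \<mu> :: "'a::topological_space measure"
  assumes \<mu>: "borel_prob \<mu>" and V: "\<And>\<epsilon>. \<epsilon> > 0 \<Longrightarrow> \<exists>V. open V \<and> B \<subseteq> V \<and> emeasure \<mu> V \<le> ennreal \<epsilon>"
  shows "B \<in> null_sets (completion \<mu>)"
proof -
  have sets: "sets \<mu> = sets borel" using \<mu>(1) unfolding borel_prob_def by blast
  have "\<exists>V. open V \<and> B \<subseteq> V \<and> emeasure \<mu> V \<le> ennreal (1 / real (Suc n))" for n by (rule V) simp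
  then obtain V where V: "\<And>n. open (V n)" "\<And>n. B \<subseteq> V n" "\<And>n. emeasure \<mu> (V n) \<le> ennreal (1 / real (Suc n))" by metis
  have m: "V n \<in> sets \<mu>" for n using V(1) unfolding sets by auto
  have le: "emeasure \<mu> (\<Inter>n. V n) \<le> ennreal (1 / real (Suc n))" for n
    using emeasure_mono[of "\<Inter>n. V n" "V n" \<mu>] m V(3)[of n] by (meson INT_lower UNIV_I order_trans)
  have "emeasure \<mu> (\<Inter>n. V n) = 0"
  proof -
    have "(\<lambda>n. ennreal (1 / real (Suc n))) \<longlonglongrightarrow> ennreal 0"
      using LIMSEQ_inverse_real_of_nat by (intro tendsto_ennrealI) (simp add: inverse_eq_divide)
    then have "emeasure \<mu> (\<Inter>n. V n) \<le> ennreal 0" by (rule LIMSEQ_le_const) (use le in blast)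
    then show ?thesis by simp
  qed
  then have "(\<Inter>n. V n) \<in> null_sets \<mu>" using m by (intro null_setsI) auto
  then show ?thesis using V(2) by (metis INT_greatest null_sets_completion_subset null_sets_completionI)
qed

text \<open>
  Conditions are finite unions of basic open sets of measure less than \<open>\<epsilon>\<close>, extended by larger ones. As points
  have small neighbourhoods, the conditions that contain a given point are dense. The union along a generic chain covers
  \<open>B\<close> and has measure at most \<open>\<epsilon>\<close>.
\<close>

theorem null_if_card_less_cov_meager:
  fixes \<mu> :: "'a::polish_space measure"
  assumes \<mu>: "borel_prob \<mu>" "\<And>x. emeasure \<mu> {x} = 0" and B: "|B| <o cov_meager"
  shows "B \<in> null_sets (completion \<mu>)"
proof (rule null_if_outer_small[OF \<mu>(1)])
  fix \<epsilon> :: real assume \<epsilon>: "\<epsilon> > 0"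
  interpret prob_space \<mu> using \<mu>(1) unfolding borel_prob_def by blast
  have sets: "sets \<mu> = sets borel" using \<mu>(1) unfolding borel_prob_def by blast
  obtain U :: "nat \<Rightarrow> 'a set" where U: "topological_basis (range U)" using exists_basis_enumeration by blast
  have oU: "open (U j)" for j using topological_basis_open[OF U] by blast
  define V where "V p = (\<Union>j\<in>set_decode p. U j)" for p
  have oV: "open (V p)" for p unfolding V_def using oU by blast
  have mV: "V p \<in> sets \<mu>" for p unfolding sets using oV by simp
  define le where "le q p \<longleftrightarrow> (measure \<mu> (V p) < \<epsilon> \<longrightarrow> measure \<mu> (V q) < \<epsilon> \<and> V p \<subseteq> V q)" for q p
  have dense: "\<exists>q\<in>{q. b \<in> V q}. le q p" for b p
  proof (cases "measure \<mu> (V p) < \<epsilon>")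
    case True
    then obtain e where e: "e > 0" "measure \<mu> (ball b e) < \<epsilon> - measure \<mu> (V p)"
      using small_ball[OF \<mu>(1,2), of "\<epsilon> - measure \<mu> (V p)" b] by auto
    obtain j where j: "b \<in> U j" "U j \<subseteq> ball b e" using basis_element[OF U open_ball, of b b e] e(1) by auto
    define q where "q = set_encode (insert j (set_decode p))"
    have Vq: "V q = U j \<union> V p" unfolding V_def q_def by simp
    have mU: "U j \<in> sets \<mu>" unfolding sets using oU by simp
    have "measure \<mu> (V q) \<le> measure \<mu> (U j) + measure \<mu> (V p)" unfolding Vq using mU mV by (rule measure_subadditive) simp_all
    also have "measure \<mu> (U j) \<le> measure \<mu> (ball b e)" using j(2) by (intro finite_measure_mono) (simp_all add: sets)
    finally have "measure \<mu> (V q) < \<epsilon>" using e(2) by simp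
    then show ?thesis using j(1) Vq unfolding le_def by (intro bexI[of _ q]) auto
  next
    case False
    obtain j where j: "b \<in> U j" using basis_element[OF U open_UNIV, of b] by auto
    moreover have "set_decode (set_encode {j}) = {j}" by (rule set_encode_inverse) simp
    ultimately have "b \<in> V (set_encode {j})" unfolding V_def by blast
    then show ?thesis using False unfolding le_def by blast
  qed
  obtain q where q: "q 0 = 0" "\<And>n. q (Suc n) = q n \<or> le (q (Suc n)) (q n)" "\<And>b. b \<in> B \<Longrightarrow> \<exists>n. b \<in> V (q n)"
    using generic_chain[where p = 0 and E = "\<lambda>b. {q. b \<in> V q}" and le = le, OF B dense] by blast
  have small: "measure \<mu> (V (q n)) < \<epsilon>" for n
  proof (induction n)
    case 0
    have "V 0 = {}" unfolding V_def by simp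
    then show ?case using q(1) \<epsilon> by simp
  next
    case (Suc n)
    then show ?case using q(2)[of n] unfolding le_def by metis
  qed
  have "V (q n) \<subseteq> V (q (Suc n))" for n using q(2)[of n] small[of n] unfolding le_def by auto
  then have inc: "incseq (\<lambda>n. V (q n))" by (rule incseq_SucI)
  have "emeasure \<mu> (\<Union>n. V (q n)) = (SUP n. emeasure \<mu> (V (q n)))"
    by (rule SUP_emeasure_incseq[symmetric]) (use inc mV in auto)
  also have "\<dots> \<le> ennreal \<epsilon>" using small by (intro SUP_least) (simp add: emeasure_eq_measure ennreal_leI less_imp_le)
  finally show "\<exists>V. open V \<and> B \<subseteq> V \<and> emeasure \<mu> V \<le> ennreal \<epsilon>"
    using q(3) oV by (intro exI[of _ "\<Union>n. V (q n)"]) auto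
qed

text \<open>
  The set \<open>\<Union>j\<in>c n. U j\<close> is a union of small neighbourhoods of a dense sequence. The meager set is given by its code
  \<open>c\<close>, since the codes can be enumerated in a transfinite recursion.
\<close>

theorem exists_meager_conull:
  fixes \<mu> :: "'a::polish_space measure" and U :: "nat \<Rightarrow> 'a set"
  assumes \<mu>: "borel_prob \<mu>" "\<And>x. emeasure \<mu> {x} = 0" and U: "topological_basis (range U)"
  shows "\<exists>c :: nat \<Rightarrow> nat set. (\<forall>n. nowhere_dense (- (\<Union>j\<in>c n. U j))) \<and> (\<Inter>n. \<Union>j\<in>c n. U j) \<in> null_sets (completion \<mu>)"
proof -
  interpret prob_space \<mu> using \<mu>(1) unfolding borel_prob_def by blast
  have sets: "sets \<mu> = sets borel" using \<mu>(1) unfolding borel_prob_def by blast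
  have oU: "open (U j)" for j using topological_basis_open[OF U] by blast
  have ex: "\<exists>c. nowhere_dense (- (\<Union>j\<in>c. U j)) \<and> emeasure \<mu> (\<Union>j\<in>c. U j) \<le> ennreal \<epsilon>" if \<epsilon>: "\<epsilon> > 0" for \<epsilon> :: real
  proof -
    have "\<exists>k. (U j \<noteq> {} \<longrightarrow> U k \<inter> U j \<noteq> {}) \<and> measure \<mu> (U k) \<le> \<epsilon> * (1/2) ^ Suc j" for j
    proof -
      obtain x where x: "U j \<noteq> {} \<longrightarrow> x \<in> U j" by blast
      obtain e where e: "e > 0" "measure \<mu> (ball x e) < \<epsilon> * (1/2) ^ Suc j"
        using small_ball[OF \<mu>(1,2), of "\<epsilon> * (1/2) ^ Suc j" x] \<epsilon> by auto
      obtain k where k: "x \<in> U k" "U k \<subseteq> ball x e" using basis_element[OF U open_ball, of x x e] e(1) by auto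
      have "measure \<mu> (U k) \<le> measure \<mu> (ball x e)" using k(2) by (intro finite_measure_mono) (simp_all add: sets)
      then show ?thesis using e(2) k(1) x by (intro exI[of _ k]) auto
    qed
    then obtain k where k: "\<And>j. U j \<noteq> {} \<Longrightarrow> U (k j) \<inter> U j \<noteq> {}" "\<And>j. measure \<mu> (U (k j)) \<le> \<epsilon> * (1/2) ^ Suc j"
      by metis
    have s: "(\<lambda>j. \<epsilon> * (1/2) ^ Suc j) sums (\<epsilon> * 1)" by (intro sums_mult power_half_series)
    have sm: "summable (\<lambda>j. measure \<mu> (U (k j)))"
      by (rule summable_comparison_test'[OF sums_summable[OF s], of 0]) (use k(2) in auto)
    have "measure \<mu> (\<Union>j. U (k j)) \<le> (\<Sum>j. measure \<mu> (U (k j)))"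
      by (rule finite_measure_subadditive_countably) (use sm oU in \<open>auto simp: sets\<close>)
    also have "\<dots> \<le> (\<Sum>j. \<epsilon> * (1/2) ^ Suc j)" by (rule suminf_le[OF k(2) sm sums_summable[OF s]])
    also have "\<dots> = \<epsilon>" using sums_unique[OF s] by simp
    finally have "emeasure \<mu> (\<Union>j\<in>range k. U j) \<le> ennreal \<epsilon>" by (simp add: emeasure_eq_measure ennreal_leI)
    moreover have "nowhere_dense (- (\<Union>j\<in>range k. U j))"
    proof -
      have cl: "closed (- (\<Union>j\<in>range k. U j))" using oU by auto
      have "interior (- (\<Union>j\<in>range k. U j)) = {}"
      proof (rule ccontr)
        assume "interior (- (\<Union>j\<in>range k. U j)) \<noteq> {}"
        then obtain x where x: "x \<in> interior (- (\<Union>j\<in>range k. U j))" by blast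
        obtain j where j: "x \<in> U j" "U j \<subseteq> interior (- (\<Union>j\<in>range k. U j))"
          using basis_element[OF U open_interior x] by auto
        then have "U (k j) \<inter> U j \<noteq> {}" using k(1) by blast
        then show False using j(2) interior_subset by blast
      qed
      then show ?thesis unfolding nowhere_dense_def using cl by simp
    qed
    ultimately show ?thesis by blast
  qed
  have "\<exists>c. nowhere_dense (- (\<Union>j\<in>c. U j)) \<and> emeasure \<mu> (\<Union>j\<in>c. U j) \<le> ennreal (1 / real (Suc n))" for n
    by (rule ex) simp
  then obtain c where c: "\<And>n. nowhere_dense (- (\<Union>j\<in>c n. U j))" "\<And>n. emeasure \<mu> (\<Union>j\<in>c n. U j) \<le> ennreal (1 / real (Suc n))"
    by metis
  have "(\<Inter>n. \<Union>j\<in>c n. U j) \<in> null_sets (completion \<mu>)"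
  proof (rule null_if_outer_small[OF \<mu>(1)])
    fix \<epsilon> :: real assume "\<epsilon> > 0"
    then obtain n where n: "1 / real (Suc n) < \<epsilon>" using reals_Archimedean[of \<epsilon>] by (auto simp: inverse_eq_divide)
    have "emeasure \<mu> (\<Union>j\<in>c n. U j) \<le> ennreal \<epsilon>" using c(2)[of n] n by (meson ennreal_leI less_imp_le order_trans)
    then show "\<exists>V. open V \<and> (\<Inter>n. \<Union>j\<in>c n. U j) \<subseteq> V \<and> emeasure \<mu> V \<le> ennreal \<epsilon>"
      using oU by (intro exI[of _ "\<Union>j\<in>c n. U j"]) auto
  qed
  then show ?thesis using c(1) by blast
qed

section \<open>The transfinite construction\<close>

text \<open>
  The representing relation \<open>|UNIV|\<close> of a cardinal is a well-order of minimal type, hence its proper initial segments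
  have smaller cardinality.
\<close>

abbreviation before :: "'i \<Rightarrow> 'i set" where
  "before i \<equiv> underS |UNIV :: 'i set| i"

lemma before_total:
  fixes i j :: 'i
  assumes "i \<noteq> j"
  shows "i \<in> before j \<or> j \<in> before i"
proof -
  have "total_on (UNIV :: 'i set) |UNIV :: 'i set|"
    using card_of_well_order_on[of "UNIV :: 'i set"] unfolding well_order_on_def linear_order_on_def by blast
  then show ?thesis using assms unfolding total_on_def underS_def by blast
qed

lemma before_trans:
  fixes i j k :: 'i
  assumes "i \<in> before j" "j \<in> before k"
  shows "i \<in> before k"
proof -
  have "trans |UNIV :: 'i set|" "antisym |UNIV :: 'i set|"
    using card_of_well_order_on[of "UNIV :: 'i set"]
    unfolding well_order_on_def linear_order_on_def partial_order_on_def preorder_on_def by blast+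
  then show ?thesis using assms unfolding underS_def by (simp) (metis antisymD transD)
qed

lemma wf_before: "wf {(i, j :: 'i). i \<in> before j}"
proof -
  have "wf ( |UNIV :: 'i set| - Id)" using card_of_well_order_on[of "UNIV :: 'i set"] unfolding well_order_on_def by blast
  then show ?thesis by (rule wf_subset) (auto simp: underS_def)
qed

lemma card_before: "|before (i :: 'i)| <o |UNIV :: 'i set|"
  by (rule card_of_underS[OF card_of_Card_order]) (simp add: Field_card_of)

text \<open>
  The stages are pairs, so that each \<open>g \<notin> T\<close> is the first component of as many stages as there are group elements.
  Stages \<open>i\<close> with \<open>fst i \<in> T\<close> get the harmless shift \<open>0\<close>.
\<close>

definition stage_shift :: "'a::zero set \<Rightarrow> 'a \<times> 'a \<Rightarrow> 'a" where
  "stage_shift T i = (if fst i \<in> T then 0 else fst i)"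

definition stage_points :: "'a::{zero,plus} set \<Rightarrow> ('a \<times> 'a \<Rightarrow> 'a) \<Rightarrow> ('a \<times> 'a) set \<Rightarrow> 'a set" where
  "stage_points T x J = (\<Union>j\<in>J. {x j, x j + stage_shift T j})"

lemma card_image_less: "|A| <o r \<Longrightarrow> |f ` A| <o r"
  by (rule ordLeq_ordLess_trans[OF card_of_image])

lemma ordLess_Times:
  assumes inf: "infinite C" and AB: "|A| <o |C|" "|B| <o |C|"
  shows "|A \<times> B| <o |C|"
proof (cases "finite (A <+> B)")
  case True
  then have "finite (A \<times> B)" by (simp add: finite_Plus_iff)
  then show ?thesis by (rule finite_ordLess_infinite_set[OF _ inf])
next
  case False
  have "|A \<times> B| \<le>o |A <+> B|"
    using False by (intro card_of_Times_ordLeq_infinite_Field card_of_Plus1 card_of_Plus2 card_of_Card_order)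
      (simp add: Field_card_of)
  then show ?thesis by (rule ordLeq_ordLess_trans[OF _ card_of_Plus_ordLess_infinite[OF inf AB]])
qed

lemma ordLess_UN_finite:
  assumes unc: "uncountable C" and I: "|I| <o |C|" and F: "\<And>i. i \<in> I \<Longrightarrow> finite (F i)"
  shows "|\<Union>i\<in>I. F i| <o |C|"
proof -
  have inf: "infinite C" using unc countable_finite by blast
  have infD: "infinite (I <+> (UNIV :: nat set))" by (simp add: finite_Plus_iff)
  have "|\<Union>i\<in>I. F i| \<le>o |I <+> (UNIV :: nat set)|"
    using F by (intro card_of_UNION_ordLeq_infinite[OF infD card_of_Plus1] ballI
      ordLess_imp_ordLeq[OF finite_ordLess_infinite_set[OF _ infD]]) auto
  then show ?thesis
    by (rule ordLeq_ordLess_trans[OF _ card_of_Plus_ordLess_infinite[OF inf I nat_ordLess_uncountable[OF unc]]])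
qed

lemma card_stage_points_less:
  assumes "infinite (UNIV :: 'a::ab_group_add set)" "|J| <o |UNIV :: 'a set|"
  shows "|stage_points T x J| <o |UNIV :: 'a set|"
proof -
  have "stage_points T x J = x ` J \<union> (\<lambda>j. x j + stage_shift T j) ` J" unfolding stage_points_def by auto
  then show ?thesis using assms by (simp add: card_of_Un_ordLess_infinite card_image_less)
qed

text \<open>
  At each stage both new points avoid the earlier points and their translates by elements of \<open>T\<close>. As \<open>T\<close> is
  symmetric, no difference in \<open>T\<close> can then occur between different stages, and within a stage the only nonzero differences
  are \<open>g\<close> and \<open>- g\<close>. The predicate \<open>\<Phi>\<close> stands for the smallness requirement, depending on the set of
  previous stages, the set of previous points and the shift.
\<close>

theorem transfinite_construction:
  fixes T :: "'a::ab_group_add set"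
  assumes inf: "infinite (UNIV :: 'a set)"
    and T: "\<And>t. t \<in> T \<Longrightarrow> - t \<in> T" "0 \<notin> T" "|T| <o |UNIV :: 'a set|"
    and step: "\<And>J B F g. \<lbrakk>|J| <o |UNIV :: 'a set|; |B| <o |UNIV :: 'a set|; |F| <o |UNIV :: 'a set|; g \<notin> T\<rbrakk>
      \<Longrightarrow> \<exists>x. x \<notin> F \<and> x + g \<notin> F \<and> \<Phi> J B g x"
  obtains x where "\<And>i. \<Phi> (before i) (stage_points T x (before i)) (stage_shift T i) (x i)"
    and "\<And>i j. i \<noteq> j \<Longrightarrow> {x i, x i + stage_shift T i} \<inter> {x j, x j + stage_shift T j} = {}"
    and "\<And>t. t \<in> T \<Longrightarrow> stage_points T x UNIV \<inter> (+) t ` stage_points T x UNIV = {}"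
    and "\<And>g. g \<notin> T \<Longrightarrow> |stage_points T x UNIV| \<le>o |stage_points T x UNIV \<inter> (+) g ` stage_points T x UNIV|"
proof -
  let ?\<kappa> = "|UNIV :: 'a set|"
  have pairs: "|UNIV :: ('a \<times> 'a) set| =o ?\<kappa>" using card_of_Times_same_infinite[OF inf] by simp
  have before_less: "|before i| <o ?\<kappa>" for i :: "'a \<times> 'a"
    by (rule ordLess_ordIso_trans[OF card_before pairs])
  define forbid where "forbid B = B \<union> (\<lambda>(b, t). b + t) ` (B \<times> T)" for B :: "'a set"
  have forbid_less: "|forbid B| <o ?\<kappa>" if "|B| <o ?\<kappa>" for B
    unfolding forbid_def by (intro card_of_Un_ordLess_infinite inf that card_image_less ordLess_Times T)
  define P where "P x i y \<longleftrightarrow> y \<notin> forbid (stage_points T x (before i)) \<and> y + stage_shift T i \<notin> forbid (stage_points T x (before i)) \<and>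
    \<Phi> (before i) (stage_points T x (before i)) (stage_shift T i) y" for x i y
  have "\<exists>x. \<forall>i. P x i (x i)"
  proof (rule dependent_wf_choice[OF wf_before])
    fix f g :: "'a \<times> 'a \<Rightarrow> 'a" and i y assume "\<And>z. (z, i) \<in> {(i, j). i \<in> before j} \<Longrightarrow> f z = g z"
    then have "stage_points T f (before i) = stage_points T g (before i)" unfolding stage_points_def by simp
    then show "P f i y = P g i y" unfolding P_def by simp
  next
    fix i :: "'a \<times> 'a" and f :: "'a \<times> 'a \<Rightarrow> 'a"
    have B: "|stage_points T f (before i)| <o ?\<kappa>" by (rule card_stage_points_less[OF inf before_less])
    have "stage_shift T i \<notin> T" using T(2) unfolding stage_shift_def by auto
    from step[OF before_less B forbid_less[OF B] this] show "\<exists>y. P f i y" unfolding P_def by blast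
  qed
  then obtain x where x: "\<And>i. P x i (x i)" by blast
  define A where "A = stage_points T x UNIV"
  define pr where "pr i = {x i, x i + stage_shift T i}" for i
  have A: "A = (\<Union>i. pr i)" unfolding A_def stage_points_def pr_def by simp
  have fresh: "a \<notin> forbid (stage_points T x (before i))" if "a \<in> pr i" for a i
    using x[of i] that unfolding P_def pr_def by auto
  have old: "pr j \<subseteq> stage_points T x (before i)" if "j \<in> before i" for i j
    using that unfolding stage_points_def pr_def by blast
  have disj: "pr i \<inter> pr j = {}" if ij: "i \<noteq> j" for i j
  proof -
    have "pr i \<inter> pr j = {}" if "i \<in> before j" for i j
      using fresh[of _ j] old[OF that] unfolding forbid_def by blast
    then show ?thesis using before_total[OF ij] by blast
  qed
  have apart: "A \<inter> (+) t ` A = {}" if t: "t \<in> T" for t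
  proof (rule ccontr)
    assume "A \<inter> (+) t ` A \<noteq> {}"
    then obtain a b where ab: "a \<in> A" "b \<in> A" "a = t + b" by blast
    then obtain i j where ij: "a \<in> pr i" "b \<in> pr j" unfolding A by blast
    consider "i = j" | "j \<in> before i" | "i \<in> before j" using before_total[of i j] by blast
    then show False
    proof cases
      case 1
      have "t = a - b" using ab(3) by simp
      then have "t \<in> {0, stage_shift T i, - stage_shift T i}" using ij 1 unfolding pr_def by auto
      moreover have "stage_shift T i \<notin> T" using T(2) unfolding stage_shift_def by auto
      moreover from this have "- stage_shift T i \<notin> T" using T(1) by force
      ultimately show False using t T(2) by auto
    next
      case 2
      then have "(b, t) \<in> stage_points T x (before i) \<times> T" using old ij(2) t by blast
      then have "a \<in> forbid (stage_points T x (before i))" unfolding forbid_def ab(3) by (force simp: add.commute)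
      then show False using fresh ij(1) by blast
    next
      case 3
      then have "(a, - t) \<in> stage_points T x (before j) \<times> T" using old ij(1) T(1)[OF t] by blast
      moreover have "b = a + - t" using ab(3) by simp
      ultimately have "b \<in> forbid (stage_points T x (before j))" unfolding forbid_def by force
      then show False using fresh ij(2) by blast
    qed
  qed
  have large: "|A| \<le>o |A \<inter> (+) g ` A|" if g: "g \<notin> T" for g
  proof -
    have "inj_on (\<lambda>h. x (g, h) + g) UNIV"
    proof (rule inj_onI)
      fix h k assume eq: "x (g, h) + g = x (g, k) + g"
      then have "pr (g, h) \<inter> pr (g, k) \<noteq> {}" unfolding pr_def by auto
      then show "h = k" using disj[of "(g, h)" "(g, k)"] by auto
    qed
    moreover have "range (\<lambda>h. x (g, h) + g) \<subseteq> A \<inter> (+) g ` A"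
    proof
      fix a assume "a \<in> range (\<lambda>h. x (g, h) + g)"
      then obtain h where h: "a = g + x (g, h)" by (auto simp: add.commute)
      have "x (g, h) \<in> A" "x (g, h) + g \<in> A" using g unfolding A pr_def stage_shift_def by fastforce+
      then show "a \<in> A \<inter> (+) g ` A" unfolding h by (auto simp: add.commute)
    qed
    ultimately have "|UNIV :: 'a set| \<le>o |A \<inter> (+) g ` A|"
      using card_of_ordLeq[of "UNIV :: 'a set" "A \<inter> (+) g ` A"] by blast
    then show ?thesis by (rule ordLeq_transitive[OF card_of_mono1[OF subset_UNIV]])
  qed
  show thesis
  proof (rule that[of x])
    show "\<Phi> (before i) (stage_points T x (before i)) (stage_shift T i) (x i)" for i using x[of i] unfolding P_def by blast
    show "{x i, x i + stage_shift T i} \<inter> {x j, x j + stage_shift T j} = {}" if "i \<noteq> j" for i j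
      using disj[OF that] unfolding pr_def .
    show "stage_points T x UNIV \<inter> (+) t ` stage_points T x UNIV = {}" if "t \<in> T" for t using apart[OF that] unfolding A_def .
    show "|stage_points T x UNIV| \<le>o |stage_points T x UNIV \<inter> (+) g ` stage_points T x UNIV|" if "g \<notin> T" for g
      using large[OF that] unfolding A_def .
  qed
qed

text \<open>
  Since \<open>(x + A) \<inter> (y + A)\<close> is a translate of \<open>A \<inter> ((y - x) + A)\<close>, it is empty or of full size according to
  whether \<open>y - x \<in> T\<close>. So both indices are suprema over the cliques of \<open>T\<close>.
\<close>

lemma packing_indices_eq:
  fixes A :: "'a::ab_group_add set" and \<kappa> :: "'k rel"
  assumes T: "\<And>t. t \<in> T \<Longrightarrow> A \<inter> (+) t ` A = {}" "\<And>g. g \<notin> T \<Longrightarrow> |A| \<le>o |A \<inter> (+) g ` A|"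
    and A: "A \<noteq> {}" and \<kappa>: "Card_order \<kappa>" and S: "clique T S" "|S| =o \<kappa>"
    and K: "\<And>K. clique T K \<Longrightarrow> |K| \<le>o \<kappa>"
  shows "packing_index A =o \<kappa>" "almost_packing_index A =o \<kappa>"
proof -
  have tr: "((+) x ` A) \<inter> ((+) y ` A) = (+) x ` (A \<inter> (+) (y - x) ` A)" for x y
  proof -
    have "(+) y ` A = (+) x ` (+) (y - x) ` A" by (simp add: image_image add.assoc[symmetric])
    then show ?thesis by (simp add: image_Int)
  qed
  have in_T: "((+) x ` A) \<inter> ((+) y ` A) = {}" if "y - x \<in> T" for x y using T(1)[OF that] unfolding tr by simp
  have not_T: "|A| \<le>o |((+) x ` A) \<inter> ((+) y ` A)|" if "y - x \<notin> T" for x y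
  proof -
    have "|A \<inter> (+) (y - x) ` A| =o |(+) x ` (A \<inter> (+) (y - x) ` A)|"
      by (intro card_of_ordIsoI[of "(+) x"] inj_on_imp_bij_betw) (simp add: inj_on_def)
    then show ?thesis unfolding tr by (rule ordLeq_ordIso_trans[OF T(2)[OF that]])
  qed
  have empty: "|{} :: 'a set| <o |A|"
  proof -
    have "\<not> |A| \<le>o |{} :: 'a set|" using A card_of_empty3[of A] by blast
    then show ?thesis by (simp add: not_ordLeq_iff_ordLess card_of_Well_order)
  qed
  have "(((+) x ` A) \<inter> ((+) y ` A) = {}) \<longleftrightarrow> y - x \<in> T" for x y
  proof
    assume e: "((+) x ` A) \<inter> ((+) y ` A) = {}"
    show "y - x \<in> T"
    proof (rule ccontr)
      assume "y - x \<notin> T"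
      from not_T[OF this] show False using empty not_ordLess_ordLeq unfolding e by blast
    qed
  qed (rule in_T)
  then have 1: "{S. \<forall>x\<in>S. \<forall>y\<in>S. x \<noteq> y \<longrightarrow> ((+) x ` A) \<inter> ((+) y ` A) = {}} = {S. clique T S}"
    unfolding clique_def by simp
  have "|((+) x ` A) \<inter> ((+) y ` A)| <o |A| \<longleftrightarrow> y - x \<in> T" for x y
  proof
    assume l: "|((+) x ` A) \<inter> ((+) y ` A)| <o |A|"
    show "y - x \<in> T"
    proof (rule ccontr)
      assume "y - x \<notin> T"
      from not_T[OF this] show False using l not_ordLess_ordLeq by blast
    qed
  next
    assume "y - x \<in> T"
    then show "|((+) x ` A) \<inter> ((+) y ` A)| <o |A|" using in_T empty by simp
  qed
  then have 2: "{S. \<forall>x\<in>S. \<forall>y\<in>S. x \<noteq> y \<longrightarrow> |((+) x ` A) \<inter> ((+) y ` A)| <o |A|} = {S. clique T S}"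
    unfolding clique_def by simp
  have "card_sup {S. clique T S} =o \<kappa>"
  proof -
    have "card_sup {S. clique T S} \<le>o \<kappa>" by (rule card_sup_least[OF \<kappa>]) (use K in simp)
    moreover have "|S| \<le>o card_sup {S. clique T S}" by (rule card_sup_upper) (use S in simp)
    then have "\<kappa> \<le>o card_sup {S. clique T S}" by (rule ordIso_ordLeq_trans[OF ordIso_symmetric[OF S(2)]])
    ultimately show ?thesis by (simp add: ordIso_iff_ordLeq)
  qed
  then show "packing_index A =o \<kappa>" "almost_packing_index A =o \<kappa>"
    unfolding packing_index_def almost_packing_index_def 1 2 by simp_all
qed

section \<open>A nowhere dense Haar null set\<close>

lemma nat_sets_ordIso_reals: "|UNIV :: nat set set| =o |UNIV :: real set|"
  using nat_sets_eqpoll_reals unfolding eqpoll_def card_of_ordIso .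

lemma ordLeq_nat_sets: "|UNIV :: 'a::{second_countable_topology, t1_space} set| \<le>o |UNIV :: nat set set|"
proof -
  obtain U :: "nat \<Rightarrow> 'a set" where U: "topological_basis (range U)" using exists_basis_enumeration by blast
  have "inj (\<lambda>x. {n. x \<in> U n})"
  proof (rule injI, rule ccontr)
    fix x y assume eq: "{n. x \<in> U n} = {n. y \<in> U n}" and "x \<noteq> y"
    then obtain n where "x \<in> U n" "U n \<subseteq> - {y}" using basis_element[OF U, of "- {y}" x] by auto
    then show False using eq by blast
  qed
  then show ?thesis using card_of_ordLeq[of "UNIV :: 'a set" "UNIV :: nat set set"] by blast
qed

lemma uncountable_if_inj_nat_sets:
  assumes "inj (f :: nat set \<Rightarrow> 'a)"
  shows "uncountable (UNIV :: 'a set)"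
proof
  assume "countable (UNIV :: 'a set)"
  then have "countable (range f)" by (rule countable_subset[rotated]) simp
  then have "countable (UNIV :: nat set set)" using assms by (rule countable_image_inj_on)
  moreover obtain h :: "nat set \<Rightarrow> real" where "bij h" using nat_sets_eqpoll_reals unfolding eqpoll_def by blast
  ultimately have "countable (UNIV :: real set)" by (metis bij_is_surj countable_image)
  then show False using uncountable_UNIV_real by simp
qed

lemma finite_null:
  fixes \<mu> :: "'a::t1_space measure"
  assumes \<mu>: "borel_prob \<mu>" "\<And>x. emeasure \<mu> {x} = 0" and A: "finite A"
  shows "A \<in> null_sets \<mu>"
  using A
proof (induction A rule: finite_induct)
  case (insert x A)
  have "{x} \<in> null_sets \<mu>" using \<mu> unfolding borel_prob_def by (intro null_setsI) auto
  then have "{x} \<union> A \<in> null_sets \<mu>" using insert.IH by (rule null_sets.Un)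
  then show ?case by simp
qed simp

text \<open>
  Every translate of \<open>A\<close> meets the closed set \<open>P\<close>, which carries \<open>\<mu>\<close>, in a finite set, and finite sets are
  null as \<open>\<mu>\<close> is continuous.
\<close>

lemma haar_null_if_finite_traces:
  fixes A :: "'a::{polish_space, topological_ab_group_add} set"
  assumes \<mu>: "borel_prob \<mu>" "\<And>x. emeasure \<mu> {x} = 0" and P: "closed P" "emeasure \<mu> (- P) = 0"
    and fin: "\<And>z. finite (A \<inter> (+) z ` P)"
  shows "haar_null A"
  unfolding haar_null_def
proof (intro exI[of _ \<mu>] conjI allI)
  show "borel_prob \<mu>" by (rule \<mu>(1))
  have sets: "sets \<mu> = sets borel" using \<mu>(1) unfolding borel_prob_def by blast
  fix x y
  let ?D = "(\<lambda>a. x + a + y) ` A"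
  have "?D \<inter> P \<subseteq> (\<lambda>a. x + a + y) ` (A \<inter> (+) (- (x + y)) ` P)"
  proof
    fix b assume "b \<in> ?D \<inter> P"
    then obtain a where a: "a \<in> A" "b = x + a + y" "b \<in> P" by blast
    have "a = - (x + y) + b" unfolding a(2) by (simp add: algebra_simps)
    then show "b \<in> (\<lambda>a. x + a + y) ` (A \<inter> (+) (- (x + y)) ` P)" using a by blast
  qed
  then have "finite (?D \<inter> P)" by (rule finite_subset) (rule finite_imageI[OF fin])
  then have 1: "?D \<inter> P \<in> null_sets \<mu>" by (rule finite_null[OF \<mu>])
  have 2: "- P \<in> null_sets \<mu>" using P sets by (intro null_setsI) auto
  have "?D \<subseteq> (?D \<inter> P) \<union> - P" by blast
  then show "?D \<in> null_sets (completion \<mu>)"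
    using null_sets_completion_subset[OF _ null_sets_completionI[OF null_sets.Un[OF 1 2]]] by blast
qed

lemma nowhere_dense_subset: "A \<subseteq> B \<Longrightarrow> nowhere_dense B \<Longrightarrow> nowhere_dense A"
  unfolding nowhere_dense_def by (metis closure_mono interior_mono subset_empty)

lemma nowhere_dense_singleton:
  assumes "\<not> open {x :: 'a::t1_space}"
  shows "nowhere_dense {x}"
proof -
  have "interior {x} = {}"
  proof (rule ccontr)
    assume "interior {x} \<noteq> {}"
    then have "interior {x} = {x}" using interior_subset[of "{x}"] by blast
    then show False using assms open_interior[of "{x}"] by simp
  qed
  then show ?thesis unfolding nowhere_dense_def by simp
qed

lemma nowhere_dense_translate:
  fixes M :: "'a::topological_ab_group_add set"
  assumes "nowhere_dense M"
  shows "nowhere_dense {x. x + g \<in> M}"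
  unfolding nowhere_dense_def
proof (rule ccontr)
  let ?N = "{x. x + g \<in> M}"
  have op: "open {x. x - a \<in> V}" if "open V" for V :: "'a set" and a by (rule open_translate[OF that])
  assume "interior (closure ?N) \<noteq> {}"
  then obtain x where x: "x \<in> interior (closure ?N)" by blast
  define V where "V = {y. y - g \<in> interior (closure ?N)}"
  have V: "open V" unfolding V_def by (rule op) simp
  have "x + g \<in> V" using x unfolding V_def by simp
  have "closure ?N \<subseteq> {x. x - (- g) \<in> closure M}"
  proof (rule closure_minimal)
    show "?N \<subseteq> {x. x - (- g) \<in> closure M}" using closure_subset[of M] by auto
    have "- {x. x - (- g) \<in> closure M} = {x. x - (- g) \<in> - closure M}" by auto
    moreover have "open {x. x - (- g) \<in> - closure M}" by (rule op[OF open_Compl[OF closed_closure]])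
    ultimately show "closed {x. x - (- g) \<in> closure M}" unfolding closed_def by simp
  qed
  then have "V \<subseteq> closure M" unfolding V_def using interior_subset[of "closure ?N"] by fastforce
  then have "V \<subseteq> interior (closure M)" using V by (simp add: interior_maximal)
  then show False using assms \<open>x + g \<in> V\<close> unfolding nowhere_dense_def by blast
qed

text \<open>
  The requirement on a pair \<open>x, x + g\<close> is that neither point lies in a translate of \<open>P\<close> containing two earlier
  points. Each pair of earlier points rules out only finitely many \<open>x \<in> Q\<close>. In the end no translate of \<open>P\<close> meets
  three stages, and each stage contributes at most two points.
\<close>

theorem exists_haar_null_with_index:
  fixes S :: "'a::{polish_space, topological_ab_group_add} set" and \<kappa> :: "'k rel"
  assumes iso: "\<And>x::'a. \<not> open {x}" and \<kappa>: "Card_order \<kappa>"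
    and S: "|S| =o \<kappa>" "|difference_set S| <o |UNIV :: 'a set|" "\<And>K. clique (difference_set S) K \<Longrightarrow> |K| \<le>o \<kappa>"
  shows "\<exists>A :: 'a set. A \<noteq> {} \<and> nowhere_dense A \<and> haar_null A \<and> packing_index A =o \<kappa> \<and> almost_packing_index A =o \<kappa>"
proof -
  obtain P Q W :: "'a set" and \<mu> :: "'a measure" where nd: "nowhere_dense (Q \<union> W)"
    and many: "\<And>g. \<exists>x :: nat set \<Rightarrow> 'a. inj x \<and> (\<forall>\<tau>. x \<tau> \<in> Q \<and> x \<tau> + g \<in> W)"
    and fin: "\<And>a b. a \<noteq> b \<Longrightarrow> finite {z. a \<in> (+) z ` P \<and> b \<in> (+) z ` P}"
    and one: "\<And>p q z. \<lbrakk>p \<in> Q; q \<in> Q; p \<in> (+) z ` P; q \<in> (+) z ` P\<rbrakk> \<Longrightarrow> p = q"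
    and \<mu>: "borel_prob \<mu>" "\<And>x. emeasure \<mu> {x} = 0" "closed P" "emeasure \<mu> (- P) = 0"
    by (rule exists_nowhere_dense_with_small_test_set[OF iso]) (rule that)
  obtain f :: "nat set \<Rightarrow> 'a" where "inj f" using many[of 0] by blast
  then have unc: "uncountable (UNIV :: 'a set)" by (rule uncountable_if_inj_nat_sets)
  have inf: "infinite (UNIV :: 'a set)" using unc countable_finite by blast
  define T where "T = difference_set S"
  have T: "- t \<in> T" if "t \<in> T" for t using difference_set_symmetric that unfolding T_def by blast
  have T0: "0 \<notin> T" unfolding T_def by (rule zero_notin_difference_set)
  define \<Phi> where "\<Phi> J B g x \<longleftrightarrow> x \<in> Q \<and> x + g \<in> W \<and>
    (\<forall>z. (x \<in> (+) z ` P \<or> x + g \<in> (+) z ` P) \<longrightarrow> (\<forall>a\<in>B \<inter> (+) z ` P. \<forall>b\<in>B \<inter> (+) z ` P. a = b))"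
    for J :: "('a \<times> 'a) set" and B :: "'a set" and g x :: 'a
  have step: "\<exists>x. x \<notin> F \<and> x + g \<notin> F \<and> \<Phi> J B g x"
    if less: "|J| <o |UNIV :: 'a set|" "|B| <o |UNIV :: 'a set|" "|F| <o |UNIV :: 'a set|" and g: "g \<notin> T"
    for J :: "('a \<times> 'a) set" and B F :: "'a set" and g :: 'a
  proof -
    obtain xs :: "nat set \<Rightarrow> 'a" where xs: "inj xs" "\<And>\<tau>. xs \<tau> \<in> Q" "\<And>\<tau>. xs \<tau> + g \<in> W" using many by blast
    \<comment> \<open>\<open>Z (a, b)\<close> are the translates through \<open>a\<close> and \<open>b\<close>, and \<open>R (a, b)\<close> the points of \<open>Q\<close> they spoil\<close>
    define D where "D = {(a, b). a \<in> B \<and> b \<in> B \<and> a \<noteq> b}"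
    define Z where "Z p = {z. fst p \<in> (+) z ` P \<and> snd p \<in> (+) z ` P}" for p :: "'a \<times> 'a"
    define R where "R p = (\<Union>z\<in>Z p. Q \<inter> (+) z ` P \<union> Q \<inter> (+) (z - g) ` P)" for p :: "'a \<times> 'a"
    have finQ: "finite (Q \<inter> (+) z ` P)" for z
    proof (cases "Q \<inter> (+) z ` P = {}")
      case False
      then obtain p where "p \<in> Q \<inter> (+) z ` P" by blast
      then have "Q \<inter> (+) z ` P \<subseteq> {p}" using one[of _ p z] by blast
      then show ?thesis by (rule finite_subset) simp
    qed simp
    have finR: "finite (R p)" if "p \<in> D" for p
    proof -
      have "finite (Z p)" using fin that unfolding Z_def D_def by auto
      then show ?thesis unfolding R_def using finQ by blast
    qed
    have "D \<subseteq> B \<times> B" unfolding D_def by auto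
    then have "|D| <o |UNIV :: 'a set|"
      by (rule ordLeq_ordLess_trans[OF card_of_mono1 ordLess_Times[OF inf less(2,2)]])
    then have R: "|\<Union>p\<in>D. R p| <o |UNIV :: 'a set|" by (rule ordLess_UN_finite[OF unc _ finR])
    define Bad where "Bad = (F \<union> (\<lambda>f. f - g) ` F) \<union> (\<Union>p\<in>D. R p)"
    have Bad: "|Bad| <o |UNIV :: 'a set|" unfolding Bad_def by (intro card_of_Un_ordLess_infinite inf less card_image_less R)
    have "\<not> range xs \<subseteq> Bad"
    proof
      assume "range xs \<subseteq> Bad"
      then have "|UNIV :: nat set set| \<le>o |Bad|"
        using xs(1) card_of_ordLeq[of "UNIV :: nat set set" Bad] by blast
      then have "|UNIV :: 'a set| \<le>o |Bad|" by (rule ordLeq_transitive[OF ordLeq_nat_sets])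
      then show False using Bad not_ordLess_ordLeq by blast
    qed
    then obtain \<tau> where \<tau>: "xs \<tau> \<notin> Bad" by blast
    have notF: "xs \<tau> \<notin> F" using \<tau> unfolding Bad_def by blast
    have notF': "xs \<tau> + g \<notin> F"
    proof
      assume "xs \<tau> + g \<in> F"
      then have "xs \<tau> \<in> (\<lambda>f. f - g) ` F" by (intro image_eqI[of _ _ "xs \<tau> + g"]) auto
      then show False using \<tau> unfolding Bad_def by blast
    qed
    have unique: "a = b" if z: "xs \<tau> \<in> (+) z ` P \<or> xs \<tau> + g \<in> (+) z ` P" and ab: "a \<in> B \<inter> (+) z ` P" "b \<in> B \<inter> (+) z ` P" for z a b
    proof (rule ccontr)
      assume "a \<noteq> b"
      then have p: "(a, b) \<in> D" "z \<in> Z (a, b)" using ab unfolding D_def Z_def by auto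
      have "xs \<tau> \<in> (+) z ` P \<or> xs \<tau> \<in> (+) (z - g) ` P"
      proof -
        have "xs \<tau> \<in> (+) (z - g) ` P" if m: "xs \<tau> + g \<in> (+) z ` P"
        proof -
          obtain q where q: "q \<in> P" "xs \<tau> + g = z + q" using m by blast
          have "xs \<tau> = z - g + q" using q(2) by (simp add: algebra_simps eq_diff_eq)
          then show ?thesis using q(1) by blast
        qed
        then show ?thesis using z by blast
      qed
      then have "xs \<tau> \<in> R (a, b)" unfolding R_def using p(2) xs(2) by blast
      then show False using \<tau> p(1) unfolding Bad_def by blast
    qed
    have "\<Phi> J B g (xs \<tau>)" unfolding \<Phi>_def using xs(2,3) unique by (intro conjI allI impI ballI)
    then show ?thesis using notF notF' by (intro exI[of _ "xs \<tau>"]) simp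
  qed
  have T_less: "|T| <o |UNIV :: 'a set|" using S(2) unfolding T_def .
  obtain x where x: "\<And>i. \<Phi> (before i) (stage_points T x (before i)) (stage_shift T i) (x i)"
    and disj: "\<And>i j. i \<noteq> j \<Longrightarrow> {x i, x i + stage_shift T i} \<inter> {x j, x j + stage_shift T j} = {}"
    and apart: "\<And>t. t \<in> T \<Longrightarrow> stage_points T x UNIV \<inter> (+) t ` stage_points T x UNIV = {}"
    and large: "\<And>g. g \<notin> T \<Longrightarrow> |stage_points T x UNIV| \<le>o |stage_points T x UNIV \<inter> (+) g ` stage_points T x UNIV|"
    by (rule transfinite_construction[where T = T and \<Phi> = \<Phi>, OF inf T T0 T_less step]) (assumption | rule that)+
  define A where "A = stage_points T x UNIV"
  have ne: "A \<noteq> {}" unfolding A_def stage_points_def by auto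
  have "A \<subseteq> Q \<union> W" using x unfolding A_def stage_points_def \<Phi>_def by auto
  then have ndA: "nowhere_dense A" using nd by (rule nowhere_dense_subset)
  have finA: "finite (A \<inter> (+) z ` P)" for z
  proof -
    define pr where "pr i = {x i, x i + stage_shift T i}" for i
    define I where "I = {i. pr i \<inter> (+) z ` P \<noteq> {}}"
    \<comment> \<open>if three stages met \<open>z + P\<close>, the last one would violate its requirement\<close>
    have no_chain: False if ijk: "i \<in> I" "j \<in> I" "k \<in> I" "i \<in> before j" "i \<in> before k" "j \<in> before k" "i \<noteq> j" for i j k
    proof -
      obtain a b where ab: "a \<in> pr i" "a \<in> (+) z ` P" "b \<in> pr j" "b \<in> (+) z ` P" using ijk(1,2) unfolding I_def by blast
      have "a \<in> stage_points T x (before k)" "b \<in> stage_points T x (before k)"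
        using ab ijk(5,6) unfolding stage_points_def pr_def by blast+
      moreover have "x k \<in> (+) z ` P \<or> x k + stage_shift T k \<in> (+) z ` P" using ijk(3) unfolding I_def pr_def by blast
      ultimately have "a = b" using x[of k] ab(2,4) unfolding \<Phi>_def by blast
      then show False using disj[OF ijk(7)] ab unfolding pr_def by blast
    qed
    have "finite I"
    proof (rule ccontr)
      assume "infinite I"
      then obtain I' where "I' \<subseteq> I" "card I' = 3" using infinite_arbitrarily_large by blast
      then obtain i j k where ijk: "i \<in> I" "j \<in> I" "k \<in> I" "i \<noteq> j" "i \<noteq> k" "j \<noteq> k" unfolding card_3_iff by auto
      have chain: False if "a \<in> I" "b \<in> I" "d \<in> I" "a \<noteq> b" "a \<in> before b" "b \<in> before d" for a b d
        using no_chain[OF that(1-3,5) before_trans[OF that(5,6)] that(6,4)] .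
      from before_total[OF ijk(4)] before_total[OF ijk(5)] before_total[OF ijk(6)] show False
        using chain[OF ijk(1,2,3)] chain[OF ijk(1,3,2)] chain[OF ijk(2,1,3)] chain[OF ijk(2,3,1)] chain[OF ijk(3,1,2)] chain[OF ijk(3,2,1)] ijk(4-6)
        by metis
    qed
    then have "finite (\<Union>i\<in>I. pr i)" unfolding pr_def by simp
    moreover have "A \<inter> (+) z ` P \<subseteq> (\<Union>i\<in>I. pr i)" unfolding A_def stage_points_def I_def pr_def by blast
    ultimately show ?thesis by (rule finite_subset[rotated])
  qed
  have null: "haar_null A" by (rule haar_null_if_finite_traces[OF \<mu> finA])
  have apartA: "A \<inter> (+) t ` A = {}" if "t \<in> T" for t using apart[OF that] unfolding A_def .
  have largeA: "|A| \<le>o |A \<inter> (+) g ` A|" if "g \<notin> T" for g using large[OF that] unfolding A_def .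
  have K: "|K| \<le>o \<kappa>" if "clique T K" for K using S(3) that unfolding T_def .
  have C: "clique T S" unfolding T_def by (rule clique_difference_set_self)
  have "packing_index A =o \<kappa>" "almost_packing_index A =o \<kappa>"
    using packing_indices_eq[of T A \<kappa> S] apartA largeA ne \<kappa> C S(1) K by blast+
  then show ?thesis using ne ndA null by blast
qed

section \<open>A universally null set\<close>

text \<open>
  Both points of stage \<open>i\<close> avoid the meager sets coded by the earlier stages. For a continuous measure let \<open>j\<close> be the
  stage that codes a meager conull set. Outside a null set, \<open>A\<close> then consists of points of stages up to \<open>j\<close>, which
  are fewer than \<open>cov_meager\<close>.
\<close>

theorem exists_universally_null_with_index:
  fixes S :: "'a::{polish_space, topological_ab_group_add} set" and \<kappa> :: "'k rel"
  assumes iso: "\<And>x::'a. \<not> open {x}" and unc: "uncountable (UNIV :: 'a set)"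
    and cov: "cov_meager =o |UNIV :: real set|" and cont: "|UNIV :: nat set set| \<le>o |UNIV :: 'a set|"
    and \<kappa>: "Card_order \<kappa>"
    and S: "|S| =o \<kappa>" "|difference_set S| <o |UNIV :: 'a set|" "\<And>K. clique (difference_set S) K \<Longrightarrow> |K| \<le>o \<kappa>"
  shows "\<exists>A :: 'a set. A \<noteq> {} \<and> universally_null A \<and> packing_index A =o \<kappa> \<and> almost_packing_index A =o \<kappa>"
proof -
  have inf: "infinite (UNIV :: 'a set)" using unc countable_finite by blast
  have infR: "infinite (UNIV :: real set)" by (rule infinite_UNIV_char_0)
  have to_real: "|X| <o |UNIV :: real set|" if "|X| <o |UNIV :: 'a set|" for X :: "'x set"
    using ordLess_ordLeq_trans[OF that ordLeq_ordIso_trans[OF ordLeq_nat_sets nat_sets_ordIso_reals]] .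
  obtain U :: "nat \<Rightarrow> 'a set" where U: "topological_basis (range U)" using exists_basis_enumeration by blast
  have "|UNIV :: (nat \<Rightarrow> nat set) set| \<le>o |UNIV :: ('a \<times> 'a) set|"
  proof -
    \<comment> \<open>a sequence of sets of numbers is coded by a single set of numbers\<close>
    have "inj (\<lambda>c :: nat \<Rightarrow> nat set. {prod_encode (n, k) |n k. k \<in> c n})"
    proof (rule injI, rule ext, rule set_eqI)
      fix c d :: "nat \<Rightarrow> nat set" and n k
      assume eq: "{prod_encode (n, k) |n k. k \<in> c n} = {prod_encode (n, k) |n k. k \<in> d n}"
      have "k \<in> e n \<longleftrightarrow> prod_encode (n, k) \<in> {prod_encode (n, k) |n k. k \<in> e n}" for e :: "nat \<Rightarrow> nat set" by auto
      from this[of c] this[of d] show "k \<in> c n \<longleftrightarrow> k \<in> d n" unfolding eq by (rule trans[OF _ sym])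
    qed
    then have le: "|UNIV :: (nat \<Rightarrow> nat set) set| \<le>o |UNIV :: nat set set|"
      using card_of_ordLeq[of "UNIV :: (nat \<Rightarrow> nat set) set" "UNIV :: nat set set"] by blast
    have iso: "|UNIV :: 'a set| =o |UNIV :: ('a \<times> 'a) set|"
      using card_of_Times_same_infinite[OF inf] ordIso_symmetric by simp
    show ?thesis by (rule ordLeq_ordIso_trans[OF ordLeq_transitive[OF le cont] iso])
  qed
  then obtain code :: "'a \<times> 'a \<Rightarrow> nat \<Rightarrow> nat set" where code: "range code = UNIV"
    using card_of_ordLeq2[of "UNIV :: (nat \<Rightarrow> nat set) set" "UNIV :: ('a \<times> 'a) set"] by auto
  define N where "N j n = (if nowhere_dense (- (\<Union>l\<in>code j n. U l)) then - (\<Union>l\<in>code j n. U l) else {})" for j n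
  have nd_empty: "nowhere_dense ({} :: 'a set)" unfolding nowhere_dense_def by simp
  have ndN: "nowhere_dense (N j n)" for j n unfolding N_def using nd_empty by simp
  have nd1: "nowhere_dense {x :: 'a}" for x by (rule nowhere_dense_singleton[OF iso])
  define T where "T = difference_set S"
  have T: "- t \<in> T" if "t \<in> T" for t using difference_set_symmetric that unfolding T_def by blast
  have T0: "0 \<notin> T" unfolding T_def by (rule zero_notin_difference_set)
  have T_less: "|T| <o |UNIV :: 'a set|" using S(2) unfolding T_def .
  define \<Phi> where "\<Phi> J B g x \<longleftrightarrow> (\<forall>j\<in>J. \<forall>n. x \<notin> N j n \<and> x + g \<notin> N j n)"
    for J :: "('a \<times> 'a) set" and B :: "'a set" and g x :: 'a
  have step: "\<exists>x. x \<notin> F \<and> x + g \<notin> F \<and> \<Phi> J B g x"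
    if less: "|J| <o |UNIV :: 'a set|" "|B| <o |UNIV :: 'a set|" "|F| <o |UNIV :: 'a set|" and g: "g \<notin> T"
    for J :: "('a \<times> 'a) set" and B F :: "'a set" and g :: 'a
  proof -
    define M where "M = case_sum (\<lambda>(j, n). N j n) (\<lambda>f. {f})"
    define I where "I = (J \<times> (UNIV :: nat set)) <+> F"
    have ndM: "nowhere_dense (M i)" for i unfolding M_def using ndN nd1 by (cases i) auto
    have I: "|I| <o |UNIV :: real set|" unfolding I_def
      by (intro card_of_Plus_ordLess_infinite ordLess_Times infR to_real less nat_ordLess_uncountable uncountable_UNIV_real)
    \<comment> \<open>\<open>x\<close> avoids \<open>M i\<close> (index \<open>True\<close>), and \<open>x + g\<close> avoids it as well (index \<open>False\<close>)\<close>
    define M' where "M' = (\<lambda>(b, i). if b then M i else {x. x + g \<in> M i})"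
    have ndM': "nowhere_dense (M' p)" for p unfolding M'_def using ndM nowhere_dense_translate[OF ndM] by (cases p) auto
    have less: "|(UNIV :: bool set) \<times> I| <o |UNIV :: real set|"
      by (rule ordLess_Times[OF infR finite_ordLess_infinite_set[OF _ infR] I]) simp
    obtain x where x: "\<And>p. p \<in> (UNIV :: bool set) \<times> I \<Longrightarrow> x \<notin> M' p"
      using exists_point_avoiding_nowhere_dense[where M = M', OF cov less ndM'] by blast
    have av: "x \<notin> M i \<and> x + g \<notin> M i" if "i \<in> I" for i
      using x[of "(True, i)"] x[of "(False, i)"] that unfolding M'_def by simp
    have "x \<notin> F \<and> x + g \<notin> F"
      using av[of "Inr x"] av[of "Inr (x + g)"] unfolding M_def I_def by auto
    moreover have "x \<notin> N j n \<and> x + g \<notin> N j n" if "j \<in> J" for j n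
      using av[of "Inl (j, n)"] that unfolding M_def I_def by auto
    ultimately show ?thesis unfolding \<Phi>_def by blast
  qed
  obtain x where x: "\<And>i. \<Phi> (before i) (stage_points T x (before i)) (stage_shift T i) (x i)"
    and apart: "\<And>t. t \<in> T \<Longrightarrow> stage_points T x UNIV \<inter> (+) t ` stage_points T x UNIV = {}"
    and large: "\<And>g. g \<notin> T \<Longrightarrow> |stage_points T x UNIV| \<le>o |stage_points T x UNIV \<inter> (+) g ` stage_points T x UNIV|"
    by (rule transfinite_construction[where T = T and \<Phi> = \<Phi>, OF inf T T0 T_less step]) (assumption | rule that)+
  define A where "A = stage_points T x UNIV"
  have ne: "A \<noteq> {}" unfolding A_def stage_points_def by auto
  have null: "universally_null A"
    unfolding universally_null_def
  proof (intro allI impI)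
    fix \<mu> :: "'a measure" assume "borel_prob \<mu> \<and> (\<forall>x. emeasure \<mu> {x} = 0)"
    then have \<mu>: "borel_prob \<mu>" "\<And>x. emeasure \<mu> {x} = 0" by auto
    obtain c :: "nat \<Rightarrow> nat set" where c: "\<And>n. nowhere_dense (- (\<Union>l\<in>c n. U l))" "(\<Inter>n. \<Union>l\<in>c n. U l) \<in> null_sets (completion \<mu>)"
      using exists_meager_conull[OF \<mu> U] by blast
    obtain j where j: "code j = c" using code by (metis UNIV_I imageE)
    have Nj: "N j n = - (\<Union>l\<in>c n. U l)" for n unfolding N_def j using c(1) by simp
    define L where "L = insert j (before j)"
    have pairs: "|UNIV :: ('a \<times> 'a) set| =o |UNIV :: 'a set|" using card_of_Times_same_infinite[OF inf] by simp
    have "|L| <o |UNIV :: 'a set|"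
    proof -
      have "|{j} \<union> before j| <o |UNIV :: 'a set|"
        by (intro card_of_Un_ordLess_infinite inf finite_ordLess_infinite_set ordLess_ordIso_trans[OF card_before pairs]) simp
      then show ?thesis unfolding L_def by simp
    qed
    then have "|stage_points T x L| <o cov_meager"
      using ordLess_ordIso_trans[OF to_real[OF card_stage_points_less[OF inf]] ordIso_symmetric[OF cov]] by blast
    then have "stage_points T x L \<in> null_sets (completion \<mu>)" by (rule null_if_card_less_cov_meager[OF \<mu>])
    then have un: "(\<Inter>n. \<Union>l\<in>c n. U l) \<union> stage_points T x L \<in> null_sets (completion \<mu>)" using c(2) by (intro null_sets.Un)
    have "A \<subseteq> (\<Inter>n. \<Union>l\<in>c n. U l) \<union> stage_points T x L"
    proof
      fix a assume "a \<in> A"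
      then obtain i where i: "a \<in> {x i, x i + stage_shift T i}" unfolding A_def stage_points_def by blast
      show "a \<in> (\<Inter>n. \<Union>l\<in>c n. U l) \<union> stage_points T x L"
      proof (cases "i \<in> L")
        case True
        then show ?thesis using i unfolding stage_points_def by blast
      next
        case False
        then have "j \<in> before i" using before_total[of i j] unfolding L_def by blast
        then have "a \<notin> N j n" for n using x[of i] i unfolding \<Phi>_def by blast
        then show ?thesis unfolding Nj by blast
      qed
    qed
    then show "A \<in> null_sets (completion \<mu>)"
      using un by (metis null_sets_completion_subset completion.complete_measure_axioms complete_measure.complete)
  qed
  have apartA: "A \<inter> (+) t ` A = {}" if "t \<in> T" for t using apart[OF that] unfolding A_def .
  have largeA: "|A| \<le>o |A \<inter> (+) g ` A|" if "g \<notin> T" for g using large[OF that] unfolding A_def .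
  have K: "|K| \<le>o \<kappa>" if "clique T K" for K using S(3) that unfolding T_def .
  have C: "clique T S" unfolding T_def by (rule clique_difference_set_self)
  have "packing_index A =o \<kappa>" "almost_packing_index A =o \<kappa>"
    using packing_indices_eq[of T A \<kappa> S] apartA largeA ne \<kappa> C S(1) K by blast+
  then show ?thesis using ne null by blast
qed

section \<open>Sets of prescribed packing index\<close>

lemma mem_torsion2: "x \<in> torsion 2 \<longleftrightarrow> x + x = 0"
  unfolding torsion_def by (simp add: numeral_2_eq_2)

lemma mem_torsion3: "x \<in> torsion 3 \<longleftrightarrow> x + x + x = 0"
  unfolding torsion_def by (simp add: numeral_3_eq_3 add.assoc)

text \<open>
  The cosets of the elements of order at most two correspond to the values of \<open>2x\<close>. With more
  than two cosets, \<open>2x\<close> takes two different nonzero values, which is what the hexagon needs.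
\<close>

lemma card_cosets_torsion2:
  assumes "\<nexists>a b::'a::ab_group_add. a + a \<noteq> 0 \<and> b + b \<noteq> 0 \<and> a + a \<noteq> b + b"
  shows "|cosets (torsion 2 :: 'a set)| \<le>o |{..<2::nat}|"
proof -
  have eq: "(+) x ` torsion 2 = (+) y ` torsion 2" if xy: "x + x = y + y" for x y :: 'a
  proof -
    have "(+) x ` torsion 2 \<subseteq> (+) y ` torsion 2" if "x + x = y + y" for x y :: 'a
    proof
      fix z assume "z \<in> (+) x ` torsion 2"
      then obtain h where h: "h + h = 0" "z = x + h" by (auto simp: mem_torsion2)
      have "(x - y + h) + (x - y + h) = (x + x) - (y + y) + (h + h)" by (simp add: algebra_simps)
      then have "x - y + h \<in> torsion 2" using that h by (simp add: mem_torsion2)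
      moreover have "z = y + (x - y + h)" using h by simp
      ultimately show "z \<in> (+) y ` torsion 2" by blast
    qed
    then show ?thesis using xy by (metis subset_antisym)
  qed
  obtain a :: 'a where a: "\<And>b::'a. b + b \<noteq> 0 \<Longrightarrow> b + b = a + a" using assms by metis
  have "cosets (torsion 2 :: 'a set) \<subseteq> {(+) 0 ` torsion 2, (+) a ` torsion 2}"
  proof
    fix C assume "C \<in> cosets (torsion 2 :: 'a set)"
    then obtain b :: 'a where b: "C = (+) b ` torsion 2" unfolding cosets_def by blast
    show "C \<in> {(+) 0 ` torsion 2, (+) a ` torsion 2}"
      using eq[of b 0] eq[of b a] a[of b] unfolding b by (cases "b + b = 0") auto
  qed
  moreover have "finite {(+) 0 ` torsion 2, (+) a ` torsion 2}" "card {(+) 0 ` torsion 2, (+) a ` torsion 2} \<le> 2"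
    by (auto simp: card_insert_if)
  ultimately have "finite (cosets (torsion 2 :: 'a set))" "card (cosets (torsion 2 :: 'a set)) \<le> 2"
    using finite_subset card_mono order_trans by metis+
  then show ?thesis by (subst finite_card_ordLeq_iff) auto
qed

theorem corollary1:
  fixes \<kappa> :: "'k rel"
  assumes non_discrete:
      "(euclidean :: 'a::{polish_space, topological_ab_group_add} topology) \<noteq> discrete_topology UNIV"
    and cardinal: "Card_order \<kappa>"
    and i: "|{..<1::nat}| \<le>o \<kappa>" "\<kappa> \<le>o |UNIV :: 'a set|"
    and ii: "(UNIV :: 'a set) = torsion 3 \<Longrightarrow> \<not> \<kappa> =o |{..<2::nat}|"
    and iii: "|cosets (torsion 2 :: 'a set)| \<le>o |{..<2::nat}| \<Longrightarrow> \<not> \<kappa> =o |{..<3::nat}|"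
  shows "(\<exists>A :: 'a set. A \<noteq> {} \<and> nowhere_dense A \<and> haar_null A \<and>
            packing_index A =o \<kappa> \<and> almost_packing_index A =o \<kappa>) \<and>
         (cov_meager =o |UNIV :: real set| \<longrightarrow>
           (\<exists>A :: 'a set. A \<noteq> {} \<and> universally_null A \<and>
              packing_index A =o \<kappa> \<and> almost_packing_index A =o \<kappa>))"
proof -
  have iso: "\<not> open {x}" for x :: 'a by (rule not_open_singleton[OF non_discrete])
  obtain P Q W :: "'a set" and \<mu> :: "'a measure" where
    many: "\<And>g. \<exists>x :: nat set \<Rightarrow> 'a. inj x \<and> (\<forall>\<tau>. x \<tau> \<in> Q \<and> x \<tau> + g \<in> W)"
    and \<mu>: "borel_prob \<mu>" "\<And>x. emeasure \<mu> {x} = 0"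
    by (rule exists_nowhere_dense_with_small_test_set[OF iso]) (rule that)
  obtain f :: "nat set \<Rightarrow> 'a" where f: "inj f" using many[of 0] by blast
  have unc: "uncountable (UNIV :: 'a set)" by (rule uncountable_if_inj_nat_sets[OF f])
  have cont: "|UNIV :: nat set set| \<le>o |UNIV :: 'a set|"
    using f card_of_ordLeq[of "UNIV :: nat set set" "UNIV :: 'a set"] by blast
  consider "\<kappa> =o |UNIV :: 'a set|" | "\<kappa> <o |UNIV :: 'a set|" using i(2) ordLeq_iff_ordLess_or_ordIso by blast
  then show ?thesis
  proof cases
    case 1
    have sub: "{0 :: 'a} \<in> null_sets (completion \<nu>)" if "borel_prob \<nu>" "\<And>x. emeasure \<nu> {x} = 0" for \<nu>
      by (rule null_sets_completionI[OF finite_null[OF that]]) simp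
    have "universally_null {0 :: 'a}" unfolding universally_null_def using sub by blast
    moreover have "haar_null {0 :: 'a}"
      by (rule haar_null_if_finite_traces[of \<mu> UNIV]) (use \<mu> in auto)
    moreover have "nowhere_dense {0 :: 'a}" by (rule nowhere_dense_singleton[OF iso])
    moreover have "packing_index {0 :: 'a} =o \<kappa>" "almost_packing_index {0 :: 'a} =o \<kappa>"
    proof -
      have T: "{0} \<inter> (+) t ` {0} = {}" if "t \<in> UNIV - {0}" for t :: 'a using that by auto
      have G: "|{0 :: 'a}| \<le>o |{0} \<inter> (+) g ` {0}|" if "g \<notin> UNIV - {0}" for g :: 'a
        using that by (intro card_of_mono1) auto
      have C: "clique (UNIV - {0}) (UNIV :: 'a set)" unfolding clique_def by auto
      have K: "|K| \<le>o \<kappa>" for K :: "'a set"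
        by (rule ordLeq_ordIso_trans[OF card_of_mono1[OF subset_UNIV] ordIso_symmetric[OF 1]])
      show "packing_index {0 :: 'a} =o \<kappa>" "almost_packing_index {0 :: 'a} =o \<kappa>"
        by (rule packing_indices_eq[OF T G _ cardinal C ordIso_symmetric[OF 1] K]; simp)+
    qed
    ultimately show ?thesis by (intro conjI impI exI[of _ "{0 :: 'a}"]) auto
  next
    case 2
    have two: "\<exists>t::'a. t + t + t \<noteq> 0" if "\<kappa> =o |{..<2::nat}|"
    proof (rule ccontr)
      assume "\<not> ?thesis"
      then have "(UNIV :: 'a set) = torsion 3" by (auto simp: mem_torsion3)
      then show False using ii that by blast
    qed
    have three: "\<exists>a b::'a. a + a \<noteq> 0 \<and> b + b \<noteq> 0 \<and> a + a \<noteq> b + b" if "\<kappa> =o |{..<3::nat}|"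
      using card_cosets_torsion2 iii that by blast
    obtain S :: "'a set" where S: "|S| =o \<kappa>" "|difference_set S| <o |UNIV :: 'a set|"
      "\<And>K. clique (difference_set S) K \<Longrightarrow> |K| \<le>o \<kappa>"
      using exists_clique_set[OF unc cardinal i(1) 2 two three] by blast
    show ?thesis
      using exists_haar_null_with_index[OF iso cardinal S] exists_universally_null_with_index[OF iso unc _ cont cardinal S]
      by blast
  qed
qed

end
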